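(* Assume the Gaussian prior, the infinite-channel regime and the exponential growth condition. Then for every $\ell=1,\dots,L+1$ and every fixed positive integer $C$ (with $C\le C_{L+1}$ if $\ell=L+1$), as $n\to\infty$, $$\big[h^{(\ell)}_{c,i}(\mathbf x_\mu): i=1,\dots,N_\ell;\ c=1,\dots,C;\ \mu=1,\dots,P\big]\xrightarrow{\ \mathcal L\ }\tilde Z=[\tilde Z_{i,c,\mu}],$$ where $\tilde Z$ is a centered Gaussian array with covariance $\operatorname{Cov}(\tilde Z_{i,c,\mu},\tilde Z_{j,c',\nu})=\delta_{c,c'}\mathbf K^{(\ell)}_{(i,\mu),(j,\nu)}$ (i.e. covariance $\mathbf I_C\otimes\mathbf K^{(\ell)}$), and $\mathbf K^{(1)},\dots,\mathbf K^{(L+1)}$ are the deterministic matrices given by $\mathbf K^{(1)}$ in the context and the recursion $\mathbf K^{(\ell+1)}_{(i,\mu),(j,\nu)}=\frac{1}{\lambda_\ell M_\ell}\sum_{m\in\mathcal M_\ell}\mathbf E[\sigma(R^{(i,\ell)}_m(Z^{(\ell)}_{:,\mu}))\sigma(R^{(j,\ell)}_m(Z^{(\ell)}_{:,\nu}))]$, $Z^{(\ell)}\sim\mathcal N(\mathbf 0,\mathbf K^{(\ell)})$.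
   Context: Convolutional network. Fix integers $L\ge1$, $P\ge1$, channel numbers $C_0,\dots,C_{L+1}\ge1$, spatial sizes $N_0,\dots,N_{L+1}\ge1$, a measurable activation $\sigma:\mathbb R\to\mathbb R$, finite nonempty index sets $\mathcal M_\ell$ of cardinality $M_\ell$ ($\ell=0,\dots,L$), measurable "patch extractors" $R^{(i,\ell)}=(R^{(i,\ell)}_m)_{m\in\mathcal M_\ell}:\mathbb R^{N_\ell}\to\mathbb R^{M_\ell}$ ($\ell=0,\dots,L$, $i=1,\dots,N_{\ell+1}$), and constants $\lambda_\ell>0$. Gaussian prior: the weights $W^{(\ell)}_{m,c',c}$ ($\ell=0,\dots,L$, $m\in\mathcal M_\ell$, $c'=1,\dots,C_\ell$, $c=1,\dots,C_{\ell+1}$) are independent with $W^{(\ell)}_{m,c',c}\sim\mathcal N(0,\lambda_\ell^{-1})$. For an input $\mathbf x=(x_{c,i})\in\mathbb R^{C_0\times N_0}$ write $x_{c,:}=(x_{c,1},\dots,x_{c,N_0})$. The preactivations are $h^{(1)}_{c,i}(\mathbf x)=\frac{1}{\sqrt{M_0C_0}}\sum_{c'=1}^{C_0}\sum_{m\in\mathcal M_0}W^{(0)}_{m,c',c}R^{(i,0)}_m(x_{c',:})$ and, for $\ell=1,\dots,L$, $h^{(\ell+1)}_{c,i}(\mathbf x)=\frac{1}{\sqrt{M_\ell C_\ell}}\sum_{c'=1}^{C_\ell}\sum_{m\in\mathcal M_\ell}W^{(\ell)}_{m,c',c}\,\sigma\big(R^{(i,\ell)}_m(h^{(\ell)}_{c',:}(\mathbf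 x))\big)$, $c=1,\dots,C_{\ell+1}$, $i=1,\dots,N_{\ell+1}$, where $h^{(\ell)}_{c,:}=(h^{(\ell)}_{c,1},\dots,h^{(\ell)}_{c,N_\ell})$. Fix inputs $\mathbf x_1,\dots,\mathbf x_P$ with entries $x_{\mu,c,i}$. Set $D_\ell=N_\ell P$. Index pairs $(i,\mu)$ are flattened to the single index $\mu+(i-1)P$, so arrays indexed by $((i,\mu),(j,\nu))$ are identified with $D_\ell\times D_\ell$ matrices and $z=(z_{i,\mu})\in\mathbb R^{N_\ell\times P}$ with vectors of $\mathbb R^{D_\ell}$; $z_{:,\mu}=(z_{1,\mu},\dots,z_{N_\ell,\mu})$. Define $\mathbf K^{(1)}_{(i,\mu),(j,\nu)}=\frac{1}{\lambda_0C_0M_0}\sum_{c=1}^{C_0}\sum_{m\in\mathcal M_0}R^{(i,0)}_m(x_{\mu,c,:})R^{(j,0)}_m(x_{\nu,c,:})$. Infinite-channel regime: $L,N_0,\dots,N_{L+1},C_0,C_{L+1},P$ are fixed, while for $\ell=1,\dots,L$, $C_\ell=C_\ell(n)$ depends on $n\ge1$ with $C_\ell(n)/n\to\alpha_\ell\in(0,\infty)$. Exponential growth condition: $\sigma$ and every $R^{(i,\ell)}$ ($\ell=1,\dots,L$) are continuous, and there are constants $0\le r_\sigma<2$, $A_\sigma,B_\sigma\in(0,\infty)$ with $|\sigma(R^{(i,\ell)}_m(z))|\le A_\sigma e^{B_\sigma\|z\|^{r_\sigma}}$ for all $z\in\mathbb R^{N_\ell}$ and all $\ell=1,\dots,L$,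 $i$, $m$. *)

theory Defs
  imports "HOL-Probability.Probability"
begin

text \<open>Vectors of R^I (I finite) are represented as extensional functions, i.e. elements of
  PiE I (\<lambda>_. UNIV), the space of the product measure PiM I (\<lambda>_. borel); the
  topology is the product topology (= Euclidean topology for finite I).\<close>

text \<open>Centered Gaussian probability measure on R^I with covariance matrix S,
  characterised by its characteristic function (covers degenerate covariances).\<close>
definition centered_gaussian ::
  "'i set \<Rightarrow> ('i \<Rightarrow> 'i \<Rightarrow> real) \<Rightarrow> ('i \<Rightarrow> real) measure \<Rightarrow> bool" where
  "centered_gaussian I S \<mu> \<longleftrightarrow>
     prob_space \<mu> \<and> sets \<mu> = sets (PiM I (\<lambda>_. borel)) \<and>
     (\<forall>t::'i \<Rightarrow> real.
        integral\<^sup>L \<mu> (\<lambda>z. cis (\<Sum>k\<in>I. t k * z k))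
        = complex_of_real (exp (- (\<Sum>k\<in>I. \<Sum>l\<in>I. t k * S k l * t l) / 2)))"

definition conv_law ::
  "'i set \<Rightarrow> (nat \<Rightarrow> 'o measure) \<Rightarrow> (nat \<Rightarrow> 'o \<Rightarrow> 'i \<Rightarrow> real) \<Rightarrow> ('i \<Rightarrow> real) measure \<Rightarrow> bool" where
  "conv_law I \<Omega> X \<mu> \<longleftrightarrow>
     (\<forall>g :: ('i \<Rightarrow> real) \<Rightarrow> real.
        g \<in> borel_measurable (PiM I (\<lambda>_. borel)) \<longrightarrow>
        bounded (g ` PiE I (\<lambda>_. UNIV)) \<longrightarrow>
        continuous_on (PiE I (\<lambda>_. UNIV)) g \<longrightarrow>
        ((\<lambda>n. \<integral>\<omega>. g (X n \<omega>) \<partial>(\<Omega> n)) \<longlonglongrightarrow> (\<integral>z. g z \<partial>\<mu>)))"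

text \<open>Preactivations h^(l)_{c,i}(x_p) of the CNN for one realisation W of the weights.
  Cs l = C_l, N l = N_l, Ms l = \<M>_l, R l i m z = R^(i,l)_m(z), x p c = x_{p,c,:}
  (as function of the spatial index), W (l,m,c',c) = W^(l)_{m,c',c}.
  Channels, spatial positions and inputs are indexed from 1.\<close>
fun preact ::
  "(nat \<Rightarrow> nat) \<Rightarrow> (nat \<Rightarrow> nat) \<Rightarrow> (nat \<Rightarrow> 'm set) \<Rightarrow> (real \<Rightarrow> real)
   \<Rightarrow> (nat \<Rightarrow> nat \<Rightarrow> 'm \<Rightarrow> (nat \<Rightarrow> real) \<Rightarrow> real) \<Rightarrow> (nat \<Rightarrow> nat \<Rightarrow> nat \<Rightarrow> real)
   \<Rightarrow> (nat \<times> 'm \<times> nat \<times> nat \<Rightarrow> real) \<Rightarrow> nat \<Rightarrow> nat \<Rightarrow> nat \<Rightarrow> nat \<Rightarrow> real" where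
  "preact Cs N Ms \<sigma> R x W 0 c i p = 0"
| "preact Cs N Ms \<sigma> R x W (Suc 0) c i p =
     1 / sqrt (real (card (Ms 0)) * real (Cs 0)) *
     (\<Sum>c'\<in>{1..Cs 0}. \<Sum>m\<in>Ms 0. W (0, m, c', c) * R 0 i m (restrict (x p c') {1..N 0}))"
| "preact Cs N Ms \<sigma> R x W (Suc (Suc l)) c i p =
     1 / sqrt (real (card (Ms (Suc l))) * real (Cs (Suc l))) *
     (\<Sum>c'\<in>{1..Cs (Suc l)}. \<Sum>m\<in>Ms (Suc l).
        W (Suc l, m, c', c) *
        \<sigma> (R (Suc l) i m (restrict (\<lambda>j. preact Cs N Ms \<sigma> R x W (Suc l) c' j p) {1..N (Suc l)})))"

fun kernel ::
  "nat \<Rightarrow> nat \<Rightarrow> (nat \<Rightarrow> nat) \<Rightarrow> (nat \<Rightarrow> 'm set) \<Rightarrow> (nat \<Rightarrow> real) \<Rightarrow> (real \<Rightarrow> real)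
   \<Rightarrow> (nat \<Rightarrow> nat \<Rightarrow> 'm \<Rightarrow> (nat \<Rightarrow> real) \<Rightarrow> real) \<Rightarrow> (nat \<Rightarrow> nat \<Rightarrow> nat \<Rightarrow> real)
   \<Rightarrow> nat \<Rightarrow> nat \<times> nat \<Rightarrow> nat \<times> nat \<Rightarrow> real" where
  "kernel P C0 N Ms lam \<sigma> R x 0 = (\<lambda>_ _. 0)"
| "kernel P C0 N Ms lam \<sigma> R x (Suc 0) = (\<lambda>(i, p) (j, q).
     1 / (lam 0 * real C0 * real (card (Ms 0))) *
     (\<Sum>c\<in>{1..C0}. \<Sum>m\<in>Ms 0.
        R 0 i m (restrict (x p c) {1..N 0}) * R 0 j m (restrict (x q c) {1..N 0})))"
| "kernel P C0 N Ms lam \<sigma> R x (Suc (Suc l)) =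
     (let Zlaw = (SOME \<mu>. centered_gaussian ({1..N (Suc l)} \<times> {1..P})
                              (kernel P C0 N Ms lam \<sigma> R x (Suc l)) \<mu>)
      in (\<lambda>(i, p) (j, q).
           1 / (lam (Suc l) * real (card (Ms (Suc l)))) *
           (\<Sum>m\<in>Ms (Suc l).
              \<integral>z. \<sigma> (R (Suc l) i m (restrict (\<lambda>a. z (a, p)) {1..N (Suc l)})) *
                  \<sigma> (R (Suc l) j m (restrict (\<lambda>a. z (a, q)) {1..N (Suc l)})) \<partial>Zlaw)))"

definition kron_cov :: "(nat \<times> nat \<Rightarrow> nat \<times> nat \<Rightarrow> real) \<Rightarrow> nat \<times> nat \<times> nat \<Rightarrow> nat \<times> nat \<times> nat \<Rightarrow> real" where
  "kron_cov K = (\<lambda>(i, c, p) (j, c', q). if c = c' then K (i, p) (j, q) else 0)"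

definition gpow :: "real \<Rightarrow> real \<Rightarrow> real" where
  "gpow y r = (if r = 0 then 1 else y powr r)"

end

theory Submission
  imports Defs
begin

text \<open>Given the weights of the layers below, the preactivations of layer \<open>l + 1\<close> are exactly Gaussian:
  the channels are independent copies of \<open>N(0, S)\<close>, where the random matrix \<open>S\<close> is an average over
  the channels of layer \<open>l\<close> of a function of the preactivations of that layer. So it suffices that \<open>S\<close>
  converges in probability to the kernel, and this follows by induction on \<open>l\<close> from Chebyshev's
  inequality conditionally on the lower layers, because \<open>S \<mapsto> E g(N(0, S))\<close> is continuous.
  As the expectation of \<open>g\<close> may be infinite once \<open>S\<close> is averaged over the weights (the entries of \<open>S\<close>
  have heavy tails), moments are only taken conditionally, on the event that \<open>S\<close> is close to the
  kernel. There \<open>r < 2\<close> makes the growth of \<open>g\<close> slower than \<open>exp (\<eta> |z|\<^sup>2)\<close> for every \<open>\<eta> > 0\<close>, which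
  bounds all moments of \<open>g\<close> uniformly in the covariance. Continuity in \<open>S\<close> is a multivariate Levy
  theorem for Gaussian measures, obtained from the Stone-Weierstrass theorem.\<close>

subsection \<open>Gaussian measures\<close>

text \<open>Two features shape the argument. All widths grow at once, so no layer can be sent to its
  limit before the next one: the constants of the concentration estimate must not depend on the
  widths, and the failure probability of a layer is bounded by that of the layer below plus a
  constant over the width. Moreover, a Gaussian measure is given only by its characteristic
  function, with a possibly singular covariance, so there is no joint density to work with. Moment
  bounds therefore go through one-dimensional marginals, and two Gaussian measures with equal
  covariance are compared only on integrals of the functions at hand, where agreement is a special
  case of continuity. The kernel recursion picks its Gaussian law with \<open>SOME\<close>; that
  this choice is meaningful has to be proved along the recursion, from positive semidefiniteness and
  an explicit construction out of independent normals. The same construction yields the conditional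
  laws of the layers. Conditioning itself is Fubini on the product law of the weights, split into
  one layer and the rest.\<close>

lemma centered_gaussianD:
  assumes "centered_gaussian I S \<mu>"
  shows "prob_space \<mu>" "sets \<mu> = sets (PiM I (\<lambda>_. borel))" "space \<mu> = PiE I (\<lambda>_. UNIV)"
    "\<And>t. integral\<^sup>L \<mu> (\<lambda>z. cis (\<Sum>k\<in>I. t k * z k))
        = complex_of_real (exp (- (\<Sum>k\<in>I. \<Sum>l\<in>I. t k * S k l * t l) / 2))"
  using assms sets_eq_imp_space_eq[of \<mu> "PiM I (\<lambda>_. borel)"]
  by (auto simp: centered_gaussian_def space_PiM)

lemma measurable_centered_gaussian_cong:
  assumes "centered_gaussian I S \<mu>"
  shows "measurable \<mu> N = measurable (PiM I (\<lambda>_. borel)) N"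
  by (intro measurable_cong_sets centered_gaussianD[OF assms] refl)

lemma cis_borel_measurable [measurable]: "cis \<in> borel_measurable borel"
  by (intro borel_measurable_continuous_onI continuous_on_cis continuous_on_id)

lemma centered_gaussian_integrable_cis:
  assumes "centered_gaussian I S \<mu>"
  shows "integrable \<mu> (\<lambda>z. cis (\<Sum>k\<in>I. t k * z k))"
proof -
  interpret prob_space \<mu> by (rule centered_gaussianD[OF assms])
  show ?thesis
    by (rule integrable_const_bound[of _ 1])
       (simp_all add: measurable_centered_gaussian_cong[OF assms])
qed

text \<open>A characteristic function has modulus at most 1, so the exponent on the right of its
  Gaussian formula cannot be positive.\<close>

lemma centered_gaussian_quadratic_nonneg:
  assumes "centered_gaussian I S \<mu>"
  shows "0 \<le> (\<Sum>k\<in>I. \<Sum>l\<in>I. t k * S k l * t l)"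
proof -
  interpret prob_space \<mu> by (rule centered_gaussianD[OF assms])
  have "norm (integral\<^sup>L \<mu> (\<lambda>z. cis (\<Sum>k\<in>I. t k * z k)))
      \<le> integral\<^sup>L \<mu> (\<lambda>z. norm (cis (\<Sum>k\<in>I. t k * z k)))"
    by (rule integral_norm_bound)
  also have "\<dots> = 1" by (simp add: prob_space)
  finally show ?thesis
    unfolding centered_gaussianD(4)[OF assms] by (simp add: norm_exp del: of_real_exp)
qed

lemma quadratic_form_single:
  fixes S :: "'i \<Rightarrow> 'i \<Rightarrow> real"
  assumes "finite I" "k \<in> I"
  shows "(\<Sum>j\<in>I. \<Sum>l\<in>I. (if j = k then t else 0) * S j l * (if l = k then t else 0)) = t\<^sup>2 * S k k"
proof -
  have "(\<Sum>j\<in>I. \<Sum>l\<in>I. (if j = k then t else 0) * S j l * (if l = k then t else 0))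
      = (\<Sum>j\<in>I. \<Sum>l\<in>I. if l = k then (if j = k then t * S k k * t else 0) else 0)"
    by (intro sum.cong refl) auto
  also have "\<dots> = t * S k k * t" using assms by simp
  finally show ?thesis by (simp add: power2_eq_square)
qed

lemma centered_gaussian_diag_nonneg:
  assumes "centered_gaussian I S \<mu>" "finite I" "k \<in> I"
  shows "0 \<le> S k k"
  using centered_gaussian_quadratic_nonneg[OF assms(1), of "\<lambda>j. if j = k then 1 else 0"]
  by (simp only: quadratic_form_single[OF assms(2,3)]) simp

text \<open>Levy uniqueness on the line: both sides have the characteristic function
  \<open>exp (- t\<^sup>2 * S k k / 2)\<close>. Writing the marginal as a scaled standard normal,
  not by a density, includes the point mass that arises when \<open>S k k = 0\<close>.\<close>

lemma centered_gaussian_marginal: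
  assumes cg: "centered_gaussian I S \<mu>" and I: "finite I" "k \<in> I"
  shows "distr \<mu> borel (\<lambda>z. z k) = distr std_normal_distribution borel (\<lambda>x. sqrt (S k k) * x)"
proof (rule Levy_uniqueness)
  interpret prob_space \<mu> by (rule centered_gaussianD[OF cg])
  have m: "(\<lambda>z. z k) \<in> borel_measurable \<mu>"
    unfolding measurable_centered_gaussian_cong[OF cg] using I(2) by simp
  show "real_distribution (distr \<mu> borel (\<lambda>z. z k))"
    by (intro real_distribution.intro real_distribution_axioms.intro prob_space_distr m) simp_all
  interpret n: real_distribution std_normal_distribution by (rule real_dist_normal_dist)
  show "real_distribution (distr std_normal_distribution borel (\<lambda>x. sqrt (S k k) * x))"
    by (intro real_distribution.intro real_distribution_axioms.intro n.prob_space_distr) simp_all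
  show "char (distr \<mu> borel (\<lambda>z. z k)) = char (distr std_normal_distribution borel (\<lambda>x. sqrt (S k k) * x))"
  proof
    fix t
    have "char (distr \<mu> borel (\<lambda>z. z k)) t = integral\<^sup>L \<mu> (\<lambda>z. iexp (t * z k))"
      unfolding char_def by (subst integral_distr[OF m]) simp_all
    also have "\<dots> = integral\<^sup>L \<mu> (\<lambda>z. cis (\<Sum>j\<in>I. (if j = k then t else 0) * z j))"
      using I by (simp add: cis_conv_exp if_distrib[where f="\<lambda>x. x * _"] cong: if_cong)
    also have "\<dots> = complex_of_real (exp (- (t\<^sup>2 * S k k) / 2))"
      unfolding centered_gaussianD(4)[OF cg] quadratic_form_single[OF I] ..
    also have "\<dots> = char std_normal_distribution (t * sqrt (S k k))"
      unfolding char_std_normal_distribution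
      using centered_gaussian_diag_nonneg[OF cg I] by (simp add: power_mult_distrib)
    also have "\<dots> = char (distr std_normal_distribution borel (\<lambda>x. sqrt (S k k) * x)) t"
      unfolding char_def by (subst integral_distr) (simp_all add: mult.assoc)
    finally show "char (distr \<mu> borel (\<lambda>z. z k)) t
      = char (distr std_normal_distribution borel (\<lambda>x. sqrt (S k k) * x)) t" .
  qed
qed

text \<open>Against the standard normal density the exponent is at most
  \<open>- x\<^sup>2 / 2 + x\<^sup>2 / 4 = - x\<^sup>2 / 4\<close>, and this is
  \<open>sqrt 2\<close> times the density of a normal variable of variance 2. The bound 1/4 stays
  strictly below the critical value 1/2, which gives a constant independent of the variance.\<close>

lemma centered_gaussian_exp_square:
  assumes cg: "centered_gaussian I S \<mu>" and I: "finite I" "k \<in> I"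
    and \<theta>: "\<theta> * S k k \<le> 1 / 4"
  shows "(\<integral>\<^sup>+z. ennreal (exp (\<theta> * (z k)\<^sup>2)) \<partial>\<mu>) \<le> ennreal (sqrt 2)"
proof -
  have m: "(\<lambda>z. z k) \<in> borel_measurable \<mu>"
    unfolding measurable_centered_gaussian_cong[OF cg] using I(2) by simp
  have "(\<integral>\<^sup>+z. ennreal (exp (\<theta> * (z k)\<^sup>2)) \<partial>\<mu>)
      = (\<integral>\<^sup>+y. ennreal (exp (\<theta> * y\<^sup>2)) \<partial>(distr \<mu> borel (\<lambda>z. z k)))"
    by (subst nn_integral_distr[OF m]) simp_all
  also have "\<dots> = (\<integral>\<^sup>+x. ennreal (exp (\<theta> * (sqrt (S k k) * x)\<^sup>2)) \<partial>std_normal_distribution)"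
    unfolding centered_gaussian_marginal[OF cg I] by (subst nn_integral_distr) simp_all
  also have "\<dots> = (\<integral>\<^sup>+x. ennreal (std_normal_density x) * ennreal (exp (\<theta> * (sqrt (S k k) * x)\<^sup>2)) \<partial>lborel)"
    by (subst nn_integral_density) simp_all
  also have "\<dots> \<le> (\<integral>\<^sup>+x. ennreal (sqrt 2) * ennreal (normal_density 0 (sqrt 2) x) \<partial>lborel)"
  proof (rule nn_integral_mono)
    fix x :: real
    have "std_normal_density x * exp (\<theta> * (sqrt (S k k) * x)\<^sup>2)
        = 1 / sqrt (2 * pi) * exp (- x\<^sup>2 / 2 + \<theta> * S k k * x\<^sup>2)"
      using centered_gaussian_diag_nonneg[OF cg I]
      by (simp add: std_normal_density_def exp_add[symmetric] power_mult_distrib exp_diff)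
         (simp add: exp_minus field_simps exp_add[symmetric])
    also have "\<dots> \<le> 1 / sqrt (2 * pi) * exp (- x\<^sup>2 / 2 + 1 / 4 * x\<^sup>2)"
      by (intro mult_left_mono iffD2[OF exp_le_cancel_iff] add_left_mono mult_right_mono \<theta>) auto
    also have "\<dots> = sqrt 2 * normal_density 0 (sqrt 2) x"
      by (simp add: normal_density_def real_sqrt_mult field_simps)
    finally show "ennreal (std_normal_density x) * ennreal (exp (\<theta> * (sqrt (S k k) * x)\<^sup>2))
        \<le> ennreal (sqrt 2) * ennreal (normal_density 0 (sqrt 2) x)"
      by (simp add: ennreal_mult[symmetric])
  qed
  also have "\<dots> = ennreal (sqrt 2) * (\<integral>\<^sup>+x. ennreal (normal_density 0 (sqrt 2) x) \<partial>lborel)"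
    by (rule nn_integral_cmult) simp
  also have "(\<integral>\<^sup>+x. ennreal (normal_density 0 (sqrt 2) x) \<partial>lborel) = 1"
    using prob_space.emeasure_space_1[OF prob_space_normal_density[of "sqrt 2" 0]]
    by (simp add: emeasure_density)
  finally show ?thesis by simp
qed

subsection \<open>Functions of sub-Gaussian growth\<close>

text \<open>Quantifying over every \<eta>, with a constant depending on \<eta>, makes the class
  closed under products (use \<open>\<eta> / 2\<close> for each factor). A single fixed \<eta> would
  not survive the products of activations and the squares needed for second moments.\<close>

definition sub_gaussian_growth :: "'i set \<Rightarrow> (('i \<Rightarrow> real) \<Rightarrow> real) \<Rightarrow> bool" where
  "sub_gaussian_growth I g \<longleftrightarrow>
     (\<forall>\<eta>>0. \<exists>A. \<forall>z\<in>PiE I (\<lambda>_. UNIV). \<bar>g z\<bar> \<le> A * exp (\<eta> * (\<Sum>k\<in>I. (z k)\<^sup>2)))"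

lemma sub_gaussian_growthE:
  assumes "sub_gaussian_growth I g" "\<eta> > 0"
  obtains A where "A \<ge> 0" "\<And>z. z \<in> PiE I (\<lambda>_. UNIV) \<Longrightarrow> \<bar>g z\<bar> \<le> A * exp (\<eta> * (\<Sum>k\<in>I. (z k)\<^sup>2))"
proof -
  obtain A where A: "\<And>z. z \<in> PiE I (\<lambda>_. UNIV) \<Longrightarrow> \<bar>g z\<bar> \<le> A * exp (\<eta> * (\<Sum>k\<in>I. (z k)\<^sup>2))"
    using assms unfolding sub_gaussian_growth_def by blast
  have "\<bar>g z\<bar> \<le> \<bar>A\<bar> * exp (\<eta> * (\<Sum>k\<in>I. (z k)\<^sup>2))" if "z \<in> PiE I (\<lambda>_. UNIV)" for z
    using order.trans[OF A[OF that] mult_right_mono[of A "\<bar>A\<bar>"]] by simp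
  then show ?thesis by (intro that[of "\<bar>A\<bar>"]) auto
qed

lemma sub_gaussian_growth_mult:
  assumes "sub_gaussian_growth I f" "sub_gaussian_growth I g"
  shows "sub_gaussian_growth I (\<lambda>z. f z * g z)"
  unfolding sub_gaussian_growth_def
proof (intro allI impI)
  fix \<eta> :: real assume "\<eta> > 0"
  then have h: "\<eta> / 2 > 0" by simp
  obtain A where A: "A \<ge> 0" "\<And>z. z \<in> PiE I (\<lambda>_. UNIV) \<Longrightarrow> \<bar>f z\<bar> \<le> A * exp (\<eta> / 2 * (\<Sum>k\<in>I. (z k)\<^sup>2))"
    using sub_gaussian_growthE[OF assms(1) h] by blast
  obtain B where B: "B \<ge> 0" "\<And>z. z \<in> PiE I (\<lambda>_. UNIV) \<Longrightarrow> \<bar>g z\<bar> \<le> B * exp (\<eta> / 2 * (\<Sum>k\<in>I. (z k)\<^sup>2))"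
    using sub_gaussian_growthE[OF assms(2) h] by blast
  have "\<bar>f z * g z\<bar> \<le> A * B * exp (\<eta> * (\<Sum>k\<in>I. (z k)\<^sup>2))" if z: "z \<in> PiE I (\<lambda>_. UNIV)" for z
  proof -
    have "\<bar>f z * g z\<bar> \<le> (A * exp (\<eta> / 2 * (\<Sum>k\<in>I. (z k)\<^sup>2))) * (B * exp (\<eta> / 2 * (\<Sum>k\<in>I. (z k)\<^sup>2)))"
      unfolding abs_mult by (intro mult_mono A B z) (use A in auto)
    also have "\<dots> = A * B * exp (\<eta> / 2 * (\<Sum>k\<in>I. (z k)\<^sup>2) + \<eta> / 2 * (\<Sum>k\<in>I. (z k)\<^sup>2))"
      by (simp only: exp_add) (simp add: algebra_simps)
    also have "\<dots> = A * B * exp (\<eta> * (\<Sum>k\<in>I. (z k)\<^sup>2))" by (simp add: field_simps)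
    finally show ?thesis .
  qed
  then show "\<exists>A. \<forall>z\<in>PiE I (\<lambda>_. UNIV). \<bar>f z * g z\<bar> \<le> A * exp (\<eta> * (\<Sum>k\<in>I. (z k)\<^sup>2))" by blast
qed

lemma sub_gaussian_growth_add:
  assumes "sub_gaussian_growth I f" "sub_gaussian_growth I g"
  shows "sub_gaussian_growth I (\<lambda>z. f z + g z)"
  unfolding sub_gaussian_growth_def
proof (intro allI impI)
  fix \<eta> :: real assume h: "\<eta> > 0"
  obtain A where A: "A \<ge> 0" "\<And>z. z \<in> PiE I (\<lambda>_. UNIV) \<Longrightarrow> \<bar>f z\<bar> \<le> A * exp (\<eta> * (\<Sum>k\<in>I. (z k)\<^sup>2))"
    using sub_gaussian_growthE[OF assms(1) h] by blast
  obtain B where B: "B \<ge> 0" "\<And>z. z \<in> PiE I (\<lambda>_. UNIV) \<Longrightarrow> \<bar>g z\<bar> \<le> B * exp (\<eta> * (\<Sum>k\<in>I. (z k)\<^sup>2))"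
    using sub_gaussian_growthE[OF assms(2) h] by blast
  have "\<bar>f z + g z\<bar> \<le> (A + B) * exp (\<eta> * (\<Sum>k\<in>I. (z k)\<^sup>2))" if z: "z \<in> PiE I (\<lambda>_. UNIV)" for z
    using A(2)[OF z] B(2)[OF z] abs_triangle_ineq[of "f z" "g z"] by (simp add: distrib_right)
  then show "\<exists>A. \<forall>z\<in>PiE I (\<lambda>_. UNIV). \<bar>f z + g z\<bar> \<le> A * exp (\<eta> * (\<Sum>k\<in>I. (z k)\<^sup>2))" by blast
qed

lemma sub_gaussian_growth_bounded:
  assumes "\<And>z. z \<in> PiE I (\<lambda>_. UNIV) \<Longrightarrow> \<bar>g z\<bar> \<le> C"
  shows "sub_gaussian_growth I g"
  unfolding sub_gaussian_growth_def
proof (intro allI impI exI[of _ C] ballI)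
  fix \<eta> :: real and z assume "\<eta> > 0" and z: "z \<in> PiE I (\<lambda>_. UNIV :: real set)"
  then have "1 \<le> exp (\<eta> * (\<Sum>k\<in>I. (z k)\<^sup>2))" by (simp add: sum_nonneg)
  moreover have "0 \<le> C" "\<bar>g z\<bar> \<le> C" using assms[OF z] by linarith+
  ultimately show "\<bar>g z\<bar> \<le> C * exp (\<eta> * (\<Sum>k\<in>I. (z k)\<^sup>2))"
    using mult_left_mono[of 1 _ C] by fastforce
qed

lemma sub_gaussian_growth_sum:
  assumes "\<And>m. m \<in> M \<Longrightarrow> sub_gaussian_growth I (f m)"
  shows "sub_gaussian_growth I (\<lambda>z. \<Sum>m\<in>M. f m z)"
  using assms
proof (induction M rule: infinite_finite_induct)
  case (insert m M)
  then show ?case by (simp add: sub_gaussian_growth_add)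
qed (auto intro: sub_gaussian_growth_bounded[of _ _ 0])

text \<open>From \<open>y \<le> exp y\<close>. It supplies the uniform second moment that serves as
  a tightness estimate for Gaussian measures.\<close>

lemma sub_gaussian_growth_square_norm: "sub_gaussian_growth I (\<lambda>z. \<Sum>k\<in>I. (z k)\<^sup>2)"
  unfolding sub_gaussian_growth_def
proof (intro allI impI)
  fix \<eta> :: real assume h: "\<eta> > 0"
  have "\<bar>\<Sum>k\<in>I. (z k)\<^sup>2\<bar> \<le> 1 / \<eta> * exp (\<eta> * (\<Sum>k\<in>I. (z k)\<^sup>2))" for z :: "'a \<Rightarrow> real"
  proof -
    have "\<eta> * (\<Sum>k\<in>I. (z k)\<^sup>2) \<le> exp (\<eta> * (\<Sum>k\<in>I. (z k)\<^sup>2))"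
      using exp_ge_add_one_self[of "\<eta> * (\<Sum>k\<in>I. (z k)\<^sup>2)"] by linarith
    then show ?thesis using h by (simp add: sum_nonneg field_simps)
  qed
  then show "\<exists>A. \<forall>z\<in>PiE I (\<lambda>_. UNIV). \<bar>\<Sum>k\<in>I. (z k)\<^sup>2\<bar> \<le> A * exp (\<eta> * (\<Sum>k\<in>I. (z k)\<^sup>2))" by blast
qed

text \<open>The squared norm is at most \<open>card I\<close> times the largest squared coordinate,
  so the exponential of the norm is dominated by a sum of exponentials of single coordinates. Only
  the marginals enter, hence neither a density nor independence is required, and \<open>B\<close>
  depends on the covariance only through the bound \<open>M\<close> on its diagonal.\<close>

lemma sub_gaussian_growth_moment:
  fixes I :: "'i set"
  assumes I: "finite I" and g: "sub_gaussian_growth I g"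
    and gm: "g \<in> borel_measurable (PiM I (\<lambda>_. borel))"
  obtains B where "B \<ge> 0"
    "\<And>S \<mu>. centered_gaussian I S \<mu> \<Longrightarrow> (\<And>k. k \<in> I \<Longrightarrow> S k k \<le> M) \<Longrightarrow>
       integrable \<mu> g \<and> (\<integral>z. \<bar>g z\<bar> \<partial>\<mu>) \<le> B"
proof -
  define q where "q = real (card I)"
  \<comment> \<open>Chosen so that \<open>\<eta> * q * \<bar>M\<bar> \<le> 1 / 4\<close>; the two
    added ones keep the denominator positive when \<open>I\<close> is empty or \<open>M\<close>
    vanishes.\<close>
  define \<eta> where "\<eta> = 1 / (4 * (q + 1) * (\<bar>M\<bar> + 1))"
  have q: "q \<ge> 0" by (simp add: q_def)
  have \<eta>: "\<eta> > 0" unfolding \<eta>_def using q by auto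
  obtain A where A: "A \<ge> 0" "\<And>z. z \<in> PiE I (\<lambda>_. UNIV) \<Longrightarrow> \<bar>g z\<bar> \<le> A * exp (\<eta> * (\<Sum>k\<in>I. (z k)\<^sup>2))"
    using sub_gaussian_growthE[OF g \<eta>] by blast
  define B where "B = A * (1 + q * sqrt 2)"
  have B0: "B \<ge> 0" unfolding B_def using A q by auto
  have "integrable \<mu> g \<and> (\<integral>z. \<bar>g z\<bar> \<partial>\<mu>) \<le> B"
    if cg: "centered_gaussian I S \<mu>" and M: "\<And>k. k \<in> I \<Longrightarrow> S k k \<le> M" for S \<mu>
  proof -
    interpret prob_space \<mu> by (rule centered_gaussianD[OF cg])
    have gm': "g \<in> borel_measurable \<mu>"
      unfolding measurable_centered_gaussian_cong[OF cg] by (rule gm)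
    have m: "(\<lambda>z. z k) \<in> borel_measurable \<mu>" if "k \<in> I" for k
      unfolding measurable_centered_gaussian_cong[OF cg] using that by simp
    \<comment> \<open>The summand 1 covers the empty index set, where the left side is
      \<open>exp 0\<close>.\<close>
    have pt: "exp (\<eta> * (\<Sum>k\<in>I. (z k)\<^sup>2)) \<le> 1 + (\<Sum>k\<in>I. exp (\<eta> * q * (z k)\<^sup>2))" for z :: "'i \<Rightarrow> real"
    proof (cases "I = {}")
      case False
      obtain j where j: "j \<in> I" "\<And>k. k \<in> I \<Longrightarrow> (z k)\<^sup>2 \<le> (z j)\<^sup>2"
      proof -
        have "Max ((\<lambda>k. (z k)\<^sup>2) ` I) \<in> (\<lambda>k. (z k)\<^sup>2) ` I" using I False by (intro Max_in) auto
        then obtain j where "j \<in> I" "(z j)\<^sup>2 = Max ((\<lambda>k. (z k)\<^sup>2) ` I)" by auto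
        then show ?thesis using that[of j] I by auto
      qed
      have "(\<Sum>k\<in>I. (z k)\<^sup>2) \<le> (\<Sum>k\<in>I. (z j)\<^sup>2)" by (intro sum_mono j)
      then have "\<eta> * (\<Sum>k\<in>I. (z k)\<^sup>2) \<le> \<eta> * q * (z j)\<^sup>2"
        using \<eta> by (simp add: q_def mult.assoc)
      then have "exp (\<eta> * (\<Sum>k\<in>I. (z k)\<^sup>2)) \<le> exp (\<eta> * q * (z j)\<^sup>2)" by simp
      also have "\<dots> \<le> (\<Sum>k\<in>I. exp (\<eta> * q * (z k)\<^sup>2))"
        by (rule member_le_sum[OF j(1)]) (use I in auto)
      finally show ?thesis by simp
    qed simp
    have "(\<integral>\<^sup>+z. ennreal \<bar>g z\<bar> \<partial>\<mu>)
        \<le> (\<integral>\<^sup>+z. ennreal A * (1 + (\<Sum>k\<in>I. ennreal (exp (\<eta> * q * (z k)\<^sup>2)))) \<partial>\<mu>)"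
    proof (rule nn_integral_mono)
      fix z assume "z \<in> space \<mu>"
      then have z: "z \<in> PiE I (\<lambda>_. UNIV)" using centered_gaussianD(3)[OF cg] by simp
      have "\<bar>g z\<bar> \<le> A * (1 + (\<Sum>k\<in>I. exp (\<eta> * q * (z k)\<^sup>2)))"
        using order.trans[OF A(2)[OF z] mult_left_mono[OF pt A(1)]] .
      then have "ennreal \<bar>g z\<bar> \<le> ennreal (A * (1 + (\<Sum>k\<in>I. exp (\<eta> * q * (z k)\<^sup>2))))"
        by (rule ennreal_leI)
      also have "\<dots> = ennreal A * (1 + (\<Sum>k\<in>I. ennreal (exp (\<eta> * q * (z k)\<^sup>2))))"
        using A(1) by (simp add: ennreal_mult sum_nonneg add_nonneg_nonneg)
      finally show "ennreal \<bar>g z\<bar> \<le> ennreal A * (1 + (\<Sum>k\<in>I. ennreal (exp (\<eta> * q * (z k)\<^sup>2))))" .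
    qed
    also have "\<dots> = ennreal A * (1 + (\<Sum>k\<in>I. (\<integral>\<^sup>+z. ennreal (exp (\<eta> * q * (z k)\<^sup>2)) \<partial>\<mu>)))"
      using m by (simp add: nn_integral_cmult nn_integral_add nn_integral_sum emeasure_space_1
          del: sum_ennreal)
    also have "\<dots> \<le> ennreal A * (1 + (\<Sum>k\<in>I. ennreal (sqrt 2)))"
    proof (intro mult_left_mono add_left_mono sum_mono centered_gaussian_exp_square[OF cg I])
      fix k assume k: "k \<in> I"
      have "\<eta> * q * S k k \<le> \<eta> * q * \<bar>M\<bar>"
        using M[OF k] \<eta> q by (intro mult_left_mono) auto
      also have "\<dots> \<le> 1 / 4"
      proof -
        have "q * \<bar>M\<bar> \<le> (q + 1) * (\<bar>M\<bar> + 1)" using q by (intro mult_mono) auto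
        then show ?thesis unfolding \<eta>_def using q by (simp add: divide_simps add_pos_nonneg) (simp add: algebra_simps)
      qed
      finally show "\<eta> * q * S k k \<le> 1 / 4" .
    qed simp_all
    also have "\<dots> = ennreal B"
      unfolding B_def q_def using A(1)
      by (simp add: ennreal_mult ennreal_of_nat_eq_real_of_nat)
    finally have le: "(\<integral>\<^sup>+z. ennreal \<bar>g z\<bar> \<partial>\<mu>) \<le> ennreal B" .
    have int: "integrable \<mu> g"
      using gm' le by (intro integrableI_bounded) (auto intro: le_less_trans)
    have "(\<integral>z. \<bar>g z\<bar> \<partial>\<mu>) \<le> B"
      using le int B0 by (subst (asm) nn_integral_eq_integral) auto
    with int show ?thesis by simp
  qed
  with B0 show ?thesis by (rule that)
qed

subsection \<open>Continuity of Gaussian expectations in the covariance\<close>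

text \<open>The algebra for Stone-Weierstrass whose Gaussian integrals can be read off the
  characteristic function. The free phase \<open>b\<close> turns cosines into sines as well, and
  zero frequencies give the constants, so one generator suffices.\<close>

inductive trig_poly :: "'i set \<Rightarrow> (('i \<Rightarrow> real) \<Rightarrow> real) \<Rightarrow> bool" for I where
  trig_poly_cos: "trig_poly I (\<lambda>z. a * cos (b + (\<Sum>k\<in>I. t k * z k)))"
| trig_poly_add: "trig_poly I f \<Longrightarrow> trig_poly I g \<Longrightarrow> trig_poly I (\<lambda>z. f z + g z)"

lemma trig_poly_const: "trig_poly I (\<lambda>_. c)"
  using trig_poly_cos[of I c 0 "\<lambda>_. 0"] by simp

text \<open>A product of two cosines is half the sum of the cosines of the difference and of the sum
  of the arguments; induction on both factors extends this to sums.\<close>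

lemma trig_poly_mult:
  assumes f: "trig_poly I f" and g: "trig_poly I g"
  shows "trig_poly I (\<lambda>z. f z * g z)"
  using f
proof induction
  case (trig_poly_cos a b t)
  from g show ?case
  proof induction
    case (trig_poly_cos a' b' t')
    have "(\<lambda>z. (a * cos (b + (\<Sum>k\<in>I. t k * z k))) * (a' * cos (b' + (\<Sum>k\<in>I. t' k * z k))))
        = (\<lambda>z. (a * a' / 2) * cos ((b - b') + (\<Sum>k\<in>I. (t k - t' k) * z k))
             + (a * a' / 2) * cos ((b + b') + (\<Sum>k\<in>I. (t k + t' k) * z k)))"
    proof
      fix z :: "'a \<Rightarrow> real"
      have "(\<Sum>k\<in>I. (t k - t' k) * z k) = (\<Sum>k\<in>I. t k * z k) - (\<Sum>k\<in>I. t' k * z k)"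
        by (simp add: left_diff_distrib sum_subtractf)
      moreover have "(\<Sum>k\<in>I. (t k + t' k) * z k) = (\<Sum>k\<in>I. t k * z k) + (\<Sum>k\<in>I. t' k * z k)"
        by (simp add: distrib_right sum.distrib)
      moreover have "(a * cos (b + X)) * (a' * cos (b' + Y))
          = (a * a' / 2) * cos ((b - b') + (X - Y)) + (a * a' / 2) * cos ((b + b') + (X + Y))" for X Y
      proof -
        have "(b - b') + (X - Y) = (b + X) - (b' + Y)" "(b + b') + (X + Y) = (b + X) + (b' + Y)"
          by simp_all
        then show ?thesis
          using cos_times_cos[of "b + X" "b' + Y"]
          by (simp only:) (simp add: field_simps del: cos_add)
      qed
      ultimately show "(a * cos (b + (\<Sum>k\<in>I. t k * z k))) * (a' * cos (b' + (\<Sum>k\<in>I. t' k * z k)))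
        = (a * a' / 2) * cos ((b - b') + (\<Sum>k\<in>I. (t k - t' k) * z k))
             + (a * a' / 2) * cos ((b + b') + (\<Sum>k\<in>I. (t k + t' k) * z k))"
        by simp
    qed
    then show ?case by (simp only:) (intro trig_poly.intros)
  next
    case (trig_poly_add f g)
    then show ?case by (simp only: distrib_left) (intro trig_poly.intros)
  qed
next
  case (trig_poly_add f g)
  then show ?case by (simp only: distrib_right) (intro trig_poly.intros)
qed

lemma trig_poly_polynomial_compose:
  assumes "real_polynomial_function q" "trig_poly I f"
  shows "trig_poly I (\<lambda>z. q (f z))"
  using assms(1)
proof induction
  case (linear h)
  then obtain c where "h = (\<lambda>x. x * c)" using real_bounded_linear by blast
  then show ?case using assms(2) by (simp add: trig_poly_mult trig_poly_const)
qed (simp_all add: trig_poly_const trig_poly_add trig_poly_mult)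

lemma trig_poly_bounded:
  assumes "trig_poly I f" obtains C where "\<And>z. \<bar>f z\<bar> \<le> C"
proof -
  from assms have "\<exists>C. \<forall>z. \<bar>f z\<bar> \<le> C"
  proof induction
    case (trig_poly_cos a b t)
    have "\<bar>a * cos (b + (\<Sum>k\<in>I. t k * z k))\<bar> \<le> \<bar>a\<bar>" for z
      unfolding abs_mult by (rule mult_left_le) auto
    then show ?case by blast
  next
    case (trig_poly_add f g)
    then obtain A B where "\<And>z. \<bar>f z\<bar> \<le> A" "\<And>z. \<bar>g z\<bar> \<le> B" by blast
    then have "\<bar>f z + g z\<bar> \<le> A + B" for z
      by (meson abs_triangle_ineq add_mono order.trans)
    then show ?case by blast
  qed
  then show ?thesis using that by blast
qed

lemma trig_poly_continuous:
  fixes f :: "('i::countable \<Rightarrow> real) \<Rightarrow> real"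
  assumes "trig_poly I f" shows "continuous_on UNIV f"
  using assms
proof induction
  case (trig_poly_cos a b t)
  have "continuous_on UNIV (\<lambda>z::'i \<Rightarrow> real. z k)" for k
    by (rule continuous_on_product_coordinates)
  then show ?case by (intro continuous_on_mult continuous_on_cos continuous_on_add continuous_on_sum continuous_on_const)
qed (rule continuous_on_add)

lemma trig_poly_measurable:
  assumes "trig_poly I f" shows "f \<in> borel_measurable (PiM I (\<lambda>_. borel))"
  using assms by induction measurable

text \<open>Integrability is part of the notion because the integral of a non-integrable function is
  0 by default, so a bare limit of integrals would carry no information.\<close>

definition integrals_conv :: "'i set \<Rightarrow> (nat \<Rightarrow> ('i \<Rightarrow> real) measure) \<Rightarrow> ('i \<Rightarrow> real) measure \<Rightarrow> (('i \<Rightarrow> real) \<Rightarrow> real) \<Rightarrow> bool" where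
  "integrals_conv I \<mu> \<nu> g \<longleftrightarrow> (\<forall>n. integrable (\<mu> n) g) \<and> integrable \<nu> g \<and>
      (\<lambda>n. \<integral>z. g z \<partial>\<mu> n) \<longlonglongrightarrow> (\<integral>z. g z \<partial>\<nu>)"

text \<open>Three-term estimate: \<open>g\<close> is exchanged for \<open>f\<close> under
  \<open>\<mu> n\<close> and under \<nu>, each at cost \<open>r / 4\<close> uniformly in
  \<open>n\<close>, and the integrals of \<open>f\<close> converge.\<close>

lemma integrals_conv_approx:
  assumes g: "\<And>n. integrable (\<mu> n) g" "integrable \<nu> g"
    and approx: "\<And>e. e > 0 \<Longrightarrow> \<exists>f. integrals_conv I \<mu> \<nu> f \<and>
        (\<forall>n. (\<integral>z. \<bar>g z - f z\<bar> \<partial>\<mu> n) \<le> e) \<and> (\<integral>z. \<bar>g z - f z\<bar> \<partial>\<nu>) \<le> e"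
  shows "integrals_conv I \<mu> \<nu> g"
proof -
  have "(\<lambda>n. \<integral>z. g z \<partial>\<mu> n) \<longlonglongrightarrow> (\<integral>z. g z \<partial>\<nu>)"
  proof (rule LIMSEQ_I)
    fix r :: real assume "r > 0"
    then have r: "r / 4 > 0" by simp
    obtain f where f: "integrals_conv I \<mu> \<nu> f"
      and f1: "\<And>n. (\<integral>z. \<bar>g z - f z\<bar> \<partial>\<mu> n) \<le> r / 4" and f2: "(\<integral>z. \<bar>g z - f z\<bar> \<partial>\<nu>) \<le> r / 4"
      using approx[OF r] by blast
    have fi: "integrable (\<mu> n) f" "integrable \<nu> f" for n
      using f by (auto simp: integrals_conv_def)
    have d: "\<bar>(\<integral>z. g z \<partial>M) - (\<integral>z. f z \<partial>M)\<bar> \<le> (\<integral>z. \<bar>g z - f z\<bar> \<partial>M)"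
      if "integrable M g" "integrable M f" for M
      using that integral_abs_bound[of M "\<lambda>z. g z - f z"] by simp
    obtain n0 where n0: "\<And>n. n \<ge> n0 \<Longrightarrow> norm ((\<integral>z. f z \<partial>\<mu> n) - (\<integral>z. f z \<partial>\<nu>)) < r / 4"
      using f r unfolding integrals_conv_def by (meson LIMSEQ_D)
    have "norm ((\<integral>z. g z \<partial>\<mu> n) - (\<integral>z. g z \<partial>\<nu>)) < r" if n: "n \<ge> n0" for n
      using n0[OF n] d[OF g(1)[of n] fi(1)[of n]] d[OF g(2) fi(2)] f1[of n] f2
      unfolding real_norm_def by linarith
    then show "\<exists>n0. \<forall>n\<ge>n0. norm ((\<integral>z. g z \<partial>\<mu> n) - (\<integral>z. g z \<partial>\<nu>)) < r" by blast
  qed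
  with g show ?thesis by (simp add: integrals_conv_def)
qed

lemma centered_gaussian_integral_cos:
  assumes cg: "centered_gaussian I S \<mu>"
  shows "(\<integral>z. cos (b + (\<Sum>k\<in>I. t k * z k)) \<partial>\<mu>)
    = cos b * exp (- (\<Sum>k\<in>I. \<Sum>l\<in>I. t k * S k l * t l) / 2)"
proof -
  have "(\<integral>z. cos (b + (\<Sum>k\<in>I. t k * z k)) \<partial>\<mu>) = (\<integral>z. Re (cis b * cis (\<Sum>k\<in>I. t k * z k)) \<partial>\<mu>)"
    by (simp add: cos_add)
  also have "\<dots> = Re (\<integral>z. cis b * cis (\<Sum>k\<in>I. t k * z k) \<partial>\<mu>)"
    by (rule integral_Re) (intro integrable_mult_right centered_gaussian_integrable_cis[OF cg])
  also have "\<dots> = Re (cis b * complex_of_real (exp (- (\<Sum>k\<in>I. \<Sum>l\<in>I. t k * S k l * t l) / 2)))"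
    by (simp only: integral_mult_right_zero centered_gaussianD(4)[OF cg])
  finally show ?thesis by simp
qed

lemma centered_gaussian_integrable_bounded:
  assumes cg: "centered_gaussian I S \<mu>" and "g \<in> borel_measurable (PiM I (\<lambda>_. borel))"
    and "\<And>z. z \<in> PiE I (\<lambda>_. UNIV) \<Longrightarrow> \<bar>g z\<bar> \<le> C"
  shows "integrable \<mu> (g :: _ \<Rightarrow> real)"
proof -
  interpret prob_space \<mu> by (rule centered_gaussianD[OF cg])
  show ?thesis
    by (rule integrable_const_bound[of _ C])
       (use assms in \<open>auto simp: measurable_centered_gaussian_cong[OF cg] centered_gaussianD(3)[OF cg] intro!: AE_I2\<close>)
qed

text \<open>An extensional box is a full product over all indices with the one-point factor
  \<open>{undefined}\<close> off \<open>I\<close>, so Tychonoff applies.\<close>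

lemma compact_box: "compact (PiE I (\<lambda>_. {-T..T::real}))"
proof -
  have "PiE I (\<lambda>_. {-T..T}) = PiE UNIV (\<lambda>i. if i \<in> I then {-T..T} else {undefined})"
    by (fastforce simp: PiE_def Pi_def extensional_def split: if_splits)
  then show ?thesis
    unfolding compactin_euclidean_iff[symmetric] euclidean_product_topology[symmetric]
    by (simp only: compactin_PiE) auto
qed

context
  fixes I :: "'i::countable set" \<comment> \<open>makes the function space metrizable, hence \<open>t2_space\<close>\<close>
    and S :: "nat \<Rightarrow> 'i \<Rightarrow> 'i \<Rightarrow> real" and S' :: "'i \<Rightarrow> 'i \<Rightarrow> real" and \<mu> \<nu>
  assumes I: "finite I"
    and cg: "\<And>n. centered_gaussian I (S n) (\<mu> n)" and cg': "centered_gaussian I S' \<nu>"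
    and conv: "\<And>k l. k \<in> I \<Longrightarrow> l \<in> I \<Longrightarrow> (\<lambda>n. S n k l) \<longlonglongrightarrow> S' k l"
begin

text \<open>Convergent sequences are bounded. One \<open>M\<close> for the whole sequence and its
  limit makes the Gaussian moment bounds uniform along the sequence.\<close>

lemma diag_bound:
  obtains M where "\<And>n k. k \<in> I \<Longrightarrow> S n k k \<le> M" "\<And>k. k \<in> I \<Longrightarrow> S' k k \<le> M"
proof -
  have "\<exists>M. \<forall>n. S n k k \<le> M \<and> S' k k \<le> M" if "k \<in> I" for k
  proof -
    have "Bseq (\<lambda>n. S n k k)" using conv[OF that that] by (meson convergent_def Bseq_eq_bounded convergent_imp_Bseq)
    then obtain B where B: "\<And>n. norm (S n k k) \<le> B" by (auto simp: Bseq_def)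
    have "S n k k \<le> max B (S' k k) \<and> S' k k \<le> max B (S' k k)" for n
      using B[of n] by auto
    then show ?thesis by blast
  qed
  then obtain m where m: "\<And>k n. k \<in> I \<Longrightarrow> S n k k \<le> m k \<and> S' k k \<le> m k" by metis
  have le: "m k \<le> (\<Sum>j\<in>I. \<bar>m j\<bar>)" if "k \<in> I" for k
    using member_le_sum[of k I "\<lambda>j. \<bar>m j\<bar>"] that I by auto
  show ?thesis
    by (rule that[of "\<Sum>j\<in>I. \<bar>m j\<bar>"]) (use m le order.trans in blast)+
qed

text \<open>The integral of a shifted cosine is an explicit continuous function of finitely many
  covariance entries.\<close>

lemma integrals_conv_trig_poly:
  assumes "trig_poly I f" shows "integrals_conv I \<mu> \<nu> f"
proof -
  have int: "integrable (\<mu> n) f" "integrable \<nu> f" if f: "trig_poly I f" for n f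
  proof -
    obtain C where C: "\<And>z. \<bar>f z\<bar> \<le> C" using trig_poly_bounded[OF f] by blast
    show "integrable (\<mu> n) f" "integrable \<nu> f"
      using centered_gaussian_integrable_bounded[OF cg trig_poly_measurable[OF f] C]
        centered_gaussian_integrable_bounded[OF cg' trig_poly_measurable[OF f] C] by auto
  qed
  from assms have "(\<lambda>n. \<integral>z. f z \<partial>\<mu> n) \<longlonglongrightarrow> (\<integral>z. f z \<partial>\<nu>)"
  proof induction
    case (trig_poly_cos a b t)
    show ?case
      unfolding integral_mult_right_zero centered_gaussian_integral_cos[OF cg]
        centered_gaussian_integral_cos[OF cg']
      by (intro tendsto_intros conv) auto
  next
    case (trig_poly_add f g)
    then show ?case by (simp add: int tendsto_add)
  qed
  with int[OF assms] show ?thesis by (simp add: integrals_conv_def)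
qed

text \<open>A trigonometric polynomial that approximates \<open>g\<close> on a large box need not be bounded by \<open>sup |g|\<close>
  outside of it, so it is clamped; approximating the clamping function by polynomials keeps the
  composition within reach of the characteristic functions.\<close>
lemma integrals_conv_clamp:
  assumes f: "trig_poly I f" shows "integrals_conv I \<mu> \<nu> (\<lambda>z. max (-m) (min m (f z)))"
proof -
  obtain C where C: "\<And>z. \<bar>f z\<bar> \<le> C" using trig_poly_bounded[OF f] by blast
  have gm: "(\<lambda>z. max (-m) (min m (f z))) \<in> borel_measurable (PiM I (\<lambda>_. borel))"
    using trig_poly_measurable[OF f] by measurable
  have bd: "\<bar>max (-m) (min m (f z))\<bar> \<le> \<bar>m\<bar>" for z by auto
  note int = centered_gaussian_integrable_bounded[OF _ gm bd]
  show ?thesis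
  proof (rule integrals_conv_approx)
    fix e :: real assume e: "e > 0"
    have "continuous_on {-C..C} (\<lambda>y. max (-m) (min m y))" by (intro continuous_intros)
    then obtain q where q: "real_polynomial_function q"
      "\<And>y. y \<in> {-C..C} \<Longrightarrow> \<bar>max (-m) (min m y) - q y\<bar> < e"
      using Stone_Weierstrass_real_polynomial_function[of "{-C..C}" "\<lambda>y. max (-m) (min m y)" e] e by auto
    have le: "\<bar>max (-m) (min m (f z)) - q (f z)\<bar> \<le> e" for z
      using q(2)[of "f z"] C[of z] by (simp add: abs_le_iff less_imp_le)
    have ci: "integrals_conv I \<mu> \<nu> (\<lambda>z. q (f z))"
      by (rule integrals_conv_trig_poly[OF trig_poly_polynomial_compose[OF q(1) f]])
    have bound: "(\<integral>z. \<bar>max (-m) (min m (f z)) - q (f z)\<bar> \<partial>M) \<le> e"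
      if "prob_space M" "integrable M (\<lambda>z. max (-m) (min m (f z)))" "integrable M (\<lambda>z. q (f z))" for M
    proof -
      interpret prob_space M by fact
      have "(\<integral>z. \<bar>max (-m) (min m (f z)) - q (f z)\<bar> \<partial>M) \<le> (\<integral>z. e \<partial>M)"
        using that le by (intro integral_mono integrable_abs Bochner_Integration.integrable_diff) auto
      then show ?thesis by (simp add: prob_space)
    qed
    show "\<exists>h. integrals_conv I \<mu> \<nu> h \<and>
        (\<forall>n. (\<integral>z. \<bar>max (-m) (min m (f z)) - h z\<bar> \<partial>\<mu> n) \<le> e) \<and>
        (\<integral>z. \<bar>max (-m) (min m (f z)) - h z\<bar> \<partial>\<nu>) \<le> e"
      using ci bound[OF centered_gaussianD(1)[OF cg] int[OF cg]]
        bound[OF centered_gaussianD(1)[OF cg'] int[OF cg']]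
      by (intro exI[of _ "\<lambda>z. q (f z)"]) (auto simp: integrals_conv_def)
  qed (use int cg cg' in auto)
qed

text \<open>On a large box, \<open>g\<close> is approximated by a trigonometric polynomial, which is
  then clamped to \<open>[-m, m]\<close>. Outside the box the error is at most \<open>2 * m\<close>,
  and there the squared norm exceeds \<open>T\<^sup>2\<close>, so a uniform second moment makes this
  contribution small.\<close>

lemma integrals_conv_bounded:
  assumes gm: "g \<in> borel_measurable (PiM I (\<lambda>_. borel))"
    and gc: "continuous_on (PiE I (\<lambda>_. UNIV)) g"
    and gb: "\<And>z. z \<in> PiE I (\<lambda>_. UNIV) \<Longrightarrow> \<bar>g z\<bar> \<le> m"
  shows "integrals_conv I \<mu> \<nu> g"
proof -
  have m: "m \<ge> 0"
    \<comment> \<open>The constant function \<open>undefined\<close> is a point of the extensional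
      space, so the bound is attained by some absolute value.\<close>
    using gb[of "\<lambda>_. undefined"] by (simp add: PiE_iff extensional_def)
  note int = centered_gaussian_integrable_bounded[OF _ gm gb]
  obtain M where M: "\<And>n k. k \<in> I \<Longrightarrow> S n k k \<le> M" "\<And>k. k \<in> I \<Longrightarrow> S' k k \<le> M"
    using diag_bound by blast
  have sqm: "(\<lambda>z. \<Sum>k\<in>I. (z k)\<^sup>2) \<in> borel_measurable (PiM I (\<lambda>_. borel :: real measure))"
    by measurable
  obtain B where B: "B \<ge> 0"
    "\<And>S \<mu>. centered_gaussian I S \<mu> \<Longrightarrow> (\<And>k. k \<in> I \<Longrightarrow> S k k \<le> M) \<Longrightarrow>
       integrable \<mu> (\<lambda>z. \<Sum>k\<in>I. (z k)\<^sup>2) \<and> (\<integral>z. \<bar>\<Sum>k\<in>I. (z k)\<^sup>2\<bar> \<partial>\<mu>) \<le> B"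
    using sub_gaussian_growth_moment[OF I sub_gaussian_growth_square_norm sqm] by blast
  show ?thesis
  proof (rule integrals_conv_approx)
    fix e :: real assume e: "e > 0"
    \<comment> \<open>Solves \<open>2 * m * B / T\<^sup>2 \<le> e / 2\<close>, where
      \<open>B\<close> bounds the second moment; the added 1 keeps \<open>T\<close> positive if
      \<open>m * B = 0\<close>.\<close>
    define T where "T = sqrt (4 * m * B / e) + 1"
    have T: "T > 0" "2 * m * B / T\<^sup>2 \<le> e / 2"
    proof -
      have s: "sqrt (4 * m * B / e) \<ge> 0" using m B e by simp
      then show "T > 0" unfolding T_def by linarith
      have "4 * m * B / e = (sqrt (4 * m * B / e))\<^sup>2" using m B e by simp
      also have "\<dots> \<le> T\<^sup>2" unfolding T_def using s by (intro power_mono) auto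
      finally show "2 * m * B / T\<^sup>2 \<le> e / 2" using \<open>T > 0\<close> e by (simp add: field_simps)
    qed
    have "\<exists>p. trig_poly I p \<and> (\<forall>z\<in>PiE I (\<lambda>_. {-T..T}). \<bar>g z - p z\<bar> < e / 2)"
    proof (rule Stone_Weierstrass_HOL[where P = "trig_poly I", OF compact_box])
      show "continuous_on (PiE I (\<lambda>_. {-T..T})) g"
        by (rule continuous_on_subset[OF gc]) (auto simp: PiE_iff)
      show "continuous_on (PiE I (\<lambda>_. {-T..T})) f" if "trig_poly I f" for f
        by (rule continuous_on_subset[OF trig_poly_continuous[OF that]]) simp
      fix x y :: "'i \<Rightarrow> real"
      assume xy: "x \<in> PiE I (\<lambda>_. {-T..T}) \<and> y \<in> PiE I (\<lambda>_. {-T..T}) \<and> x \<noteq> y"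
      then obtain k where k: "k \<in> I" "x k \<noteq> y k" by (metis PiE_ext)
      have ran: "x k \<in> {-T..T}" "y k \<in> {-T..T}" using xy k by auto
      \<comment> \<open>The separating function is \<open>sin (z k / T)\<close>, a cosine with phase
        \<open>- pi / 2\<close>. Dividing by \<open>T\<close> puts the argument into
        \<open>[-1, 1]\<close>, where sine is injective.\<close>
      define t where "t = (\<lambda>j. if j = k then 1 / T else 0)"
      have sum: "(\<Sum>j\<in>I. t j * z j) = z k / T" for z
        unfolding t_def using k I by (simp add: if_distrib[where f="\<lambda>x. x * _"] cong: if_cong)
      have "\<bar>z / T\<bar> \<le> pi / 2" if "z \<in> {-T..T}" for z
      proof -
        have "\<bar>z / T\<bar> \<le> 1" using that T by (auto simp: abs_le_iff field_simps)
        then show ?thesis using pi_ge_two by linarith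
      qed
      from this[OF ran(1)] this[OF ran(2)] have "sin (x k / T) \<noteq> sin (y k / T)"
        using k(2) T(1) sin_inj_pi[of "x k / T" "y k / T"] unfolding abs_le_iff
        by (metis divide_cancel_right less_irrefl minus_le_iff)
      then have "1 * cos (- (pi / 2) + (\<Sum>j\<in>I. t j * x j)) \<noteq> 1 * cos (- (pi / 2) + (\<Sum>j\<in>I. t j * y j))"
        unfolding sum by (simp add: cos_diff)
      moreover have "trig_poly I (\<lambda>z. 1 * cos (- (pi / 2) + (\<Sum>j\<in>I. t j * z j)))"
        by (rule trig_poly_cos)
      ultimately show "\<exists>f. trig_poly I f \<and> f x \<noteq> f y"
        by (intro exI[of _ "\<lambda>z. 1 * cos (- (pi / 2) + (\<Sum>j\<in>I. t j * z j))"] conjI)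
    next
      fix f h :: "('i \<Rightarrow> real) \<Rightarrow> real" assume fh: "trig_poly I f \<and> trig_poly I h"
      show "trig_poly I (\<lambda>z. f z + h z)" by (intro trig_poly_add conjunct1[OF fh] conjunct2[OF fh])
      show "trig_poly I (\<lambda>z. f z * h z)" by (intro trig_poly_mult conjunct1[OF fh] conjunct2[OF fh])
    next
      show "trig_poly I (\<lambda>_. c)" for c by (rule trig_poly_const)
    qed (use e in simp)
    then obtain p where p: "trig_poly I p"
      "\<And>z. z \<in> PiE I (\<lambda>_. {-T..T}) \<Longrightarrow> \<bar>g z - p z\<bar> < e / 2" by blast
    define h where "h z = max (-m) (min m (p z))" for z
    have hm: "h \<in> borel_measurable (PiM I (\<lambda>_. borel))"
      unfolding h_def[abs_def] using trig_poly_measurable[OF p(1)] by measurable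
    have hb: "\<bar>h z\<bar> \<le> m" for z using m by (auto simp: h_def)
    have pt: "\<bar>g z - h z\<bar> \<le> e / 2 + 2 * m / T\<^sup>2 * (\<Sum>k\<in>I. (z k)\<^sup>2)"
      if z: "z \<in> PiE I (\<lambda>_. UNIV)" for z
    proof (cases "z \<in> PiE I (\<lambda>_. {-T..T})")
      case True
      \<comment> \<open>Clamping is the projection onto \<open>[-m, m]\<close>, which contains
        \<open>g z\<close>, so it cannot increase the distance.\<close>
      have "\<bar>g z - h z\<bar> \<le> \<bar>g z - p z\<bar>"
        using gb[OF z] unfolding h_def by (auto simp: abs_if max_def min_def split: if_splits)
      also have "\<dots> \<le> e / 2" using p(2)[OF True] by simp
      also have "\<dots> \<le> e / 2 + 2 * m / T\<^sup>2 * (\<Sum>k\<in>I. (z k)\<^sup>2)" using m by (simp add: sum_nonneg)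
      finally show ?thesis .
    next
      case False
      then obtain k where k: "k \<in> I" "z k \<notin> {-T..T}" using z by (auto simp: PiE_iff)
      then have "T \<le> \<bar>z k\<bar>" by auto
      then have "T\<^sup>2 \<le> (z k)\<^sup>2" using T by (metis abs_le_square_iff abs_of_pos)
      also have "\<dots> \<le> (\<Sum>k\<in>I. (z k)\<^sup>2)" using k I by (intro member_le_sum) auto
      finally have "2 * m / T\<^sup>2 * T\<^sup>2 \<le> 2 * m / T\<^sup>2 * (\<Sum>k\<in>I. (z k)\<^sup>2)"
        using m T by (intro mult_left_mono) auto
      then have "2 * m \<le> 2 * m / T\<^sup>2 * (\<Sum>k\<in>I. (z k)\<^sup>2)" using T by simp
      then show ?thesis using gb[OF z] hb[of z] e by linarith
    qed
    have bound: "(\<integral>z. \<bar>g z - h z\<bar> \<partial>\<rho>) \<le> e"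
      if c: "centered_gaussian I R \<rho>" "\<And>k. k \<in> I \<Longrightarrow> R k k \<le> M" for R \<rho>
    proof -
      interpret prob_space \<rho> by (rule centered_gaussianD[OF c(1)])
      have i: "integrable \<rho> (\<lambda>z. \<Sum>k\<in>I. (z k)\<^sup>2)" and b: "(\<integral>z. (\<Sum>k\<in>I. (z k)\<^sup>2) \<partial>\<rho>) \<le> B"
        using B(2)[OF c] by (auto simp: sum_nonneg)
      have "(\<integral>z. \<bar>g z - h z\<bar> \<partial>\<rho>) \<le> (\<integral>z. e / 2 + 2 * m / T\<^sup>2 * (\<Sum>k\<in>I. (z k)\<^sup>2) \<partial>\<rho>)"
        using int[OF c(1)] centered_gaussian_integrable_bounded[OF c(1) hm hb] i pt
        by (intro integral_mono integrable_abs Bochner_Integration.integrable_diff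
            Bochner_Integration.integrable_add integrable_mult_right)
           (auto simp: centered_gaussianD(3)[OF c(1)])
      also have "\<dots> = e / 2 + 2 * m / T\<^sup>2 * (\<integral>z. (\<Sum>k\<in>I. (z k)\<^sup>2) \<partial>\<rho>)"
        by (subst Bochner_Integration.integral_add)
           (use i in \<open>simp_all only: integrable_mult_right integrable_const integral_mult_right_zero lebesgue_integral_const prob_space scaleR_one\<close>)
      also have "\<dots> \<le> e / 2 + 2 * m / T\<^sup>2 * B"
        using m by (intro add_left_mono mult_left_mono b) auto
      also have "\<dots> \<le> e" using T(2) by simp
      finally show ?thesis .
    qed
    have "integrals_conv I \<mu> \<nu> h"
      unfolding h_def[abs_def] by (rule integrals_conv_clamp[OF p(1)])
    then show "\<exists>h. integrals_conv I \<mu> \<nu> h \<and>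
        (\<forall>n. (\<integral>z. \<bar>g z - h z\<bar> \<partial>\<mu> n) \<le> e) \<and> (\<integral>z. \<bar>g z - h z\<bar> \<partial>\<nu>) \<le> e"
      using bound[OF cg M(1)] bound[OF cg' M(2)] by blast
  qed (use int cg cg' in auto)
qed

text \<open>Truncation at level \<open>m\<close> costs at most \<open>(g z)\<^sup>2 / m\<close>
  pointwise, since \<open>\<bar>g z\<bar> / m > 1\<close> wherever it acts. The square of
  \<open>g\<close> again has sub-Gaussian growth, so its integrals are bounded uniformly and the
  cost vanishes for large \<open>m\<close>.\<close>

lemma integrals_conv_sub_gaussian_growth:
  assumes gm: "g \<in> borel_measurable (PiM I (\<lambda>_. borel))"
    and gc: "continuous_on (PiE I (\<lambda>_. UNIV)) g"
    and gg: "sub_gaussian_growth I g"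
  shows "integrals_conv I \<mu> \<nu> g"
proof -
  obtain M where M: "\<And>n k. k \<in> I \<Longrightarrow> S n k k \<le> M" "\<And>k. k \<in> I \<Longrightarrow> S' k k \<le> M"
    using diag_bound by blast
  have g2m: "(\<lambda>z. g z * g z) \<in> borel_measurable (PiM I (\<lambda>_. borel))"
    using gm by measurable
  obtain B where B: "B \<ge> 0"
    "\<And>S \<mu>. centered_gaussian I S \<mu> \<Longrightarrow> (\<And>k. k \<in> I \<Longrightarrow> S k k \<le> M) \<Longrightarrow>
       integrable \<mu> (\<lambda>z. g z * g z) \<and> (\<integral>z. \<bar>g z * g z\<bar> \<partial>\<mu>) \<le> B"
    using sub_gaussian_growth_moment[OF I sub_gaussian_growth_mult[OF gg gg] g2m] by blast
  have int: "integrable \<rho> g" if "centered_gaussian I R \<rho>" "\<And>k. k \<in> I \<Longrightarrow> R k k \<le> M" for R \<rho>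
    using sub_gaussian_growth_moment[OF I gg gm] that by metis
  show ?thesis
  proof (rule integrals_conv_approx)
    fix e :: real assume e: "e > 0"
    define m where "m = B / e + 1"
    have m: "m > 0" "B / m \<le> e"
    proof -
      show "m > 0" unfolding m_def using B(1) e by (simp add: add_nonneg_pos)
      moreover have "B \<le> e * m" unfolding m_def using e by (simp add: field_simps)
      ultimately show "B / m \<le> e" by (simp add: field_simps)
    qed
    define h where "h z = max (-m) (min m (g z))" for z
    have hm: "h \<in> borel_measurable (PiM I (\<lambda>_. borel))"
      unfolding h_def[abs_def] using gm by measurable
    have hc: "continuous_on (PiE I (\<lambda>_. UNIV)) h"
      unfolding h_def[abs_def] by (intro continuous_intros gc)
    have hb: "\<bar>h z\<bar> \<le> m" for z using m by (auto simp: h_def)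
    have pt: "\<bar>g z - h z\<bar> \<le> 1 / m * (g z * g z)" for z
    proof (cases "\<bar>g z\<bar> \<le> m")
      case True
      then have "h z = g z" by (auto simp: h_def abs_le_iff)
      then show ?thesis using m by simp
    next
      case False
      have "\<bar>g z - h z\<bar> \<le> \<bar>g z\<bar>" using False m by (auto simp: h_def abs_if max_def min_def split: if_splits)
      also have "\<dots> \<le> \<bar>g z\<bar> * (\<bar>g z\<bar> / m)" using False m mult_left_mono[of 1 "\<bar>g z\<bar> / m" "\<bar>g z\<bar>"] by simp
      also have "\<dots> = 1 / m * (g z * g z)" by (simp add: abs_mult_self_eq)
      finally show ?thesis .
    qed
    have bound: "(\<integral>z. \<bar>g z - h z\<bar> \<partial>\<rho>) \<le> e"
      if c: "centered_gaussian I R \<rho>" "\<And>k. k \<in> I \<Longrightarrow> R k k \<le> M" for R \<rho>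
    proof -
      have i: "integrable \<rho> (\<lambda>z. g z * g z)" and b: "(\<integral>z. g z * g z \<partial>\<rho>) \<le> B"
        using B(2)[OF c] by auto
      have "(\<integral>z. \<bar>g z - h z\<bar> \<partial>\<rho>) \<le> (\<integral>z. 1 / m * (g z * g z) \<partial>\<rho>)"
        using int[OF c] centered_gaussian_integrable_bounded[OF c(1) hm hb] i pt
        by (intro integral_mono integrable_abs Bochner_Integration.integrable_diff integrable_mult_right) auto
      also have "\<dots> = 1 / m * (\<integral>z. g z * g z \<partial>\<rho>)" by (rule integral_mult_right_zero)
      also have "\<dots> \<le> 1 / m * B" using m by (intro mult_left_mono b) auto
      also have "\<dots> \<le> e" using m(2) by simp
      finally show ?thesis .
    qed
    show "\<exists>h. integrals_conv I \<mu> \<nu> h \<and>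
        (\<forall>n. (\<integral>z. \<bar>g z - h z\<bar> \<partial>\<mu> n) \<le> e) \<and> (\<integral>z. \<bar>g z - h z\<bar> \<partial>\<nu>) \<le> e"
      using bound[OF cg M(1)] bound[OF cg' M(2)] integrals_conv_bounded[OF hm hc hb] by blast
  qed (use int cg cg' M in blast)+
qed

end

text \<open>Failure for every \<open>d = 1 / (n + 1)\<close> would produce a sequence of covariances
  contradicting sequential continuity. The form with \<open>d\<close> is the one applied to random
  covariances: a single \<open>d\<close> serves all matrices near \<open>S'\<close> and all Gaussian
  measures that have them as covariance.\<close>

lemma centered_gaussian_integral_continuous:
  fixes I :: "'i::countable set"
  assumes I: "finite I" and gm: "g \<in> borel_measurable (PiM I (\<lambda>_. borel))"
    and gc: "continuous_on (PiE I (\<lambda>_. UNIV)) g" and gg: "sub_gaussian_growth I g"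
    and cg': "centered_gaussian I S' \<nu>" and e: "e > 0"
  obtains d where "d > 0"
    "\<And>S \<mu>. centered_gaussian I S \<mu> \<Longrightarrow> (\<And>k l. k \<in> I \<Longrightarrow> l \<in> I \<Longrightarrow> \<bar>S k l - S' k l\<bar> \<le> d) \<Longrightarrow>
       \<bar>(\<integral>z. g z \<partial>\<mu>) - (\<integral>z. g z \<partial>\<nu>)\<bar> \<le> e"
proof (rule ccontr)
  assume neg: "\<not> thesis"
  have "\<exists>S \<mu>. centered_gaussian I S \<mu> \<and> (\<forall>k\<in>I. \<forall>l\<in>I. \<bar>S k l - S' k l\<bar> \<le> inverse (real (Suc n))) \<and>
       \<bar>(\<integral>z. g z \<partial>\<mu>) - (\<integral>z. g z \<partial>\<nu>)\<bar> > e" for n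
    using that[of "inverse (real (Suc n))"] neg by (fastforce simp: not_le)
  then obtain S \<mu> where cg: "\<And>n. centered_gaussian I (S n) (\<mu> n)"
    and S: "\<And>n k l. k \<in> I \<Longrightarrow> l \<in> I \<Longrightarrow> \<bar>S n k l - S' k l\<bar> \<le> inverse (real (Suc n))"
    and far: "\<And>n::nat. \<bar>(\<integral>z. g z \<partial>\<mu> n) - (\<integral>z. g z \<partial>\<nu>)\<bar> > e"
    by metis
  have "(\<lambda>n. S n k l) \<longlonglongrightarrow> S' k l" if "k \<in> I" "l \<in> I" for k l
  proof (rule LIM_zero_cancel, rule Lim_null_comparison[OF _ LIMSEQ_inverse_real_of_nat])
    show "\<forall>\<^sub>F n in sequentially. norm (S n k l - S' k l) \<le> inverse (real (Suc n))"
      using S[OF that] by simp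
  qed
  from integrals_conv_sub_gaussian_growth[OF I cg cg' this gm gc gg]
  have "(\<lambda>n. \<integral>z. g z \<partial>\<mu> n) \<longlonglongrightarrow> (\<integral>z. g z \<partial>\<nu>)" by (simp add: integrals_conv_def)
  from LIMSEQ_D[OF this e] obtain n where "norm ((\<integral>z. g z \<partial>\<mu> n) - (\<integral>z. g z \<partial>\<nu>)) < e" by blast
  with far[of n] show False by simp
qed

subsection \<open>Linear images of independent normal variables\<close>

abbreviation centered_normal :: "real \<Rightarrow> real measure" where
  "centered_normal s \<equiv> density lborel (\<lambda>y. ennreal (normal_density 0 s y))"

lemma prob_space_centered_normal: "s > 0 \<Longrightarrow> prob_space (centered_normal s)"
  by (rule prob_space_normal_density)

lemma integrable_cis:
  assumes "prob_space M" "f \<in> borel_measurable M"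
  shows "integrable M (\<lambda>x. cis (f x))"
proof -
  interpret prob_space M by fact
  show ?thesis using assms(2) by (intro integrable_const_bound[of _ 1]) auto
qed

lemma integral_cis_centered_normal:
  assumes s: "s > 0"
  shows "(\<integral>y. cis (u * y) \<partial>centered_normal s) = complex_of_real (exp (- (s\<^sup>2 * u\<^sup>2) / 2))"
proof -
  interpret n: real_distribution std_normal_distribution by (rule real_dist_normal_dist)
  have "distributed std_normal_distribution lborel (\<lambda>x. x) (\<lambda>x. ennreal (std_normal_density x))"
    unfolding distributed_def
    by (simp add: distr_id2[unfolded id_def] distr_cong)
  from n.normal_density_affine[OF this, of s 0] s
  have "distributed std_normal_distribution lborel (\<lambda>x. s * x) (\<lambda>x. ennreal (normal_density 0 s x))"
    by simp
  then have eq: "distr std_normal_distribution lborel (\<lambda>x. s * x) = centered_normal s"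
    by (simp add: distributed_def)
  have "(\<integral>y. cis (u * y) \<partial>centered_normal s) = (\<integral>x. cis (u * (s * x)) \<partial>std_normal_distribution)"
    unfolding eq[symmetric] by (subst integral_distr) simp_all
  also have "\<dots> = char std_normal_distribution (u * s)"
    by (simp add: char_def cis_conv_exp mult.assoc)
  also have "\<dots> = complex_of_real (exp (- (s\<^sup>2 * u\<^sup>2) / 2))"
    unfolding char_std_normal_distribution by (simp add: power_mult_distrib mult.commute)
  finally show ?thesis .
qed

lemma cis_sum: "cis (\<Sum>k\<in>J. f k) = (\<Prod>k\<in>J. cis (f k))"
  by (induction J rule: infinite_finite_induct) (simp_all add: cis_mult[symmetric])

lemma linear_image_measurable:
  "(\<lambda>y. \<lambda>a\<in>I. \<Sum>k\<in>J. B a k * y k) \<in> measurable (PiM J (\<lambda>_. borel :: real measure)) (PiM I (\<lambda>_. borel))"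
  by measurable

lemma sets_PiM_centered_normal:
  "sets (PiM J (\<lambda>k. centered_normal (s k))) = sets (PiM J (\<lambda>_. borel))"
  by (intro sets_PiM_cong) auto

lemma measurable_PiM_centered_normal:
  "measurable (PiM J (\<lambda>k. centered_normal (s k))) N = measurable (PiM J (\<lambda>_. borel)) N"
  by (intro measurable_cong_sets sets_PiM_centered_normal refl)

text \<open>By independence the characteristic function factors over \<open>J\<close>. The exponent
  is the sum of \<open>(s k)\<^sup>2 * (u k)\<^sup>2\<close>, with \<open>u\<close> the transpose of
  \<open>B\<close> applied to \<open>t\<close>; expanding the squares gives the covariance.\<close>

lemma centered_gaussian_linear_image:
  assumes J: "finite J" and I: "finite I" and s: "\<And>k. k \<in> J \<Longrightarrow> s k > 0"
  shows "centered_gaussian I (\<lambda>a b. \<Sum>k\<in>J. (s k)\<^sup>2 * B a k * B b k)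
    (distr (PiM J (\<lambda>k. centered_normal (s k))) (PiM I (\<lambda>_. borel)) (\<lambda>y. \<lambda>a\<in>I. \<Sum>k\<in>J. B a k * y k))"
proof -
  \<comment> \<open>The product locale wants a probability measure at every index, also outside
    \<open>J\<close>, where \<open>s\<close> need not be positive.\<close>
  define s' where "s' k = (if k \<in> J then s k else 1)" for k
  have s': "s' k > 0" for k using s by (simp add: s'_def)
  have eq: "PiM J (\<lambda>k. centered_normal (s k)) = PiM J (\<lambda>k. centered_normal (s' k))"
    by (intro PiM_cong) (simp_all add: s'_def)
  interpret product_prob_space "\<lambda>k. centered_normal (s' k)" J
    by (intro product_prob_spaceI prob_space_centered_normal s')
  let ?Q = "PiM J (\<lambda>k. centered_normal (s' k))"
  let ?X = "\<lambda>y. \<lambda>a\<in>I. \<Sum>k\<in>J. B a k * y k"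
  have X: "?X \<in> measurable ?Q (PiM I (\<lambda>_. borel))"
    unfolding measurable_PiM_centered_normal by (rule linear_image_measurable)
  have "(\<integral>z. cis (\<Sum>a\<in>I. t a * z a) \<partial>distr ?Q (PiM I (\<lambda>_. borel)) ?X)
    = complex_of_real (exp (- (\<Sum>a\<in>I. \<Sum>b\<in>I. t a * (\<Sum>k\<in>J. (s k)\<^sup>2 * B a k * B b k) * t b) / 2))" for t
  proof -
    define u where "u k = (\<Sum>a\<in>I. t a * B a k)" for k
    have lin: "(\<Sum>a\<in>I. t a * (\<Sum>k\<in>J. B a k * y k)) = (\<Sum>k\<in>J. u k * y k)" for y
      unfolding u_def sum_distrib_left sum_distrib_right
      by (subst sum.swap) (simp add: mult_ac)
    have "(\<integral>z. cis (\<Sum>a\<in>I. t a * z a) \<partial>distr ?Q (PiM I (\<lambda>_. borel)) ?X)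
        = (\<integral>y. cis (\<Sum>a\<in>I. t a * ?X y a) \<partial>?Q)"
      by (subst integral_distr[OF X]) simp_all
    also have "\<dots> = (\<integral>y. (\<Prod>k\<in>J. cis (u k * y k)) \<partial>?Q)"
      by (simp add: lin cis_sum cong: sum.cong)
    also have "\<dots> = (\<Prod>k\<in>J. \<integral>y. cis (u k * y) \<partial>centered_normal (s' k))"
      by (rule product_integral_prod[OF J])
         (intro integrable_cis prob_space_centered_normal s', simp)
    also have "\<dots> = (\<Prod>k\<in>J. complex_of_real (exp (- ((s k)\<^sup>2 * (u k)\<^sup>2) / 2)))"
      by (intro prod.cong refl) (simp add: integral_cis_centered_normal[OF s'], simp add: s'_def)
    also have "\<dots> = complex_of_real (exp (\<Sum>k\<in>J. - ((s k)\<^sup>2 * (u k)\<^sup>2) / 2))"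
      by (simp only: exp_sum[OF J] of_real_prod)
    also have "(\<Sum>k\<in>J. - ((s k)\<^sup>2 * (u k)\<^sup>2) / 2)
        = - (\<Sum>a\<in>I. \<Sum>b\<in>I. t a * (\<Sum>k\<in>J. (s k)\<^sup>2 * B a k * B b k) * t b) / 2"
    proof -
      have "(\<Sum>k\<in>J. (s k)\<^sup>2 * (u k)\<^sup>2) = (\<Sum>k\<in>J. \<Sum>a\<in>I. \<Sum>b\<in>I. t a * ((s k)\<^sup>2 * B a k * B b k) * t b)"
        unfolding u_def power2_eq_square[of "sum _ _"] sum_product sum_distrib_left
        by (intro sum.cong refl) (simp add: sum_distrib_left mult_ac)
      also have "\<dots> = (\<Sum>a\<in>I. \<Sum>k\<in>J. \<Sum>b\<in>I. t a * ((s k)\<^sup>2 * B a k * B b k) * t b)"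
        by (rule sum.swap)
      also have "\<dots> = (\<Sum>a\<in>I. \<Sum>b\<in>I. \<Sum>k\<in>J. t a * ((s k)\<^sup>2 * B a k * B b k) * t b)"
        by (intro sum.cong refl sum.swap)
      also have "\<dots> = (\<Sum>a\<in>I. \<Sum>b\<in>I. t a * (\<Sum>k\<in>J. (s k)\<^sup>2 * B a k * B b k) * t b)"
        by (simp add: sum_distrib_left sum_distrib_right)
      finally show ?thesis by (simp add: sum_negf sum_divide_distrib[symmetric])
    qed
    finally show ?thesis .
  qed
  then show ?thesis
    unfolding centered_gaussian_def eq using prob_space_distr[OF X] by simp
qed

lemma centered_gaussian_cong:
  assumes "\<And>a b. a \<in> I \<Longrightarrow> b \<in> I \<Longrightarrow> S a b = S' a b"
  shows "centered_gaussian I S \<mu> \<longleftrightarrow> centered_gaussian I S' \<mu>"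
proof -
  have "(\<Sum>k\<in>I. \<Sum>l\<in>I. t k * S k l * t l) = (\<Sum>k\<in>I. \<Sum>l\<in>I. t k * S' k l * t l)" for t
    using assms by (intro sum.cong refl) simp
  then show ?thesis by (simp add: centered_gaussian_def)
qed

section \<open>Positive semidefinite matrices and the existence of Gaussian measures\<close>

definition psd_on :: "'i set \<Rightarrow> ('i \<Rightarrow> 'i \<Rightarrow> real) \<Rightarrow> bool" where
  "psd_on I S \<longleftrightarrow> (\<forall>a\<in>I. \<forall>b\<in>I. S a b = S b a) \<and>
     (\<forall>t. 0 \<le> (\<Sum>a\<in>I. \<Sum>b\<in>I. t a * S a b * t b))"

lemma quadratic_form_insert:
  fixes S :: "'i \<Rightarrow> 'i \<Rightarrow> real"
  assumes "finite I" "i \<notin> I" and sym: "\<And>a. a \<in> I \<Longrightarrow> S i a = S a i"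
  shows "(\<Sum>a\<in>insert i I. \<Sum>b\<in>insert i I. t a * S a b * t b)
    = (t i)\<^sup>2 * S i i + 2 * t i * (\<Sum>a\<in>I. t a * S a i) + (\<Sum>a\<in>I. \<Sum>b\<in>I. t a * S a b * t b)"
proof -
  have "(\<Sum>b\<in>I. t i * S i b * t b) = t i * (\<Sum>a\<in>I. t a * S a i)"
    unfolding sum_distrib_left by (intro sum.cong refl) (simp add: sym)
  moreover have "(\<Sum>a\<in>I. t a * S a i * t i) = t i * (\<Sum>a\<in>I. t a * S a i)"
    unfolding sum_distrib_left by (intro sum.cong refl) simp
  ultimately show ?thesis
    using assms(1,2) by (simp add: sum.distrib power2_eq_square)
qed

text \<open>Cholesky factorisation: the induction step replaces \<open>S\<close> by its Schur complement with respect
  to the new index. Since \<open>x / 0 = 0\<close>, a vanishing pivot needs no separate treatment, except that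
  its row must vanish too.\<close>
lemma psd_on_factor:
  assumes "finite I" "psd_on I S"
  shows "\<exists>B. \<forall>a\<in>I. \<forall>b\<in>I. S a b = (\<Sum>k\<in>I. B a k * B b k)"
  using assms
proof (induction I arbitrary: S rule: finite_induct)
  case (insert i I)
  have sym: "\<And>a b. a \<in> insert i I \<Longrightarrow> b \<in> insert i I \<Longrightarrow> S a b = S b a"
    and pos: "\<And>t. 0 \<le> (\<Sum>a\<in>insert i I. \<Sum>b\<in>insert i I. t a * S a b * t b)"
    using insert.prems unfolding psd_on_def by blast+
  have pos': "0 \<le> (t i)\<^sup>2 * S i i + 2 * t i * (\<Sum>a\<in>I. t a * S a i) + (\<Sum>a\<in>I. \<Sum>b\<in>I. t a * S a b * t b)" for t
    using pos[of t] quadratic_form_insert[OF insert.hyps(1,2), of S t] sym by simp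
  have pivot0: "0 \<le> S i i"
    using pos'[of "\<lambda>a. if a = i then 1 else 0"] insert.hyps(2)
    by (simp add: if_distrib[where f="\<lambda>x. x * _"] if_distrib[where f="\<lambda>x. _ * x"] sum.neutral cong: if_cong)
  have row0: "S a i = 0" if "S i i = 0" "a \<in> I" for a
  proof (rule ccontr)
    assume ne: "S a i \<noteq> 0"
    \<comment> \<open>For the vector with entry \<open>x\<close> at \<open>i\<close> and 1 at
      \<open>a\<close>, the form equals \<open>2 * x * S a i + S a a\<close> because the pivot
      vanishes; this \<open>x\<close> makes it -1.\<close>
    define x where "x = - (S a a + 1) / (2 * S a i)"
    define t where "t b = (if b = i then x else if b = a then 1 else 0)" for b
    have tI: "t b = (if b = a then 1 else 0)" if "b \<in> I" for b
      using that insert.hyps(2) by (auto simp: t_def)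
    have "(\<Sum>b\<in>I. t b * S b i) = (\<Sum>b\<in>I. (if b = a then 1 else 0) * S b i)"
      by (intro sum.cong refl) (simp add: tI)
    also have "\<dots> = S a i" using that(2) insert.hyps(1) by (simp add: if_distrib[where f="\<lambda>x. x * _"] cong: if_cong)
    finally have 1: "(\<Sum>b\<in>I. t b * S b i) = S a i" .
    have "(\<Sum>b\<in>I. \<Sum>c\<in>I. t b * S b c * t c)
        = (\<Sum>b\<in>I. \<Sum>c\<in>I. (if b = a then 1 else 0) * S b c * (if c = a then 1 else 0))"
      by (intro sum.cong refl) (simp add: tI)
    also have "\<dots> = S a a" by (subst quadratic_form_single[OF insert.hyps(1) that(2)]) simp
    finally have 2: "(\<Sum>b\<in>I. \<Sum>c\<in>I. t b * S b c * t c) = S a a" .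
    have "0 \<le> 2 * x * S a i + S a a"
      using pos'[of t] that(1) unfolding 1 2 by (simp add: t_def)
    also have "\<dots> = - 1" unfolding x_def using ne by (simp add: field_simps)
    finally show False by simp
  qed
  define c where "c a = S a i / sqrt (S i i)" for a
  define S' where "S' a b = S a b - c a * c b" for a b
  have "psd_on I S'"
    unfolding psd_on_def
  proof (intro conjI ballI allI)
    show "S' a b = S' b a" if "a \<in> I" "b \<in> I" for a b using sym that by (simp add: S'_def)
    fix t :: "'a \<Rightarrow> real"
    define v where "v = (\<Sum>a\<in>I. t a * S a i)"
    \<comment> \<open>The entry at \<open>i\<close> minimises the quadratic form when the other
      entries are fixed; the minimum is the form of the Schur complement.\<close>
    define t' where "t' = t(i := - v / S i i)"
    have t'I: "t' a = t a" if "a \<in> I" for a using that insert.hyps(2) by (auto simp: t'_def)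
    have "(\<Sum>a\<in>I. t' a * S a i) = v" unfolding v_def by (intro sum.cong refl) (simp add: t'I)
    moreover have "(\<Sum>a\<in>I. \<Sum>b\<in>I. t' a * S a b * t' b) = (\<Sum>a\<in>I. \<Sum>b\<in>I. t a * S a b * t b)"
      by (intro sum.cong refl) (simp add: t'I)
    ultimately have "0 \<le> (v / S i i)\<^sup>2 * S i i - 2 * v / S i i * v + (\<Sum>a\<in>I. \<Sum>b\<in>I. t a * S a b * t b)"
      using pos'[of t'] by (simp add: t'_def)
    also have "(v / S i i)\<^sup>2 * S i i - 2 * v / S i i * v = - (v * v / S i i)"
      by (cases "S i i = 0") (simp_all add: field_simps power2_eq_square)
    also have "v * v / S i i = (\<Sum>a\<in>I. t a * c a) * (\<Sum>b\<in>I. t b * c b)"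
    proof -
      have "(\<Sum>a\<in>I. t a * c a) = v / sqrt (S i i)"
        unfolding v_def c_def sum_divide_distrib by simp
      then show ?thesis using pivot0 by simp
    qed
    also have "- \<dots> + (\<Sum>a\<in>I. \<Sum>b\<in>I. t a * S a b * t b) = (\<Sum>a\<in>I. \<Sum>b\<in>I. t a * S' a b * t b)"
      unfolding sum_product S'_def by (simp add: algebra_simps sum_subtractf)
    finally show "0 \<le> (\<Sum>a\<in>I. \<Sum>b\<in>I. t a * S' a b * t b)" .
  qed
  then obtain B where B: "\<And>a b. a \<in> I \<Longrightarrow> b \<in> I \<Longrightarrow> S' a b = (\<Sum>k\<in>I. B a k * B b k)"
    using insert.IH by blast
  \<comment> \<open>In block form, row \<open>i\<close> is the root of the pivot followed by zeros,
    and row \<open>a\<close> is \<open>c a\<close> followed by row \<open>a\<close> of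
    \<open>B\<close>.\<close>
  define D where "D a k = (if k = i then (if a = i then sqrt (S i i) else c a)
    else (if a = i then 0 else B a k))" for a k
  have cp: "c a * sqrt (S i i) = S a i" if "a \<in> I" for a
    using row0 that pivot0 by (cases "S i i = 0") (simp_all add: c_def)
  have "S a b = (\<Sum>k\<in>insert i I. D a k * D b k)" if ab: "a \<in> insert i I" "b \<in> insert i I" for a b
  proof -
    have "(\<Sum>k\<in>insert i I. D a k * D b k) = D a i * D b i + (\<Sum>k\<in>I. D a k * D b k)"
      using insert.hyps by simp
    also have "(\<Sum>k\<in>I. D a k * D b k)
        = (if a = i \<or> b = i then 0 else (\<Sum>k\<in>I. B a k * B b k))"
      using insert.hyps(2) by (auto simp: D_def intro!: sum.cong sum.neutral)
    also have "D a i * D b i + (if a = i \<or> b = i then 0 else (\<Sum>k\<in>I. B a k * B b k)) = S a b"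
    proof (cases "a = i \<or> b = i")
      case True
      then show ?thesis
        using cp[of a] cp[of b] ab pivot0 sym[of a b] by (auto simp: D_def mult.commute)
    next
      case False
      then show ?thesis
        using B[of a b] ab by (auto simp: D_def S'_def)
    qed
    finally show ?thesis by simp
  qed
  then show ?case by blast
qed simp

text \<open>With \<open>S\<close> factored as \<open>B\<close> times its transpose, the image of
  independent standard normals under \<open>B\<close> has covariance \<open>S\<close>. This is the
  witness behind the \<open>SOME\<close> in the kernel recursion.\<close>

lemma centered_gaussian_exists:
  assumes "finite I" "psd_on I S"
  obtains \<mu> where "centered_gaussian I S \<mu>"
proof -
  obtain B where B: "\<And>a b. a \<in> I \<Longrightarrow> b \<in> I \<Longrightarrow> S a b = (\<Sum>k\<in>I. B a k * B b k)"
    using psd_on_factor[OF assms] by blast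
  have "centered_gaussian I S (distr (PiM I (\<lambda>k. centered_normal 1)) (PiM I (\<lambda>_. borel))
      (\<lambda>y. \<lambda>a\<in>I. \<Sum>k\<in>I. B a k * y k))"
    using centered_gaussian_linear_image[OF assms(1,1), of "\<lambda>_. 1" B]
    by (subst centered_gaussian_cong[OF B]) simp_all
  then show ?thesis by (rule that)
qed

text \<open>Writing the coefficient of \<open>y j\<close> as a sum of indicators describes the
  sparse matrix of one channel without inverting \<open>w\<close>. A sum over all weights then
  collapses to the weights that feed this channel.\<close>

lemma channel_sum:
  fixes w :: "'k \<Rightarrow> 'c \<Rightarrow> 'j" and f :: "'k \<Rightarrow> real"
  assumes J: "finite J" and K: "finite K"
    and w: "\<And>k. k \<in> K \<Longrightarrow> w k c \<in> J"
  shows "(\<Sum>j\<in>J. (\<Sum>k\<in>K. if j = w k c then f k else 0) * y j) = (\<Sum>k\<in>K. f k * y (w k c))"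
proof -
  have "(\<Sum>j\<in>J. (\<Sum>k\<in>K. if j = w k c then f k else 0) * y j)
      = (\<Sum>j\<in>J. \<Sum>k\<in>K. if j = w k c then f k * y (w k c) else 0)"
    unfolding sum_distrib_right by (intro sum.cong refl) auto
  also have "\<dots> = (\<Sum>k\<in>K. \<Sum>j\<in>J. if j = w k c then f k * y (w k c) else 0)"
    by (rule sum.swap)
  also have "\<dots> = (\<Sum>k\<in>K. f k * y (w k c))"
    using J w by (intro sum.cong refl) simp
  finally show ?thesis .
qed

text \<open>The weights \<open>y (w k c)\<close> feeding channel \<open>c\<close> are disjoint for different channels, which makes
  the covariance block diagonal.\<close>
lemma centered_gaussian_channels:
  fixes w :: "'k \<Rightarrow> 'c \<Rightarrow> 'j"
  assumes fin: "finite J" "finite K" "finite I"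
    and w: "\<And>k c. k \<in> K \<Longrightarrow> c \<in> Ch \<Longrightarrow> w k c \<in> J \<and> s (w k c) = \<tau>"
    and inj: "\<And>k k' c c'. k \<in> K \<Longrightarrow> k' \<in> K \<Longrightarrow> c \<in> Ch \<Longrightarrow> c' \<in> Ch \<Longrightarrow> w k c = w k' c' \<Longrightarrow> k = k' \<and> c = c'"
    and s: "\<And>j. j \<in> J \<Longrightarrow> s j > 0" and ch: "\<And>a. a \<in> I \<Longrightarrow> ch a \<in> Ch"
  shows "centered_gaussian I (\<lambda>a b. if ch a = ch b then \<tau>\<^sup>2 * (\<Sum>k\<in>K. v a k * v b k) else 0)
    (distr (PiM J (\<lambda>j. centered_normal (s j))) (PiM I (\<lambda>_. borel))
       (\<lambda>y. \<lambda>a\<in>I. \<Sum>k\<in>K. v a k * y (w k (ch a))))"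
proof -
  define B where "B a j = (\<Sum>k\<in>K. if j = w k (ch a) then v a k else 0)" for a j
  have B: "(\<Sum>j\<in>J. B a j * y j) = (\<Sum>k\<in>K. v a k * y (w k (ch a)))" if "a \<in> I" for a y
    unfolding B_def using w ch[OF that] by (intro channel_sum fin) auto
  have cov: "(\<Sum>j\<in>J. (s j)\<^sup>2 * B a j * B b j) = (if ch a = ch b then \<tau>\<^sup>2 * (\<Sum>k\<in>K. v a k * v b k) else 0)"
    if "a \<in> I" "b \<in> I" for a b
  proof -
    \<comment> \<open>The covariance sum is itself an instance of the collapse \<open>B\<close>,
      with \<open>(s j)\<^sup>2 * B b j\<close> in the role of \<open>y j\<close>.\<close>
    have "(\<Sum>j\<in>J. (s j)\<^sup>2 * B a j * B b j) = (\<Sum>j\<in>J. B a j * ((s j)\<^sup>2 * B b j))"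
      by (simp add: mult_ac)
    also have "\<dots> = (\<Sum>k\<in>K. v a k * ((s (w k (ch a)))\<^sup>2 * B b (w k (ch a))))"
      by (rule B[OF that(1)])
    also have "\<dots> = (\<Sum>k\<in>K. if ch a = ch b then \<tau>\<^sup>2 * (v a k * v b k) else 0)"
    proof (intro sum.cong refl)
      fix k assume k: "k \<in> K"
      have eq: "w k (ch a) = w k' (ch b) \<longleftrightarrow> k' = k \<and> ch a = ch b" if "k' \<in> K" for k'
        using inj[OF k that ch[OF \<open>a \<in> I\<close>] ch[OF \<open>b \<in> I\<close>]] by auto
      have "B b (w k (ch a)) = (\<Sum>k'\<in>K. if k' = k then (if ch a = ch b then v b k else 0) else 0)"
        unfolding B_def by (intro sum.cong refl) (simp add: eq)
      also have "\<dots> = (if ch a = ch b then v b k else 0)" using k fin by simp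
      finally show "v a k * ((s (w k (ch a)))\<^sup>2 * B b (w k (ch a))) = (if ch a = ch b then \<tau>\<^sup>2 * (v a k * v b k) else 0)"
        using w[OF k ch[OF that(1)]] by simp
    qed
    finally show ?thesis by (simp add: sum_distrib_left)
  qed
  have "(\<lambda>y. \<lambda>a\<in>I. \<Sum>j\<in>J. B a j * y j) = (\<lambda>y. \<lambda>a\<in>I. \<Sum>k\<in>K. v a k * y (w k (ch a)))"
    by (intro ext restrict_ext B) auto
  with centered_gaussian_linear_image[where s = s and B = B, OF fin(1,3) s] show ?thesis
    by (simp add: centered_gaussian_cong[OF cov])
qed

text \<open>Independent copies for \<open>C\<close> channels, realised as an artificial layer: unit
  normals indexed by pairs of a factor index and a channel, with a factorisation of \<open>S\<close>
  as coefficients.\<close>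

lemma centered_gaussian_kron_exists:
  assumes A: "finite X" "finite Y" and psd: "psd_on (X \<times> Y) S"
  obtains \<mu> where "centered_gaussian (X \<times> {1..C} \<times> Y) (kron_cov S) \<mu>"
proof -
  obtain B where B: "\<And>a b. a \<in> X \<times> Y \<Longrightarrow> b \<in> X \<times> Y \<Longrightarrow> S a b = (\<Sum>k\<in>X \<times> Y. B a k * B b k)"
    using psd_on_factor[OF _ psd] A by blast
  define ch :: "nat \<times> nat \<times> nat \<Rightarrow> nat" where "ch = (\<lambda>(i, c, p). c)"
  define v :: "nat \<times> nat \<times> nat \<Rightarrow> nat \<times> nat \<Rightarrow> real" where "v = (\<lambda>(i, c, p) k. B (i, p) k)"
  have "centered_gaussian (X \<times> {1..C} \<times> Y)
      (\<lambda>a b. if ch a = ch b then 1\<^sup>2 * (\<Sum>k\<in>X \<times> Y. v a k * v b k) else 0)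
    (distr (PiM ((X \<times> Y) \<times> {1..C}) (\<lambda>j. centered_normal 1)) (PiM (X \<times> {1..C} \<times> Y) (\<lambda>_. borel))
       (\<lambda>y. \<lambda>a\<in>X \<times> {1..C} \<times> Y. \<Sum>k\<in>X \<times> Y. v a k * y (Pair k (ch a))))"
    by (rule centered_gaussian_channels[where Ch = "{1..C}"]) (use A in \<open>auto simp: ch_def\<close>)
  then show ?thesis
    by (intro that, subst centered_gaussian_cong) (auto simp: kron_cov_def ch_def v_def B)
qed

text \<open>Continuity at a covariance difference of zero. It stands in for uniqueness of the
  Gaussian law, and allows the law of a channel to be exchanged for any Gaussian measure with the
  same covariance.\<close>

lemma centered_gaussian_integral_unique:
  fixes I :: "'i::countable set"
  assumes "finite I" "g \<in> borel_measurable (PiM I (\<lambda>_. borel))"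
    and "continuous_on (PiE I (\<lambda>_. UNIV)) g" "sub_gaussian_growth I g"
    and "centered_gaussian I S \<mu>" "centered_gaussian I S \<nu>"
  shows "(\<integral>z. g z \<partial>\<mu>) = (\<integral>z. g z \<partial>\<nu>)"
proof -
  have "\<bar>(\<integral>z. g z \<partial>\<mu>) - (\<integral>z. g z \<partial>\<nu>)\<bar> \<le> e" if "e > 0" for e
    using centered_gaussian_integral_continuous[OF assms(1-4,6) that] assms(5)
    by (metis abs_0 cancel_comm_monoid_add_class.diff_cancel order_less_imp_le)
  then show ?thesis by (metis abs_le_zero_iff eq_iff_diff_eq_0 field_le_epsilon add_0)
qed

lemma centered_gaussian_integrable_sub_gaussian:
  assumes "finite I" "g \<in> borel_measurable (PiM I (\<lambda>_. borel))"
    and "sub_gaussian_growth I g" "centered_gaussian I S \<mu>"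
  shows "integrable \<mu> g"
proof -
  obtain B where "\<And>S' \<mu>. centered_gaussian I S' \<mu> \<Longrightarrow> (\<And>k. k \<in> I \<Longrightarrow> S' k k \<le> (\<Sum>k\<in>I. \<bar>S k k\<bar>)) \<Longrightarrow>
       integrable \<mu> g \<and> (\<integral>z. \<bar>g z\<bar> \<partial>\<mu>) \<le> B"
    using sub_gaussian_growth_moment[OF assms(1,3,2)] by blast
  moreover have "S k k \<le> (\<Sum>k\<in>I. \<bar>S k k\<bar>)" if "k \<in> I" for k
    using member_le_sum[of k I "\<lambda>k. \<bar>S k k\<bar>"] that assms(1) by fastforce
  ultimately show ?thesis using assms(4) by blast
qed

section \<open>Concentration of averages over channels\<close>

lemma (in prob_space) pairwise_independent_weak_law:
  fixes X :: "'c \<Rightarrow> 'a \<Rightarrow> real" and \<epsilon> :: real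
  assumes Ch: "finite Ch" "Ch \<noteq> {}" and \<epsilon>: "\<epsilon> > 0"
    and ind: "\<And>c c'. c \<in> Ch \<Longrightarrow> c' \<in> Ch \<Longrightarrow> c \<noteq> c' \<Longrightarrow> indep_var borel (X c) borel (X c')"
    and int: "\<And>c. c \<in> Ch \<Longrightarrow> integrable M (X c)" "\<And>c. c \<in> Ch \<Longrightarrow> integrable M (\<lambda>\<omega>. X c \<omega> * X c \<omega>)"
    and mean: "\<And>c. c \<in> Ch \<Longrightarrow> expectation (X c) = m"
    and sq: "\<And>c. c \<in> Ch \<Longrightarrow> expectation (\<lambda>\<omega>. X c \<omega> * X c \<omega>) = q"
  shows "prob {\<omega> \<in> space M. \<bar>(\<Sum>c\<in>Ch. X c \<omega>) / card Ch - m\<bar> \<ge> \<epsilon>} \<le> q / (card Ch * \<epsilon>\<^sup>2)"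
proof -
  define n where "n = real (card Ch)"
  have n: "n > 0" using Ch by (simp add: n_def card_gt_0_iff)
  define D where "D c \<omega> = X c \<omega> - m" for c \<omega>
  have prod_int: "integrable M (\<lambda>\<omega>. X c \<omega> * X c' \<omega>)" if "c \<in> Ch" "c' \<in> Ch" for c c'
    using that int ind indep_var_integrable by (cases "c = c'") blast+
  have DD: "integrable M (\<lambda>\<omega>. D c \<omega> * D c' \<omega>)"
    \<comment> \<open>Independence removes all covariances of the centred variables, so only the
      diagonal contributes to the variance of the average.\<close>
    "expectation (\<lambda>\<omega>. D c \<omega> * D c' \<omega>) = (if c = c' then q - m\<^sup>2 else 0)" if c: "c \<in> Ch" "c' \<in> Ch" for c c'
  proof -
    have eq: "(\<lambda>\<omega>. D c \<omega> * D c' \<omega>) = (\<lambda>\<omega>. X c \<omega> * X c' \<omega> - m * X c \<omega> - m * X c' \<omega> + m\<^sup>2)"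
      by (auto simp: D_def algebra_simps power2_eq_square)
    show "integrable M (\<lambda>\<omega>. D c \<omega> * D c' \<omega>)"
      unfolding eq using prod_int[OF c] int(1)[OF c(1)] int(1)[OF c(2)] by simp
    have "expectation (\<lambda>\<omega>. X c \<omega> * X c' \<omega>) = (if c = c' then q else m * m)"
      using sq[OF c(1)] indep_var_lebesgue_integral[OF ind[OF c] int(1)[OF c(1)] int(1)[OF c(2)]]
        mean[OF c(1)] mean[OF c(2)] by auto
    moreover have "expectation (\<lambda>\<omega>. D c \<omega> * D c' \<omega>)
        = expectation (\<lambda>\<omega>. X c \<omega> * X c' \<omega>) - m * expectation (X c) - m * expectation (X c') + m\<^sup>2"
      unfolding eq using prod_int[OF c] int(1)[OF c(1)] int(1)[OF c(2)] by (simp add: prob_space)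
    ultimately show "expectation (\<lambda>\<omega>. D c \<omega> * D c' \<omega>) = (if c = c' then q - m\<^sup>2 else 0)"
      using mean c by (simp add: power2_eq_square)
  qed
  have U: "((\<Sum>c\<in>Ch. X c \<omega>) / n - m)\<^sup>2 = (\<Sum>c\<in>Ch. \<Sum>c'\<in>Ch. D c \<omega> * D c' \<omega>) / n\<^sup>2" for \<omega>
  proof -
    have "(\<Sum>c\<in>Ch. X c \<omega>) / n - m = (\<Sum>c\<in>Ch. D c \<omega>) / n"
      using n by (simp add: D_def sum_subtractf n_def[symmetric] field_simps)
    then show ?thesis by (simp add: power_divide sum_product power2_eq_square)
  qed
  have Ui: "integrable M (\<lambda>\<omega>. ((\<Sum>c\<in>Ch. X c \<omega>) / n - m)\<^sup>2)"
    unfolding U by (intro integrable_divide Bochner_Integration.integrable_sum DD)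
  have "expectation (\<lambda>\<omega>. ((\<Sum>c\<in>Ch. X c \<omega>) / n - m)\<^sup>2)
      = (\<Sum>c\<in>Ch. \<Sum>c'\<in>Ch. expectation (\<lambda>\<omega>. D c \<omega> * D c' \<omega>)) / n\<^sup>2"
    unfolding U using DD(1) by (simp add: Bochner_Integration.integral_sum)
  also have "\<dots> = (\<Sum>c\<in>Ch. \<Sum>c'\<in>Ch. if c = c' then q - m\<^sup>2 else 0) / n\<^sup>2"
    using DD(2) by (simp cong: sum.cong)
  also have "\<dots> = (q - m\<^sup>2) / n"
    using Ch n by (simp add: n_def[symmetric] power2_eq_square)
  \<comment> \<open>Passing from the variance to the raw second moment leaves a quantity that the
    Gaussian moment bounds control directly.\<close>
  also have "\<dots> \<le> q / n" using n by (intro divide_right_mono) auto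
  finally have E: "expectation (\<lambda>\<omega>. ((\<Sum>c\<in>Ch. X c \<omega>) / n - m)\<^sup>2) \<le> q / n" .
  have "{\<omega> \<in> space M. \<bar>(\<Sum>c\<in>Ch. X c \<omega>) / n - m\<bar> \<ge> \<epsilon>}
      = {\<omega> \<in> space M. ((\<Sum>c\<in>Ch. X c \<omega>) / n - m)\<^sup>2 \<ge> \<epsilon>\<^sup>2}"
    using \<epsilon> by (simp add: abs_le_square_iff[symmetric])
  also have "prob \<dots> \<le> expectation (\<lambda>\<omega>. ((\<Sum>c\<in>Ch. X c \<omega>) / n - m)\<^sup>2) / \<epsilon>\<^sup>2"
    by (rule integral_Markov_inequality_measure[OF Ui sets.empty_sets]) (use \<epsilon> in auto)
  also have "\<dots> \<le> (q / n) / \<epsilon>\<^sup>2" by (intro divide_right_mono E) simp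
  finally show ?thesis by (simp add: n_def)
qed

text \<open>Each channel sees the same linear form in its own weights, so the arguments of
  \<open>F\<close> are independent with common covariance \<open>S\<close>. Mean and second moment
  are stated for an arbitrary Gaussian \<mu> with this covariance, the form in which the estimates
  uniform in \<open>S\<close> apply.\<close>

lemma channel_average_concentration:
  fixes w :: "'k \<Rightarrow> 'c \<Rightarrow> 'j" and A :: "'a::countable set" and Ch :: "'c set" and \<epsilon> :: real
  assumes fin: "finite J" "finite K" "finite A" "finite Ch" and Ch: "Ch \<noteq> {}" and \<epsilon>: "\<epsilon> > 0"
    and w: "\<And>k c. k \<in> K \<Longrightarrow> c \<in> Ch \<Longrightarrow> w k c \<in> J \<and> s (w k c) = \<tau>"
    and inj: "\<And>k k' c c'. k \<in> K \<Longrightarrow> k' \<in> K \<Longrightarrow> c \<in> Ch \<Longrightarrow> c' \<in> Ch \<Longrightarrow> w k c = w k' c' \<Longrightarrow> k = k' \<and> c = c'"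
    and s: "\<And>j. j \<in> J \<Longrightarrow> s j > 0"
    and Fm: "F \<in> borel_measurable (PiM A (\<lambda>_. borel))"
    and Fc: "continuous_on (PiE A (\<lambda>_. UNIV)) F" and Fg: "sub_gaussian_growth A F"
    and cg: "centered_gaussian A S \<mu>"
    and S: "\<And>a b. a \<in> A \<Longrightarrow> b \<in> A \<Longrightarrow> S a b = \<tau>\<^sup>2 * (\<Sum>k\<in>K. v a k * v b k)"
  shows "measure (PiM J (\<lambda>j. centered_normal (s j)))
      {y \<in> space (PiM J (\<lambda>_. borel)). \<bar>(\<Sum>c\<in>Ch. F (\<lambda>a\<in>A. \<Sum>k\<in>K. v a k * y (w k c))) / card Ch - (\<integral>z. F z \<partial>\<mu>)\<bar> \<ge> \<epsilon>}
    \<le> (\<integral>z. F z * F z \<partial>\<mu>) / (card Ch * \<epsilon>\<^sup>2)"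
proof -
  let ?Q = "PiM J (\<lambda>j. centered_normal (s j))"
  have pN: "prob_space (centered_normal (s j))" if "j \<in> J" for j
    using prob_space_centered_normal[OF s[OF that]] .
  interpret Q: prob_space ?Q by (intro prob_space_PiM pN)
  define h where "h c y = (\<lambda>a\<in>A. \<Sum>k\<in>K. v a k * y (w k c))" for c and y :: "'j \<Rightarrow> real"
  \<comment> \<open>The weights that feed channel \<open>c\<close>. Since \<open>h c\<close> reads
    no others and these sets are disjoint, independence of the coordinates passes to the
    channels.\<close>
  define W where "W c = (\<lambda>k. w k c) ` K" for c
  have WJ: "W c \<subseteq> J" if "c \<in> Ch" for c using w that by (auto simp: W_def)
  have hm: "h c \<in> measurable (PiM (W c) (\<lambda>_. borel)) (PiM A (\<lambda>_. borel))" for c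
    unfolding h_def W_def
    by (intro measurable_restrict borel_measurable_sum borel_measurable_times borel_measurable_const
        measurable_component_singleton) auto
  have hr: "h c (restrict y (W c)) = h c y" for c y
    unfolding h_def W_def by (intro restrict_ext sum.cong refl) auto
  have hmJ: "h c \<in> measurable ?Q (PiM A (\<lambda>_. borel))" if "c \<in> Ch" for c
    unfolding h_def measurable_PiM_centered_normal using w that
    by (intro measurable_restrict borel_measurable_sum borel_measurable_times borel_measurable_const
        measurable_component_singleton) auto
  have law: "centered_gaussian A S (distr ?Q (PiM A (\<lambda>_. borel)) (h c))" if c: "c \<in> Ch" for c
  proof -
    have "centered_gaussian A (\<lambda>a b. if c = c then \<tau>\<^sup>2 * (\<Sum>k\<in>K. v a k * v b k) else 0)
      (distr ?Q (PiM A (\<lambda>_. borel)) (\<lambda>y. \<lambda>a\<in>A. \<Sum>k\<in>K. v a k * y (w k c)))"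
      by (rule centered_gaussian_channels[where Ch = Ch and ch = "\<lambda>_. c"])
         (use fin w inj s c in \<open>auto\<close>)
    then show ?thesis
      unfolding h_def by (subst centered_gaussian_cong[OF S]) simp_all
  qed
  have F2m: "(\<lambda>z. F z * F z) \<in> borel_measurable (PiM A (\<lambda>_. borel))" using Fm by measurable
  have F2c: "continuous_on (PiE A (\<lambda>_. UNIV)) (\<lambda>z. F z * F z)" by (intro continuous_on_mult Fc)
  note F2g = sub_gaussian_growth_mult[OF Fg Fg]
  have gen: "integrable ?Q (\<lambda>y. G (h c y))" "Q.expectation (\<lambda>y. G (h c y)) = (\<integral>z. G z \<partial>\<mu>)"
    if "c \<in> Ch" and G: "G \<in> borel_measurable (PiM A (\<lambda>_. borel))" "continuous_on (PiE A (\<lambda>_. UNIV)) G"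
      "sub_gaussian_growth A G" for c and G :: "('a \<Rightarrow> real) \<Rightarrow> real"
  proof -
    show "integrable ?Q (\<lambda>y. G (h c y))"
      using centered_gaussian_integrable_sub_gaussian[OF fin(3) G(1,3) law[OF that(1)]]
      by (subst (asm) integrable_distr_eq[OF hmJ[OF that(1)] G(1)])
    show "Q.expectation (\<lambda>y. G (h c y)) = (\<integral>z. G z \<partial>\<mu>)"
      using centered_gaussian_integral_unique[OF fin(3) G law[OF that(1)] cg]
      by (subst (asm) integral_distr[OF hmJ[OF that(1)] G(1)])
  qed
  have coord: "Q.indep_vars (\<lambda>_. borel) (\<lambda>j y. y j) J"
  \<comment> \<open>The criterion by the product law asks for a nonempty index set.\<close>
  proof (cases "J = {}")
    case True
    then show ?thesis unfolding Q.indep_vars_def2 Q.indep_sets_def by auto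
  next
    case False
    have rv: "(\<lambda>y. y j) \<in> measurable ?Q borel" if "j \<in> J" for j
      unfolding measurable_PiM_centered_normal using that by simp
    have "distr ?Q borel (\<lambda>y. y j) = centered_normal (s j)" if "j \<in> J" for j
    proof -
      have "distr ?Q borel (\<lambda>y. y j) = distr ?Q (centered_normal (s j)) (\<lambda>y. y j)"
        by (intro distr_cong) auto
      then show ?thesis using distr_PiM_component[OF pN that] by simp
    qed
    moreover have "distr ?Q (PiM J (\<lambda>_. borel)) (\<lambda>y. \<lambda>j\<in>J. y j) = ?Q"
    proof -
      have "distr ?Q (PiM J (\<lambda>_. borel)) (\<lambda>y. \<lambda>j\<in>J. y j) = distr ?Q ?Q (\<lambda>y. y)"
        by (intro distr_cong) (auto simp: sets_PiM_centered_normal space_PiM PiE_restrict)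
      then show ?thesis by simp
    qed
    ultimately show ?thesis
      by (subst Q.indep_vars_iff_distr_eq_PiM'[OF False rv]) (auto intro!: PiM_cong)
  qed
  have ind: "Q.indep_var borel (\<lambda>y. F (h c y)) borel (\<lambda>y. F (h c' y))"
    if c: "c \<in> Ch" "c' \<in> Ch" "c \<noteq> c'" for c c'
  proof -
    have "Q.indep_var (PiM (W c) (\<lambda>_. borel)) (\<lambda>y. restrict (\<lambda>j. y j) (W c))
        (PiM (W c') (\<lambda>_. borel)) (\<lambda>y. restrict (\<lambda>j. y j) (W c'))"
    proof (rule Q.indep_var_restrict[OF coord])
      show "W c \<inter> W c' = {}" using inj c by (auto simp: W_def)
    qed (use WJ c in auto)
    from Q.indep_var_compose[OF this measurable_compose[OF hm Fm] measurable_compose[OF hm Fm]]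
    show ?thesis by (simp add: comp_def hr)
  qed
  have "Q.prob {y \<in> space ?Q. \<bar>(\<Sum>c\<in>Ch. F (h c y)) / card Ch - (\<integral>z. F z \<partial>\<mu>)\<bar> \<ge> \<epsilon>}
      \<le> (\<integral>z. F z * F z \<partial>\<mu>) / (card Ch * \<epsilon>\<^sup>2)"
    using gen[OF _ Fm Fc Fg] gen[OF _ F2m F2c F2g] ind
    by (intro Q.pairwise_independent_weak_law[OF fin(4) Ch \<epsilon>]) auto
  moreover have "space ?Q = space (PiM J (\<lambda>_. borel))" by (simp add: space_PiM)
  ultimately show ?thesis by (simp add: h_def)
qed

subsection \<open>The network\<close>

lemma psd_on_cong:
  assumes "\<And>a b. a \<in> I \<Longrightarrow> b \<in> I \<Longrightarrow> S a b = S' a b" "psd_on I S'"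
  shows "psd_on I S"
proof -
  have "(\<Sum>a\<in>I. \<Sum>b\<in>I. t a * S a b * t b) = (\<Sum>a\<in>I. \<Sum>b\<in>I. t a * S' a b * t b)" for t
    using assms(1) by (intro sum.cong refl) simp
  with assms show ?thesis by (simp add: psd_on_def)
qed

text \<open>The quadratic form of a Gram matrix is a sum of squares.\<close>

lemma psd_on_gram: "psd_on I (\<lambda>a b. \<Sum>k\<in>K. f k a * f k b)"
proof -
  have "(\<Sum>a\<in>I. \<Sum>b\<in>I. t a * (\<Sum>k\<in>K. f k a * f k b) * t b) = (\<Sum>k\<in>K. (\<Sum>a\<in>I. t a * f k a)\<^sup>2)" for t
  proof -
    have "(\<Sum>a\<in>I. \<Sum>b\<in>I. t a * (\<Sum>k\<in>K. f k a * f k b) * t b)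
        = (\<Sum>a\<in>I. \<Sum>b\<in>I. \<Sum>k\<in>K. (t a * f k a) * (t b * f k b))"
      by (simp add: sum_distrib_left sum_distrib_right mult_ac)
    also have "\<dots> = (\<Sum>a\<in>I. \<Sum>k\<in>K. \<Sum>b\<in>I. (t a * f k a) * (t b * f k b))"
      by (intro sum.cong refl sum.swap)
    also have "\<dots> = (\<Sum>k\<in>K. \<Sum>a\<in>I. \<Sum>b\<in>I. (t a * f k a) * (t b * f k b))"
      by (rule sum.swap)
    finally show ?thesis by (simp add: power2_eq_square sum_product)
  qed
  then show ?thesis by (simp add: psd_on_def mult.commute sum_nonneg)
qed

lemma psd_on_scale:
  assumes "psd_on I S" "c \<ge> 0"
  shows "psd_on I (\<lambda>a b. c * S a b)"
proof -
  have "(\<Sum>a\<in>I. \<Sum>b\<in>I. t a * (c * S a b) * t b) = c * (\<Sum>a\<in>I. \<Sum>b\<in>I. t a * S a b * t b)" for t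
    by (simp add: sum_distrib_left mult_ac)
  with assms show ?thesis by (simp add: psd_on_def)
qed

lemma psd_on_integral:
  assumes psd: "\<And>z. psd_on I (\<lambda>a b. F a b z)"
    and int: "\<And>a b. a \<in> I \<Longrightarrow> b \<in> I \<Longrightarrow> integrable M (F a b)"
  shows "psd_on I (\<lambda>a b. \<integral>z. F a b z \<partial>M)"
  unfolding psd_on_def
proof (intro conjI ballI allI)
  show "(\<integral>z. F a b z \<partial>M) = (\<integral>z. F b a z \<partial>M)" if "a \<in> I" "b \<in> I" for a b
    using psd that unfolding psd_on_def by (intro Bochner_Integration.integral_cong refl) blast
  fix t
  have "(\<Sum>a\<in>I. \<Sum>b\<in>I. t a * (\<integral>z. F a b z \<partial>M) * t b) = (\<integral>z. (\<Sum>a\<in>I. \<Sum>b\<in>I. t a * F a b z * t b) \<partial>M)"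
    using int by (simp add: Bochner_Integration.integral_sum)
  also have "\<dots> \<ge> 0" using psd by (intro Bochner_Integration.integral_nonneg) (simp add: psd_on_def)
  finally show "0 \<le> (\<Sum>a\<in>I. \<Sum>b\<in>I. t a * (\<integral>z. F a b z \<partial>M) * t b)" .
qed

text \<open>The threshold \<open>y0\<close> solves
  \<open>B * y0 powr r = \<eta> * y0\<^sup>2\<close>: above it the quadratic term dominates because
  \<open>r < 2\<close>, below it the left side is bounded by its value there. The exponent 0 is
  separate, since \<open>gpow\<close> is then constantly 1.\<close>

lemma gpow_le_quadratic:
  assumes r: "0 \<le> r" "r < 2" and B: "B > 0" and \<eta>: "\<eta> > 0"
  obtains c where "\<And>y. y \<ge> 0 \<Longrightarrow> B * gpow y r \<le> c + \<eta> * y\<^sup>2"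
proof (cases "r = 0")
  case True
  then show ?thesis using \<eta> by (intro that[of B]) (simp add: gpow_def)
next
  case False
  define y0 where "y0 = (B / \<eta>) powr (1 / (2 - r))"
  have y0: "y0 > 0" "y0 powr (2 - r) = B / \<eta>"
    using r B \<eta> by (simp_all add: y0_def powr_powr)
  have "B * gpow y r \<le> B * y0 powr r + \<eta> * y\<^sup>2" if y: "y \<ge> 0" for y
  proof (cases "y \<le> y0")
    case True
    then have "B * y powr r \<le> B * y0 powr r" using B r y by (intro mult_left_mono powr_mono2) auto
    moreover have "0 \<le> \<eta> * y\<^sup>2" using \<eta> by simp
    ultimately show ?thesis using \<open>r \<noteq> 0\<close> by (simp add: gpow_def)
  next
    case False
    then have yp: "y > 0" using y0 by simp
    have "B = \<eta> * y0 powr (2 - r)" using y0(2) \<eta> by simp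
    also have "\<dots> \<le> \<eta> * y powr (2 - r)" using False y0 r \<eta> by (intro mult_left_mono powr_mono2) auto
    finally have "B * y powr r \<le> \<eta> * y powr (2 - r) * y powr r" by (intro mult_right_mono) auto
    also have "\<dots> = \<eta> * y\<^sup>2" using yp by (simp add: mult.assoc powr_add[symmetric])
    moreover have "0 \<le> B * y0 powr r" using B by simp
    ultimately show ?thesis using \<open>r \<noteq> 0\<close> by (simp add: gpow_def)
  qed
  then show ?thesis by (rule that)
qed

text \<open>Gathers the data that do not vary with \<open>n\<close>. The widths are not fixed here
  but remain arguments of the later definitions, so that estimates can be stated uniformly in
  them.\<close>

locale conv_net =
  fixes L P C0 :: nat
    and N :: "nat \<Rightarrow> nat"
    and \<sigma> :: "real \<Rightarrow> real"
    and Ms :: "nat \<Rightarrow> 'm set"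
    and R :: "nat \<Rightarrow> nat \<Rightarrow> 'm \<Rightarrow> (nat \<Rightarrow> real) \<Rightarrow> real"
    and lam :: "nat \<Rightarrow> real"
    and x :: "nat \<Rightarrow> nat \<Rightarrow> nat \<Rightarrow> real"
    and r A B :: real
  assumes C0: "C0 \<ge> 1"
    and \<sigma>_meas: "\<sigma> \<in> borel_measurable borel"
    and Ms: "\<And>l. l \<le> L \<Longrightarrow> finite (Ms l) \<and> Ms l \<noteq> {}"
    and R_meas: "\<And>l i m. l \<le> L \<Longrightarrow> i \<in> {1..N (Suc l)} \<Longrightarrow> m \<in> Ms l \<Longrightarrow>
                   R l i m \<in> borel_measurable (PiM {1..N l} (\<lambda>_. borel))"
    and lam: "\<And>l. l \<le> L \<Longrightarrow> lam l > 0"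
    and \<sigma>_cont: "continuous_on UNIV \<sigma>"
    and R_cont: "\<And>l i m. l \<in> {1..L} \<Longrightarrow> i \<in> {1..N (Suc l)} \<Longrightarrow> m \<in> Ms l \<Longrightarrow>
                   continuous_on (PiE {1..N l} (\<lambda>_. UNIV)) (R l i m)"
    and r: "0 \<le> r" "r < 2" and AB: "0 < A" "0 < B"
    and growth: "\<And>l i m z. l \<in> {1..L} \<Longrightarrow> i \<in> {1..N (Suc l)} \<Longrightarrow> m \<in> Ms l \<Longrightarrow> z \<in> PiE {1..N l} (\<lambda>_. UNIV) \<Longrightarrow>
                   \<bar>\<sigma> (R l i m z)\<bar> \<le> A * exp (B * gpow (sqrt (\<Sum>j\<in>{1..N l}. (z j)\<^sup>2)) r)"
begin

abbreviation pos :: "nat \<Rightarrow> (nat \<times> nat) set" where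
  "pos l \<equiv> {1..N l} \<times> {1..P}"

abbreviation K :: "nat \<Rightarrow> nat \<times> nat \<Rightarrow> nat \<times> nat \<Rightarrow> real" where
  "K \<equiv> kernel P C0 N Ms lam \<sigma> R x"

definition act :: "nat \<Rightarrow> nat \<Rightarrow> 'm \<Rightarrow> nat \<Rightarrow> (nat \<times> nat \<Rightarrow> real) \<Rightarrow> real" where
  "act l i m p z = \<sigma> (R l i m (restrict (\<lambda>a. z (a, p)) {1..N l}))"

text \<open>The common integrand: its Gaussian mean is the next kernel, and its average over the
  channels of layer \<open>l\<close> is the random covariance of the next layer.\<close>

definition cov_fun :: "nat \<Rightarrow> nat \<times> nat \<Rightarrow> nat \<times> nat \<Rightarrow> (nat \<times> nat \<Rightarrow> real) \<Rightarrow> real" where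
  "cov_fun l a b z = 1 / (lam l * real (card (Ms l))) *
     (\<Sum>m\<in>Ms l. act l (fst a) m (snd a) z * act l (fst b) m (snd b) z)"

definition Zlaw :: "nat \<Rightarrow> (nat \<times> nat \<Rightarrow> real) measure" where
  "Zlaw l = (SOME \<mu>. centered_gaussian (pos l) (K l) \<mu>)"

lemma act_measurable:
  assumes "l \<in> {1..L}" "i \<in> {1..N (Suc l)}" "m \<in> Ms l" "p \<in> {1..P}"
  shows "act l i m p \<in> borel_measurable (PiM (pos l) (\<lambda>_. borel))"
proof -
  have "(\<lambda>z. restrict (\<lambda>a. z (a, p)) {1..N l}) \<in> measurable (PiM (pos l) (\<lambda>_. borel)) (PiM {1..N l} (\<lambda>_. borel))"
    using assms by (intro measurable_restrict measurable_component_singleton) auto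
  from measurable_compose[OF measurable_compose[OF this R_meas] \<sigma>_meas] show ?thesis
    unfolding act_def[abs_def] using assms by auto
qed

lemma act_continuous:
  assumes "l \<in> {1..L}" "i \<in> {1..N (Suc l)}" "m \<in> Ms l"
  shows "continuous_on (PiE (pos l) (\<lambda>_. UNIV)) (act l i m p)"
proof -
  have "continuous_on UNIV (\<lambda>z::nat \<times> nat \<Rightarrow> real. restrict (\<lambda>a. z (a, p)) {1..N l})"
  proof (rule continuous_on_coordinatewise_then_product)
    fix j show "continuous_on UNIV (\<lambda>z::nat \<times> nat \<Rightarrow> real. restrict (\<lambda>a. z (a, p)) {1..N l} j)"
      by (cases "j \<in> {1..N l}") (simp_all only: restrict_apply if_True if_False
          continuous_on_product_coordinates continuous_on_const)
  qed
  then have "continuous_on UNIV (\<lambda>z::nat \<times> nat \<Rightarrow> real. \<sigma> (R l i m (restrict (\<lambda>a. z (a, p)) {1..N l})))"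
    by (intro continuous_on_compose2[OF \<sigma>_cont] continuous_on_compose2[OF R_cont[OF assms]]) auto
  then show ?thesis unfolding act_def[abs_def] by (rule continuous_on_subset) simp
qed

text \<open>The growth condition enters here. An activation looks at the positions of one input
  \<open>p\<close> only, and the norm of this slice is at most the norm of the whole array.\<close>

lemma act_growth:
  assumes l: "l \<in> {1..L}" "i \<in> {1..N (Suc l)}" "m \<in> Ms l" and p: "p \<in> {1..P}"
  shows "sub_gaussian_growth (pos l) (act l i m p)"
  unfolding sub_gaussian_growth_def
proof (intro allI impI)
  fix \<eta> :: real assume \<eta>: "\<eta> > 0"
  obtain c where c: "\<And>y. y \<ge> 0 \<Longrightarrow> B * gpow y r \<le> c + \<eta> * y\<^sup>2"
    using gpow_le_quadratic[OF r AB(2) \<eta>] by blast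
  have "\<bar>act l i m p z\<bar> \<le> A * exp c * exp (\<eta> * (\<Sum>k\<in>pos l. (z k)\<^sup>2))" for z
  proof -
    define y where "y = restrict (\<lambda>a. z (a, p)) {1..N l}"
    have "\<bar>act l i m p z\<bar> \<le> A * exp (B * gpow (sqrt (\<Sum>j\<in>{1..N l}. (y j)\<^sup>2)) r)"
      unfolding act_def y_def[symmetric] by (rule growth[OF l]) (simp add: y_def)
    also have "B * gpow (sqrt (\<Sum>j\<in>{1..N l}. (y j)\<^sup>2)) r \<le> c + \<eta> * (sqrt (\<Sum>j\<in>{1..N l}. (y j)\<^sup>2))\<^sup>2"
      by (rule c) (simp add: sum_nonneg)
    also have "(sqrt (\<Sum>j\<in>{1..N l}. (y j)\<^sup>2))\<^sup>2 = (\<Sum>j\<in>{1..N l}. (z (j, p))\<^sup>2)"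
      by (simp add: sum_nonneg y_def)
    also have "(\<Sum>j\<in>{1..N l}. (z (j, p))\<^sup>2) = (\<Sum>k\<in>(\<lambda>j. (j, p)) ` {1..N l}. (z k)\<^sup>2)"
      by (subst sum.reindex) (auto simp: inj_on_def)
    also have "\<dots> \<le> (\<Sum>k\<in>pos l. (z k)\<^sup>2)" using p by (intro sum_mono2) auto
    finally show ?thesis using AB \<eta> by (simp add: exp_add)
  qed
  then show "\<exists>A. \<forall>z\<in>PiE (pos l) (\<lambda>_. UNIV). \<bar>act l i m p z\<bar> \<le> A * exp (\<eta> * (\<Sum>k\<in>pos l. (z k)\<^sup>2))" by blast
qed

lemma cov_fun_regular:
  assumes l: "l \<in> {1..L}" and a: "a \<in> pos (Suc l)" "b \<in> pos (Suc l)"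
  shows "cov_fun l a b \<in> borel_measurable (PiM (pos l) (\<lambda>_. borel))"
    and "continuous_on (PiE (pos l) (\<lambda>_. UNIV)) (cov_fun l a b)"
    and "sub_gaussian_growth (pos l) (cov_fun l a b)"
proof -
  have ab: "fst a \<in> {1..N (Suc l)}" "snd a \<in> {1..P}" "fst b \<in> {1..N (Suc l)}" "snd b \<in> {1..P}"
    using a by auto
  show "cov_fun l a b \<in> borel_measurable (PiM (pos l) (\<lambda>_. borel))"
    unfolding cov_fun_def[abs_def]
    by (intro borel_measurable_times borel_measurable_const borel_measurable_sum act_measurable l ab)
  show "continuous_on (PiE (pos l) (\<lambda>_. UNIV)) (cov_fun l a b)"
    unfolding cov_fun_def[abs_def]
    by (intro continuous_on_mult continuous_on_const continuous_on_sum act_continuous l ab)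
  show "sub_gaussian_growth (pos l) (cov_fun l a b)"
    unfolding cov_fun_def[abs_def]
    by (intro sub_gaussian_growth_mult sub_gaussian_growth_sum act_growth l ab
        sub_gaussian_growth_bounded[where C = "\<bar>1 / (lam l * real (card (Ms l)))\<bar>"]) auto
qed

text \<open>Pulls the sum over \<open>Ms l\<close> under the integral. This needs integrability,
  hence the assumption that the measure chosen by \<open>SOME\<close> really is Gaussian.\<close>

lemma kernel_Suc:
  assumes "l \<in> {1..L}" and a: "a \<in> pos (Suc l)" "b \<in> pos (Suc l)"
    and cg: "centered_gaussian (pos l) (K l) (Zlaw l)"
  shows "K (Suc l) a b = (\<integral>z. cov_fun l a b z \<partial>Zlaw l)"
proof -
  obtain l' where l': "l = Suc l'" using assms(1) by (cases l) auto
  obtain i p j q where ab: "a = (i, p)" "b = (j, q)" by (cases a, cases b)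
  have ij: "i \<in> {1..N (Suc l)}" "j \<in> {1..N (Suc l)}" "p \<in> {1..P}" "q \<in> {1..P}"
    using a by (auto simp: ab)
  have int: "integrable (Zlaw l) (\<lambda>z. act l i m p z * act l j m q z)" if "m \<in> Ms l" for m
    using assms(1) ij that
    by (intro centered_gaussian_integrable_sub_gaussian[OF _ _ _ cg] sub_gaussian_growth_mult
        borel_measurable_times act_measurable act_growth) auto
  have "K (Suc l) a b = 1 / (lam l * real (card (Ms l))) *
      (\<Sum>m\<in>Ms l. \<integral>z. act l i m p z * act l j m q z \<partial>Zlaw l)"
    unfolding l' ab Zlaw_def by (simp add: Let_def act_def)
  also have "\<dots> = (\<integral>z. cov_fun l a b z \<partial>Zlaw l)"
    using int unfolding cov_fun_def by (simp add: Bochner_Integration.integral_sum ab)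
  finally show ?thesis .
qed

text \<open>The two claims need each other: semidefiniteness of a kernel provides a Gaussian measure
  for \<open>SOME\<close> to choose, and integrating Gram matrices against that measure makes the
  next kernel semidefinite.\<close>

lemma kernel_psd_Zlaw:
  assumes "l \<le> L"
  shows "psd_on (pos (Suc l)) (K (Suc l)) \<and> centered_gaussian (pos (Suc l)) (K (Suc l)) (Zlaw (Suc l))"
  using assms
proof (induction l)
  case 0
  have *: "psd_on (pos (Suc 0)) (K (Suc 0))"
  proof (rule psd_on_cong)
    let ?f = "\<lambda>(c, m) (i, p). R 0 i m (restrict (x p c) {1..N 0})"
    show "psd_on (pos (Suc 0)) (\<lambda>a b. 1 / (lam 0 * real C0 * real (card (Ms 0))) *
        (\<Sum>k\<in>{1..C0} \<times> Ms 0. ?f k a * ?f k b))"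
      using lam[of 0] by (intro psd_on_scale psd_on_gram) simp
  qed (auto simp: sum.cartesian_product split_def)
  from centered_gaussian_exists[OF _ *]
  have "centered_gaussian (pos (Suc 0)) (K (Suc 0)) (Zlaw (Suc 0))"
    unfolding Zlaw_def by (metis finite_SigmaI finite_atLeastAtMost someI_ex)
  with * show ?case ..
next
  case (Suc l)
  then have l: "Suc l \<in> {1..L}" and cg: "centered_gaussian (pos (Suc l)) (K (Suc l)) (Zlaw (Suc l))" by auto
  have *: "psd_on (pos (Suc (Suc l))) (K (Suc (Suc l)))"
  proof (rule psd_on_cong[OF kernel_Suc[OF l _ _ cg]])
    show "psd_on (pos (Suc (Suc l))) (\<lambda>a b. \<integral>z. cov_fun (Suc l) a b z \<partial>Zlaw (Suc l))"
    proof (rule psd_on_integral)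
      fix z
      show "psd_on (pos (Suc (Suc l))) (\<lambda>a b. cov_fun (Suc l) a b z)"
        unfolding cov_fun_def
        using lam[of "Suc l"] l
        by (intro psd_on_scale psd_on_gram[where f = "\<lambda>m a. act (Suc l) (fst a) m (snd a) z"]) simp
    next
      fix a b assume "a \<in> pos (Suc (Suc l))" "b \<in> pos (Suc (Suc l))"
      from cov_fun_regular[OF l this] show "integrable (Zlaw (Suc l)) (cov_fun (Suc l) a b)"
        by (intro centered_gaussian_integrable_sub_gaussian[OF _ _ _ cg]) auto
    qed
  qed
  from centered_gaussian_exists[OF _ *]
  have "centered_gaussian (pos (Suc (Suc l))) (K (Suc (Suc l))) (Zlaw (Suc (Suc l)))"
    unfolding Zlaw_def by (metis finite_SigmaI finite_atLeastAtMost someI_ex)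
  with * show ?case ..
qed

end

text \<open>Fubini in the role of conditioning: a bound on the probability of every section over
  \<open>I\<close> bounds the total probability, without any conditional expectation.\<close>

lemma PiM_measure_le_section:
  assumes M: "\<And>i. prob_space (M i)" and IJ: "I \<inter> J = {}" "finite I" "finite J"
    and S: "S \<in> sets (PiM (I \<union> J) M)"
    and le: "\<And>x. x \<in> space (PiM I M) \<Longrightarrow>
      measure (PiM J M) {y \<in> space (PiM J M). merge I J (x, y) \<in> S} \<le> c"
  shows "measure (PiM (I \<union> J) M) S \<le> c"
proof -
  interpret product_prob_space M UNIV by (rule product_prob_spaceI[OF M])
  interpret I: prob_space "PiM I M" by (rule prob_space_PiM[OF M])
  interpret J: prob_space "PiM J M" by (rule prob_space_PiM[OF M])
  interpret IJ: prob_space "PiM (I \<union> J) M" by (rule prob_space_PiM[OF M])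
  obtain x0 where "x0 \<in> space (PiM I M)" using I.not_empty by blast
  then have c: "0 \<le> c" using le[of x0] measure_nonneg order.trans by blast
  have sec: "(\<integral>\<^sup>+y. indicator S (merge I J (x, y)) \<partial>PiM J M) \<le> ennreal c"
    if x: "x \<in> space (PiM I M)" for x
  proof -
    have "(\<lambda>y. merge I J (x, y)) \<in> measurable (PiM J M) (PiM (I \<union> J) M)"
      by (rule measurable_compose[OF measurable_Pair1'[OF x] measurable_merge])
    from measurable_sets[OF this S]
    have T: "{y \<in> space (PiM J M). merge I J (x, y) \<in> S} \<in> sets (PiM J M)"
      by (simp add: vimage_def Int_def conj_commute)
    have "(\<integral>\<^sup>+y. indicator S (merge I J (x, y)) \<partial>PiM J M)
        = (\<integral>\<^sup>+y. indicator {y \<in> space (PiM J M). merge I J (x, y) \<in> S} y \<partial>PiM J M)"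
      by (intro nn_integral_cong) (simp add: indicator_def)
    also have "\<dots> = ennreal (measure (PiM J M) {y \<in> space (PiM J M). merge I J (x, y) \<in> S})"
      using T by (simp add: J.emeasure_eq_measure)
    also have "\<dots> \<le> ennreal c" by (rule ennreal_leI[OF le[OF x]])
    finally show ?thesis .
  qed
  have "ennreal (measure (PiM (I \<union> J) M) S) = (\<integral>\<^sup>+z. indicator S z \<partial>PiM (I \<union> J) M)"
    using S by (simp add: IJ.emeasure_eq_measure)
  also have "\<dots> = (\<integral>\<^sup>+x. \<integral>\<^sup>+y. indicator S (merge I J (x, y)) \<partial>PiM J M \<partial>PiM I M)"
    using S by (intro product_nn_integral_fold IJ) simp
  also have "\<dots> \<le> (\<integral>\<^sup>+x. ennreal c \<partial>PiM I M)"
    by (intro nn_integral_mono sec)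
  also have "\<dots> = ennreal c" by (simp add: I.emeasure_space_1)
  finally show ?thesis using c by simp
qed

section \<open>Features, random covariances and their dependence on the weights\<close>

context conv_net
begin

text \<open>What the weights of layer \<open>l\<close> multiply. The input layer and the hidden
  layers get one name, so that a single formula covers both clauses of
  \<open>preact\<close>.\<close>

definition feat :: "(nat \<Rightarrow> nat) \<Rightarrow> (nat \<times> 'm \<times> nat \<times> nat \<Rightarrow> real) \<Rightarrow> nat \<Rightarrow> nat \<Rightarrow> 'm \<Rightarrow> nat \<Rightarrow> nat \<Rightarrow> real" where
  "feat Cs W l i m c p = (if l = 0 then R 0 i m (restrict (x p c) {1..N 0})
     else \<sigma> (R l i m (restrict (\<lambda>j. preact Cs N Ms \<sigma> R x W l c j p) {1..N l})))"

lemma preact_Suc_feat: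
  "preact Cs N Ms \<sigma> R x W (Suc l) c i p = 1 / sqrt (real (card (Ms l)) * real (Cs l)) *
     (\<Sum>c'\<in>{1..Cs l}. \<Sum>m\<in>Ms l. W (l, m, c', c) * feat Cs W l i m c' p)"
  by (cases l) (simp_all add: feat_def)

definition weights :: "(nat \<Rightarrow> nat) \<Rightarrow> nat \<Rightarrow> (nat \<times> 'm \<times> nat \<times> nat) set" where
  "weights Cs l = {(l', m, c', c). l' = l \<and> m \<in> Ms l \<and> c' \<in> {1..Cs l} \<and> c \<in> {1..Cs (Suc l)}}"

definition all_weights :: "(nat \<Rightarrow> nat) \<Rightarrow> (nat \<times> 'm \<times> nat \<times> nat) set" where
  "all_weights Cs = {(l, m, c', c). l \<le> L \<and> m \<in> Ms l \<and> c' \<in> {1..Cs l} \<and> c \<in> {1..Cs (Suc l)}}"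

text \<open>The value 1 above layer \<open>L\<close> is a filler: every index of the type then
  carries a probability measure, as the product locale over \<open>UNIV\<close> demands.\<close>

definition wsd :: "nat \<times> 'm \<times> nat \<times> nat \<Rightarrow> real" where
  "wsd j = (if fst j \<le> L then 1 / sqrt (lam (fst j)) else 1)"

abbreviation wlaw :: "(nat \<times> 'm \<times> nat \<times> nat) set \<Rightarrow> (nat \<times> 'm \<times> nat \<times> nat \<Rightarrow> real) measure" where
  "wlaw J \<equiv> PiM J (\<lambda>j. centered_normal (wsd j))"

text \<open>The covariance of each channel of layer \<open>l + 1\<close> conditionally on the weights of the layers
  below.\<close>
definition emp_cov :: "(nat \<Rightarrow> nat) \<Rightarrow> (nat \<times> 'm \<times> nat \<times> nat \<Rightarrow> real) \<Rightarrow> nat \<Rightarrow> nat \<times> nat \<Rightarrow> nat \<times> nat \<Rightarrow> real" where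
  "emp_cov Cs W l a b = 1 / (lam l * real (Cs l) * real (card (Ms l))) *
     (\<Sum>c\<in>{1..Cs l}. \<Sum>m\<in>Ms l. feat Cs W l (fst a) m c (snd a) * feat Cs W l (fst b) m c (snd b))"

text \<open>Index shift: \<open>close Cs W l\<close> speaks about the covariance of layer
  \<open>l + 1\<close>, and is decided by the weights of the layers strictly below
  \<open>l\<close>.\<close>

definition close :: "(nat \<Rightarrow> nat) \<Rightarrow> (nat \<times> 'm \<times> nat \<times> nat \<Rightarrow> real) \<Rightarrow> nat \<Rightarrow> real \<Rightarrow> bool" where
  "close Cs W l d \<longleftrightarrow> (\<forall>a\<in>pos (Suc l). \<forall>b\<in>pos (Suc l). \<bar>emp_cov Cs W l a b - K (Suc l) a b\<bar> \<le> d)"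

definition valid :: "(nat \<Rightarrow> nat) \<Rightarrow> bool" where
  "valid Cs \<longleftrightarrow> Cs 0 = C0 \<and> (\<forall>l\<in>{1..L}. Cs l \<ge> 1)"

lemma valid_pos: "valid Cs \<Longrightarrow> l \<le> L \<Longrightarrow> Cs l \<ge> 1"
  using C0 by (cases l) (auto simp: valid_def)

lemma wsd_pos: "wsd j > 0" using lam by (simp add: wsd_def)

lemma prob_space_wlaw: "prob_space (wlaw J)"
  by (intro prob_space_PiM prob_space_centered_normal wsd_pos)

lemma all_weights_eq: "all_weights Cs = (\<Union>l\<le>L. weights Cs l)"
  by (auto simp: all_weights_def weights_def)

lemma finite_weights: "l \<le> L \<Longrightarrow> finite (weights Cs l)"
  by (rule finite_subset[of _ "{l} \<times> Ms l \<times> {1..Cs l} \<times> {1..Cs (Suc l)}"])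
     (use Ms in \<open>auto simp: weights_def\<close>)

lemma finite_all_weights: "finite (all_weights Cs)"
  unfolding all_weights_eq by (intro finite_UN_I finite_weights) auto

lemma weights_subset: "l \<le> L \<Longrightarrow> weights Cs l \<subseteq> all_weights Cs"
  by (auto simp: all_weights_eq)

lemma feat_cong_preact:
  assumes "\<And>j. l > 0 \<Longrightarrow> j \<in> {1..N l} \<Longrightarrow> preact Cs N Ms \<sigma> R x W l c j p = preact Cs N Ms \<sigma> R x W' l c j p"
  shows "feat Cs W l i m c p = feat Cs W' l i m c p"
proof (cases "l = 0")
  case False
  then have "restrict (\<lambda>j. preact Cs N Ms \<sigma> R x W l c j p) {1..N l}
      = restrict (\<lambda>j. preact Cs N Ms \<sigma> R x W' l c j p) {1..N l}"
    using assms by (intro restrict_ext) auto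
  then show ?thesis by (simp add: feat_def)
qed (simp add: feat_def)

text \<open>Locality: the recursion reaches only weights of earlier layers, so drawing new weights
  in layer \<open>l\<close> leaves the preactivations of layer \<open>l\<close> unchanged. The
  channel must be in range, since \<open>weights\<close> lists only existing channels.\<close>

lemma preact_cong:
  assumes "\<And>k j. k < l \<Longrightarrow> j \<in> weights Cs k \<Longrightarrow> W j = W' j" "c \<in> {1..Cs l}"
  shows "preact Cs N Ms \<sigma> R x W l c i p = preact Cs N Ms \<sigma> R x W' l c i p"
  using assms
proof (induction l arbitrary: c i)
  case (Suc l)
  have "feat Cs W l i m c' p = feat Cs W' l i m c' p" if c': "c' \<in> {1..Cs l}" for i m c'
  proof (rule feat_cong_preact, rule Suc.IH[OF _ c'])
    fix k j assume "k < l" "j \<in> weights Cs k"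
    then show "W j = W' j" using Suc.prems(1) less_SucI by blast
  qed
  moreover have "W (l, m, c', c) = W' (l, m, c', c)" if "c' \<in> {1..Cs l}" "m \<in> Ms l" for c' m
    using Suc.prems that by (intro Suc.prems(1)[of l]) (auto simp: weights_def)
  ultimately show ?case
    unfolding preact_Suc_feat by simp
qed simp

lemma feat_cong:
  assumes "\<And>k j. k < l \<Longrightarrow> j \<in> weights Cs k \<Longrightarrow> W j = W' j" "c \<in> {1..Cs l}"
  shows "feat Cs W l i m c p = feat Cs W' l i m c p"
  by (intro feat_cong_preact preact_cong assms) auto

lemma preact_measurable:
  assumes "l \<le> Suc L" "c \<in> {1..Cs l}" "i \<in> {1..N l}"
  shows "(\<lambda>W. preact Cs N Ms \<sigma> R x W l c i p) \<in> borel_measurable (PiM (all_weights Cs) (\<lambda>_. borel))"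
  using assms
proof (induction l arbitrary: c i)
  case (Suc l)
  have feat: "(\<lambda>W. feat Cs W l i m c' p) \<in> borel_measurable (PiM (all_weights Cs) (\<lambda>_. borel))"
    if "c' \<in> {1..Cs l}" "m \<in> Ms l" for m c'
  proof (cases "l = 0")
    case False
    have "(\<lambda>W. restrict (\<lambda>j. preact Cs N Ms \<sigma> R x W l c' j p) {1..N l})
        \<in> measurable (PiM (all_weights Cs) (\<lambda>_. borel)) (PiM {1..N l} (\<lambda>_. borel))"
      using Suc that by (intro measurable_restrict Suc.IH) auto
    from measurable_compose[OF measurable_compose[OF this R_meas] \<sigma>_meas] show ?thesis
      unfolding feat_def using Suc.prems that False by simp
  qed (simp add: feat_def)
  have "(l, m, c', c) \<in> all_weights Cs" if "c' \<in> {1..Cs l}" "m \<in> Ms l" for m c'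
    using Suc.prems that by (auto simp: all_weights_def)
  then show ?case
    unfolding preact_Suc_feat using feat
    by (intro borel_measurable_times borel_measurable_const borel_measurable_sum
        measurable_component_singleton) auto
qed simp

lemma feat_measurable:
  assumes "l \<le> L" "c \<in> {1..Cs l}" "i \<in> {1..N (Suc l)}" "m \<in> Ms l"
  shows "(\<lambda>W. feat Cs W l i m c p) \<in> borel_measurable (PiM (all_weights Cs) (\<lambda>_. borel))"
proof (cases "l = 0")
  case False
  have "(\<lambda>W. restrict (\<lambda>j. preact Cs N Ms \<sigma> R x W l c j p) {1..N l})
      \<in> measurable (PiM (all_weights Cs) (\<lambda>_. borel)) (PiM {1..N l} (\<lambda>_. borel))"
    using assms by (intro measurable_restrict preact_measurable) auto
  from measurable_compose[OF measurable_compose[OF this R_meas] \<sigma>_meas] show ?thesis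
    unfolding feat_def using assms False by simp
qed (simp add: feat_def)

lemma emp_cov_measurable:
  assumes "l \<le> L" "a \<in> pos (Suc l)" "b \<in> pos (Suc l)"
  shows "(\<lambda>W. emp_cov Cs W l a b) \<in> borel_measurable (PiM (all_weights Cs) (\<lambda>_. borel))"
  unfolding emp_cov_def using assms
  by (intro borel_measurable_times borel_measurable_const borel_measurable_sum feat_measurable) auto

lemma close_measurable:
  assumes "l \<le> L"
  shows "{W \<in> space (PiM (all_weights Cs) (\<lambda>_. borel)). close Cs W l d} \<in> sets (PiM (all_weights Cs) (\<lambda>_. borel))"
  unfolding close_def
proof (intro sets.sets_Collect_finite_All finite_SigmaI finite_atLeastAtMost)
  fix a b assume ab: "a \<in> pos (Suc l)" "b \<in> pos (Suc l)"
  note [measurable] = emp_cov_measurable[OF assms ab, of Cs]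
  show "{W \<in> space (PiM (all_weights Cs) (\<lambda>_. borel)). \<bar>emp_cov Cs W l a b - K (Suc l) a b\<bar> \<le> d}
      \<in> sets (PiM (all_weights Cs) (\<lambda>_. borel))"
    by measurable
qed

lemma emp_cov_cong:
  assumes "\<And>k j. k < l \<Longrightarrow> j \<in> weights Cs k \<Longrightarrow> W j = W' j"
  shows "emp_cov Cs W l a b = emp_cov Cs W' l a b"
  unfolding emp_cov_def
  by (intro arg_cong2[where f = "(*)"] refl sum.cong feat_cong assms) auto

lemma close_cong:
  assumes "\<And>k j. k < l \<Longrightarrow> j \<in> weights Cs k \<Longrightarrow> W j = W' j"
  shows "close Cs W l d = close Cs W' l d"
  unfolding close_def using emp_cov_cong[of l Cs W W'] assms by simp

text \<open>The features of the input layer are deterministic, so the induction over layers starts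
  without error.\<close>

lemma emp_cov_0:
  assumes "valid Cs"
  shows "emp_cov Cs W 0 a b = K (Suc 0) a b"
  using assms by (cases a, cases b) (simp add: emp_cov_def feat_def valid_def)

declare kernel.simps [simp del] preact.simps [simp del]

text \<open>Separates the factor \<open>1 / Cs l\<close> from the normalisation, which exhibits the
  random covariance as an empirical mean to which the weak law applies.\<close>

lemma emp_cov_average:
  assumes "l \<in> {1..L}" "a \<in> pos (Suc l)" "b \<in> pos (Suc l)"
  shows "emp_cov Cs W l a b = (\<Sum>c\<in>{1..Cs l}. cov_fun l a b
      (\<lambda>(i, p)\<in>pos l. preact Cs N Ms \<sigma> R x W l c i p)) / card {1..Cs l}"
proof -
  have "act l i m p (\<lambda>(i, p)\<in>pos l. preact Cs N Ms \<sigma> R x W l c i p) = feat Cs W l i m c p"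
    if "p \<in> {1..P}" for i m p c
  proof -
    have "restrict (\<lambda>a. (\<lambda>(i, p)\<in>pos l. preact Cs N Ms \<sigma> R x W l c i p) (a, p)) {1..N l}
        = restrict (\<lambda>j. preact Cs N Ms \<sigma> R x W l c j p) {1..N l}"
      using that by (intro restrict_ext) auto
    then show ?thesis using assms(1) by (simp add: act_def feat_def)
  qed
  moreover have "snd a \<in> {1..P}" "snd b \<in> {1..P}" using assms by auto
  ultimately show ?thesis
    by (simp add: emp_cov_def cov_fun_def sum_distrib_left sum_divide_distrib mult_ac)
qed

subsection \<open>Conditioning on the earlier layers\<close>

text \<open>The coefficient of one weight in the linear map of layer \<open>l\<close>, with the
  square-root normalisation included; it is the \<open>v\<close> of the channel lemmas.\<close>

definition scaled_feat :: "(nat \<Rightarrow> nat) \<Rightarrow> (nat \<times> 'm \<times> nat \<times> nat \<Rightarrow> real) \<Rightarrow> nat \<Rightarrow> nat \<times> nat \<Rightarrow> nat \<times> 'm \<Rightarrow> real" where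
  "scaled_feat Cs W l a k = feat Cs W l (fst a) (snd k) (fst k) (snd a) / sqrt (real (card (Ms l)) * real (Cs l))"

lemma emp_cov_scaled_feat:
  assumes "l \<le> L"
  shows "emp_cov Cs W l a b = (1 / sqrt (lam l))\<^sup>2 *
    (\<Sum>k\<in>{1..Cs l} \<times> Ms l. scaled_feat Cs W l a k * scaled_feat Cs W l b k)"
proof -
  have "scaled_feat Cs W l a k * scaled_feat Cs W l b k =
      feat Cs W l (fst a) (snd k) (fst k) (snd a) * feat Cs W l (fst b) (snd k) (fst k) (snd b)
      / (real (card (Ms l)) * real (Cs l))" for k
    by (simp add: scaled_feat_def)
  then show ?thesis
    using lam[OF assms]
    by (simp add: emp_cov_def sum.cartesian_product split_def sum_divide_distrib[symmetric]
        power_divide mult_ac)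
qed

text \<open>With all other weights frozen at \<open>w\<close>, the preactivations above layer
  \<open>l\<close> are linear in the fresh weights \<open>y\<close>, and their coefficients depend
  on \<open>w\<close> alone.\<close>

lemma preact_merge:
  assumes l: "l \<le> L" and c: "c \<in> {1..Cs (Suc l)}"
  shows "preact Cs N Ms \<sigma> R x (merge (all_weights Cs - weights Cs l) (weights Cs l) (w, y)) (Suc l) c i p
    = (\<Sum>k\<in>{1..Cs l} \<times> Ms l. scaled_feat Cs w l (i, p) k * y (l, snd k, fst k, c))"
proof -
  let ?W = "merge (all_weights Cs - weights Cs l) (weights Cs l) (w, y)"
  have early: "?W j = w j" if "k < l" "j \<in> weights Cs k" for k j
  proof -
    have "j \<in> all_weights Cs - weights Cs l"
      using that weights_subset[of k Cs] l by (auto simp: weights_def)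
    then show ?thesis by simp
  qed
  have "?W (l, m, c', c) = y (l, m, c', c)" if "c' \<in> {1..Cs l}" "m \<in> Ms l" for c' m
  proof -
    have "(l, m, c', c) \<in> weights Cs l" using that c by (simp add: weights_def)
    then show ?thesis by simp
  qed
  then have "preact Cs N Ms \<sigma> R x ?W (Suc l) c i p = 1 / sqrt (real (card (Ms l)) * real (Cs l)) *
     (\<Sum>c'\<in>{1..Cs l}. \<Sum>m\<in>Ms l. y (l, m, c', c) * feat Cs w l i m c' p)"
    unfolding preact_Suc_feat
    using feat_cong[OF early] by (intro arg_cong2[where f = "(*)"] refl sum.cong) auto
  then show ?thesis
    by (simp add: scaled_feat_def sum.cartesian_product split_def sum_divide_distrib mult_ac)
qed

lemma close_merge:
  assumes l: "l \<le> L"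
  shows "close Cs (merge (all_weights Cs - weights Cs l) (weights Cs l) (w, y)) l d = close Cs w l d"
proof (rule close_cong)
  fix k j assume "k < l" "j \<in> weights Cs k"
  then have "j \<in> all_weights Cs - weights Cs l"
    using weights_subset[of k Cs] l by (auto simp: weights_def)
  then show "merge (all_weights Cs - weights Cs l) (weights Cs l) (w, y) j = w j" by simp
qed

lemma sets_wlaw: "sets (wlaw J) = sets (PiM J (\<lambda>_. borel))"
  by (rule sets_PiM_centered_normal)

lemma space_wlaw: "space (wlaw J) = space (PiM J (\<lambda>_. borel))"
  by (simp add: space_PiM)

lemma all_weights_split:
  assumes "l \<le> L"
  shows "(all_weights Cs - weights Cs l) \<union> weights Cs l = all_weights Cs"
    "(all_weights Cs - weights Cs l) \<inter> weights Cs l = {}"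
  using weights_subset[OF assms, of Cs] by auto

text \<open>When the covariance below is within \<open>d\<close> of the kernel, continuity puts the
  conditional mean within \<open>\<epsilon> / 2\<close> of the next kernel, so a deviation above
  \<epsilon> forces the channel average at least \<open>\<epsilon> / 2\<close> away from its own
  mean. Chebyshev bounds this. Both \<open>d\<close> and \<open>q\<close> are fixed before the
  widths, which permits a simultaneous limit.\<close>

lemma concentration_step:
  assumes l: "Suc l \<le> L" and a: "a \<in> pos (Suc (Suc l))" and b: "b \<in> pos (Suc (Suc l))" and \<epsilon>: "\<epsilon> > 0"
  obtains d q where "d > 0"
    "\<And>Cs. valid Cs \<Longrightarrow> measure (wlaw (all_weights Cs))
        {W \<in> space (wlaw (all_weights Cs)). close Cs W l d \<and>
           \<bar>emp_cov Cs W (Suc l) a b - K (Suc (Suc l)) a b\<bar> > \<epsilon>} \<le> q / Cs (Suc l)"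
proof -
  let ?A = "pos (Suc l)" and ?F = "cov_fun (Suc l) a b"
  have lL: "l \<le> L" "Suc l \<in> {1..L}" using l by auto
  have fA: "finite ?A" by simp
  note F = cov_fun_regular[OF lL(2) a b]
  have cgZ: "centered_gaussian ?A (K (Suc l)) (Zlaw (Suc l))" using kernel_psd_Zlaw[OF lL(1)] by simp
  have KF: "K (Suc (Suc l)) a b = (\<integral>z. ?F z \<partial>Zlaw (Suc l))" by (rule kernel_Suc[OF lL(2) a b cgZ])
  obtain d where d: "d > 0" and cont:
    "\<And>S \<mu>. centered_gaussian ?A S \<mu> \<Longrightarrow> (\<And>k l'. k \<in> ?A \<Longrightarrow> l' \<in> ?A \<Longrightarrow> \<bar>S k l' - K (Suc l) k l'\<bar> \<le> d) \<Longrightarrow>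
       \<bar>(\<integral>z. ?F z \<partial>\<mu>) - (\<integral>z. ?F z \<partial>Zlaw (Suc l))\<bar> \<le> \<epsilon> / 2"
    using centered_gaussian_integral_continuous[OF fA F cgZ half_gt_zero[OF \<epsilon>]] by blast
  \<comment> \<open>Dominates the diagonal of every matrix within \<open>d\<close> of the kernel, so
    one second moment bound \<open>q0\<close> serves all frozen weights in the good event.\<close>
  define M where "M = (\<Sum>k\<in>?A. \<bar>K (Suc l) k k\<bar>) + d"
  have F2m: "(\<lambda>z. ?F z * ?F z) \<in> borel_measurable (PiM ?A (\<lambda>_. borel))" using F(1) by measurable
  obtain q0 where q0: "q0 \<ge> 0"
    "\<And>S \<mu>. centered_gaussian ?A S \<mu> \<Longrightarrow> (\<And>k. k \<in> ?A \<Longrightarrow> S k k \<le> M) \<Longrightarrow>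
       integrable \<mu> (\<lambda>z. ?F z * ?F z) \<and> (\<integral>z. \<bar>?F z * ?F z\<bar> \<partial>\<mu>) \<le> q0"
    using sub_gaussian_growth_moment[OF fA sub_gaussian_growth_mult[OF F(3,3)] F2m] by blast
  define q where "q = q0 / (\<epsilon> / 2)\<^sup>2"
  have "measure (wlaw (all_weights Cs))
        {W \<in> space (wlaw (all_weights Cs)). close Cs W l d \<and>
           \<bar>emp_cov Cs W (Suc l) a b - K (Suc (Suc l)) a b\<bar> > \<epsilon>} \<le> q / Cs (Suc l)" (is "measure _ ?S \<le> _")
    if valid: "valid Cs" for Cs
  proof -
    let ?J = "weights Cs l" and ?I = "all_weights Cs - weights Cs l"
    let ?Ch = "{1..Cs (Suc l)}" and ?Ks = "{1..Cs l} \<times> Ms l"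
    let ?w = "\<lambda>k c. (l, snd k, fst k, c)"
    have C: "Cs (Suc l) \<ge> 1" using valid_pos[OF valid l] .
    have fin: "finite ?J" "finite ?I" "finite ?Ks"
      using finite_weights[OF lL(1)] finite_all_weights Ms[OF lL(1)] by auto
    have "?S \<in> sets (wlaw (all_weights Cs))"
    proof -
      note [measurable] = emp_cov_measurable[OF l a b, of Cs]
      have "{W \<in> space (PiM (all_weights Cs) (\<lambda>_. borel)). \<bar>emp_cov Cs W (Suc l) a b - K (Suc (Suc l)) a b\<bar> > \<epsilon>}
          \<in> sets (PiM (all_weights Cs) (\<lambda>_. borel))" by measurable
      from sets.sets_Collect_conj[OF this close_measurable[OF lL(1)]]
      show ?thesis unfolding sets_wlaw space_wlaw .
    qed
    moreover have "measure (wlaw ?J) {y \<in> space (wlaw ?J). merge ?I ?J (w, y) \<in> ?S} \<le> q / Cs (Suc l)"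
      if w: "w \<in> space (wlaw ?I)" for w
    proof (cases "close Cs w l d")
      case False
      then have empty: "{y \<in> space (wlaw ?J). merge ?I ?J (w, y) \<in> ?S} = {}"
        using close_merge[OF lL(1), of Cs w _ d] by auto
      show ?thesis unfolding empty using q0(1) by (simp add: q_def)
    next
      case True
      let ?v = "scaled_feat Cs w l"
      have psd: "psd_on ?A (emp_cov Cs w l)"
        by (rule psd_on_cong[OF emp_cov_scaled_feat[OF lL(1)]])
           (intro psd_on_scale psd_on_gram, simp)
      obtain \<mu> where cg: "centered_gaussian ?A (emp_cov Cs w l) \<mu>"
        using centered_gaussian_exists[OF fA psd] by blast
      have near: "\<bar>emp_cov Cs w l k l' - K (Suc l) k l'\<bar> \<le> d" if "k \<in> ?A" "l' \<in> ?A" for k l'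
        using True that unfolding close_def by blast
      have mean: "\<bar>(\<integral>z. ?F z \<partial>\<mu>) - K (Suc (Suc l)) a b\<bar> \<le> \<epsilon> / 2"
        unfolding KF by (rule cont[OF cg near])
      have "emp_cov Cs w l k k \<le> M" if "k \<in> ?A" for k
      proof -
        have "\<bar>K (Suc l) k k\<bar> \<le> (\<Sum>k\<in>?A. \<bar>K (Suc l) k k\<bar>)"
          using that by (intro member_le_sum) auto
        then show ?thesis using near[OF that that] unfolding M_def by linarith
      qed
      then have second: "(\<integral>z. ?F z * ?F z \<partial>\<mu>) \<le> q0" using q0(2)[OF cg] by simp
      let ?h = "\<lambda>y c. \<lambda>k\<in>?A. \<Sum>k'\<in>?Ks. ?v k k' * y (?w k' c)"
      let ?T = "{y \<in> space (PiM ?J (\<lambda>_. borel)).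
        \<bar>(\<Sum>c\<in>?Ch. ?F (?h y c)) / card ?Ch - (\<integral>z. ?F z \<partial>\<mu>)\<bar> \<ge> \<epsilon> / 2}"
      have "measure (wlaw ?J) ?T \<le> (\<integral>z. ?F z * ?F z \<partial>\<mu>) / (card ?Ch * (\<epsilon> / 2)\<^sup>2)"
        by (rule channel_average_concentration[OF fin(1,3) fA _ _ _ _ _ _ F cg,
            where \<tau> = "1 / sqrt (lam l)" and w = ?w and s = wsd and v = ?v and Ch = ?Ch and \<epsilon> = "\<epsilon> / 2"])
           (use C \<epsilon> lL wsd_pos emp_cov_scaled_feat[OF lL(1)] in \<open>auto simp: weights_def wsd_def\<close>)
      also have "\<dots> \<le> q0 / (card ?Ch * (\<epsilon> / 2)\<^sup>2)" by (intro divide_right_mono second) simp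
      also have "\<dots> = q / Cs (Suc l)" by (simp add: q_def)
      finally have T: "measure (wlaw ?J) ?T \<le> q / Cs (Suc l)" .
      have hm: "(\<lambda>y. ?h y c) \<in> measurable (PiM ?J (\<lambda>_. borel)) (PiM ?A (\<lambda>_. borel))" if "c \<in> ?Ch" for c
        using that
        by (intro measurable_restrict borel_measurable_sum borel_measurable_times borel_measurable_const
            measurable_component_singleton) (auto simp: weights_def)
      have Tm: "?T \<in> sets (wlaw ?J)"
      proof -
        have [measurable]: "(\<lambda>y. (\<Sum>c\<in>?Ch. ?F (?h y c))) \<in> borel_measurable (PiM ?J (\<lambda>_. borel))"
          by (intro borel_measurable_sum measurable_compose[OF hm F(1)])
        show ?thesis unfolding sets_wlaw by measurable
      qed
      have "{y \<in> space (wlaw ?J). merge ?I ?J (w, y) \<in> ?S} \<subseteq> ?T"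
      proof
        fix y assume "y \<in> {y \<in> space (wlaw ?J). merge ?I ?J (w, y) \<in> ?S}"
        then have y: "y \<in> space (PiM ?J (\<lambda>_. borel))"
          and far: "\<bar>emp_cov Cs (merge ?I ?J (w, y)) (Suc l) a b - K (Suc (Suc l)) a b\<bar> > \<epsilon>"
          by (auto simp: space_wlaw)
        have "(\<lambda>(i, p)\<in>pos (Suc l). preact Cs N Ms \<sigma> R x (merge ?I ?J (w, y)) (Suc l) c i p) = ?h y c"
          if "c \<in> ?Ch" for c
          by (intro restrict_ext) (auto simp: preact_merge[OF lL(1), where Cs = Cs, OF that])
        then have avg: "emp_cov Cs (merge ?I ?J (w, y)) (Suc l) a b = (\<Sum>c\<in>?Ch. ?F (?h y c)) / card ?Ch"
          unfolding emp_cov_average[OF lL(2) a b] by (intro arg_cong2[where f = "(/)"] sum.cong refl) simp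
        have "\<epsilon> / 2 \<le> \<bar>emp_cov Cs (merge ?I ?J (w, y)) (Suc l) a b - (\<integral>z. ?F z \<partial>\<mu>)\<bar>"
          using far mean by linarith
        then show "y \<in> ?T" unfolding avg by (intro CollectI conjI y)
      qed
      then show ?thesis
        using T finite_measure.finite_measure_mono[OF prob_space.axioms(1)[OF prob_space_wlaw] _ Tm]
        by (meson order.trans)
    qed
    ultimately show ?thesis
      using PiM_measure_le_section[of "\<lambda>j. centered_normal (wsd j)" ?I ?J ?S "q / Cs (Suc l)"]
        all_weights_split[OF lL(1), of Cs] fin prob_space_centered_normal[OF wsd_pos]
      by simp
  qed
  with d show ?thesis by (rule that)
qed

text \<open>A bad entry at one layer means that the layer below was bad, or that concentration
  failed; the latter has probability at most a constant over the width. Finitely many entries are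
  joined by a union bound.\<close>

lemma emp_cov_tendsto_in_prob:
  assumes valid: "\<forall>\<^sub>F n in sequentially. valid (Cs n)"
    and lim: "\<And>l. l \<in> {1..L} \<Longrightarrow> filterlim (\<lambda>n. real (Cs n l)) at_top sequentially"
    and "l \<le> L" "d > 0"
  shows "(\<lambda>n. measure (wlaw (all_weights (Cs n)))
    {W \<in> space (wlaw (all_weights (Cs n))). \<not> close (Cs n) W l d}) \<longlonglongrightarrow> 0"
  using assms(3,4)
proof (induction l arbitrary: d)
  case 0
  have "\<forall>\<^sub>F n in sequentially. measure (wlaw (all_weights (Cs n)))
    {W \<in> space (wlaw (all_weights (Cs n))). \<not> close (Cs n) W 0 d} = 0"
    using valid by eventually_elim (use 0 in \<open>simp add: close_def emp_cov_0\<close>)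
  then show ?case by (rule tendsto_eventually)
next
  case (Suc l)
  let ?Q = "\<lambda>n. wlaw (all_weights (Cs n))"
  let ?A = "pos (Suc (Suc l))"
  let ?D = "\<lambda>n a b. {W \<in> space (?Q n). \<bar>emp_cov (Cs n) W (Suc l) a b - K (Suc (Suc l)) a b\<bar> > d}"
  have Dm: "?D n a b \<in> sets (?Q n)" if "a \<in> ?A" "b \<in> ?A" for n a b
  proof -
    note [measurable] = emp_cov_measurable[OF Suc.prems(1) that, of "Cs n"]
    show ?thesis unfolding sets_wlaw space_wlaw by measurable
  qed
  have fm: "finite_measure (?Q n)" for n using prob_space_wlaw by (rule prob_space.axioms(1))
  have entry: "(\<lambda>n. measure (?Q n) (?D n a b)) \<longlonglongrightarrow> 0" if ab: "a \<in> ?A" "b \<in> ?A" for a b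
  proof -
    \<comment> \<open>The tolerance \<open>d'\<close> for the layer below depends on the entry and
      on \<open>d\<close>, which is why the induction is generalised over \<open>d\<close>.\<close>
    obtain d' q where d': "d' > 0" and step:
      "\<And>Cs. valid Cs \<Longrightarrow> measure (wlaw (all_weights Cs))
        {W \<in> space (wlaw (all_weights Cs)). close Cs W l d' \<and>
           \<bar>emp_cov Cs W (Suc l) a b - K (Suc (Suc l)) a b\<bar> > d} \<le> q / Cs (Suc l)"
      using concentration_step[OF Suc.prems(1) ab Suc.prems(2)] by blast
    let ?E = "\<lambda>n. {W \<in> space (?Q n). \<not> close (Cs n) W l d'}"
    have lL: "l \<le> L" "Suc l \<in> {1..L}" using Suc.prems by auto
    have upper: "(\<lambda>n. measure (?Q n) (?E n) + q / Cs n (Suc l)) \<longlonglongrightarrow> 0"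
      by (intro tendsto_add_zero Suc.IH[OF lL(1) d'] tendsto_divide_0[OF tendsto_const]
          filterlim_at_top_imp_at_infinity lim lL)
    have "\<forall>\<^sub>F n in sequentially. measure (?Q n) (?D n a b) \<le> measure (?Q n) (?E n) + q / Cs n (Suc l)"
      using valid
    proof eventually_elim
      case (elim n)
      interpret finite_measure "?Q n" by (rule fm)
      have cm: "{W \<in> space (?Q n). close (Cs n) W l d'} \<in> sets (?Q n)"
        using close_measurable[OF lL(1)] unfolding sets_wlaw space_wlaw .
      have Em: "?E n \<in> sets (?Q n)" using sets.sets_Collect_neg[OF cm] .
      have Gm: "{W \<in> space (?Q n). close (Cs n) W l d' \<and>
           \<bar>emp_cov (Cs n) W (Suc l) a b - K (Suc (Suc l)) a b\<bar> > d} \<in> sets (?Q n)"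
        using sets.sets_Collect_conj[OF Dm[OF ab] cm] .
      have "measure (?Q n) (?D n a b) \<le> measure (?Q n) (?E n \<union> {W \<in> space (?Q n). close (Cs n) W l d' \<and>
           \<bar>emp_cov (Cs n) W (Suc l) a b - K (Suc (Suc l)) a b\<bar> > d})"
        by (intro finite_measure_mono sets.Un Em Gm) auto
      also have "\<dots> \<le> measure (?Q n) (?E n) + measure (?Q n) {W \<in> space (?Q n). close (Cs n) W l d' \<and>
           \<bar>emp_cov (Cs n) W (Suc l) a b - K (Suc (Suc l)) a b\<bar> > d}"
        by (intro measure_Un_le Em Gm)
      also have "\<dots> \<le> measure (?Q n) (?E n) + q / Cs n (Suc l)" by (intro add_left_mono step elim)
      finally show ?case .
    qed
    from tendsto_sandwich[OF _ this tendsto_const upper] show ?thesis by simp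
  qed
  have "(\<lambda>n. \<Sum>ab\<in>?A \<times> ?A. measure (?Q n) (?D n (fst ab) (snd ab))) \<longlonglongrightarrow> (\<Sum>ab\<in>?A \<times> ?A. 0)"
    by (intro tendsto_sum entry) auto
  then have lim0: "(\<lambda>n. \<Sum>ab\<in>?A \<times> ?A. measure (?Q n) (?D n (fst ab) (snd ab))) \<longlonglongrightarrow> 0" by simp
  have "measure (?Q n) {W \<in> space (?Q n). \<not> close (Cs n) W (Suc l) d}
      \<le> (\<Sum>ab\<in>?A \<times> ?A. measure (?Q n) (?D n (fst ab) (snd ab)))" for n
  proof -
    interpret finite_measure "?Q n" by (rule fm)
    have "{W \<in> space (?Q n). \<not> close (Cs n) W (Suc l) d} \<subseteq> (\<Union>ab\<in>?A \<times> ?A. ?D n (fst ab) (snd ab))"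
    proof
      fix W assume "W \<in> {W \<in> space (?Q n). \<not> close (Cs n) W (Suc l) d}"
      then have W: "W \<in> space (?Q n)" "\<not> close (Cs n) W (Suc l) d" unfolding mem_Collect_eq by blast+
      from W(2) obtain a b where "a \<in> ?A" "b \<in> ?A" "\<not> \<bar>emp_cov (Cs n) W (Suc l) a b - K (Suc (Suc l)) a b\<bar> \<le> d"
        unfolding close_def by blast
      with W(1) have "a \<in> ?A" "b \<in> ?A" "W \<in> ?D n a b" by (simp_all only: not_le mem_Collect_eq)
      then show "W \<in> (\<Union>ab\<in>?A \<times> ?A. ?D n (fst ab) (snd ab))"
        by (intro UN_I[of "(a, b)"] SigmaI) simp_all
    qed
    then have "measure (?Q n) {W \<in> space (?Q n). \<not> close (Cs n) W (Suc l) d}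
        \<le> measure (?Q n) (\<Union>ab\<in>?A \<times> ?A. ?D n (fst ab) (snd ab))"
      by (rule finite_measure_mono) (intro sets.finite_UN finite_SigmaI finite_atLeastAtMost Dm, auto)
    also have "\<dots> \<le> (\<Sum>ab\<in>?A \<times> ?A. measure (?Q n) (?D n (fst ab) (snd ab)))"
      by (rule finite_measure_subadditive_finite) (use Dm in auto)
    finally show ?thesis .
  qed
  then show ?case
    by (intro tendsto_sandwich[OF _ _ tendsto_const lim0]) auto
qed

end

section \<open>From convergence of the covariance to convergence in law\<close>

context conv_net
begin

abbreviation out_index :: "nat \<Rightarrow> nat \<Rightarrow> (nat \<times> nat \<times> nat) set" where
  "out_index l C \<equiv> {1..N l} \<times> {1..C} \<times> {1..P}"

abbreviation out :: "(nat \<Rightarrow> nat) \<Rightarrow> (nat \<times> 'm \<times> nat \<times> nat \<Rightarrow> real) \<Rightarrow> nat \<Rightarrow> nat \<Rightarrow> nat \<times> nat \<times> nat \<Rightarrow> real" where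
  "out Cs W l C \<equiv> restrict (\<lambda>(i, c, p). preact Cs N Ms \<sigma> R x W l c i p) (out_index l C)"

lemma out_measurable:
  assumes "l \<le> Suc L" "C \<le> Cs l"
  shows "(\<lambda>W. out Cs W l C) \<in> measurable (PiM (all_weights Cs) (\<lambda>_. borel)) (PiM (out_index l C) (\<lambda>_. borel))"
proof (rule measurable_restrict)
  fix k assume "k \<in> out_index l C"
  then obtain i c p where k: "k = (i, c, p)" "i \<in> {1..N l}" "c \<in> {1..C}" by auto
  then show "(\<lambda>W. case k of (i, c, p) \<Rightarrow> preact Cs N Ms \<sigma> R x W l c i p)
      \<in> borel_measurable (PiM (all_weights Cs) (\<lambda>_. borel))"
    using preact_measurable[of l c Cs i p] assms by auto
qed

text \<open>Exact at every finite width. The condition on \<open>C\<close> ensures that the weights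
  feeding the observed channels all belong to the layer that is integrated out.\<close>

lemma conditional_law_out:
  assumes l: "l \<le> L" and C: "C \<le> Cs (Suc l)"
  shows "centered_gaussian (out_index (Suc l) C) (kron_cov (emp_cov Cs w l))
    (distr (wlaw (weights Cs l)) (PiM (out_index (Suc l) C) (\<lambda>_. borel))
      (\<lambda>y. out Cs (merge (all_weights Cs - weights Cs l) (weights Cs l) (w, y)) (Suc l) C))"
proof -
  let ?I = "out_index (Suc l) C" and ?J = "weights Cs l" and ?Ks = "{1..Cs l} \<times> Ms l"
  define ch :: "nat \<times> nat \<times> nat \<Rightarrow> nat" where "ch = (\<lambda>(i, c, p). c)"
  define v :: "nat \<times> nat \<times> nat \<Rightarrow> nat \<times> 'm \<Rightarrow> real" where "v = (\<lambda>(i, c, p). scaled_feat Cs w l (i, p))"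
  have "centered_gaussian ?I (\<lambda>a b. if ch a = ch b then (1 / sqrt (lam l))\<^sup>2 * (\<Sum>k\<in>?Ks. v a k * v b k) else 0)
    (distr (wlaw ?J) (PiM ?I (\<lambda>_. borel)) (\<lambda>y. \<lambda>a\<in>?I. \<Sum>k\<in>?Ks. v a k * y (l, snd k, fst k, ch a)))"
    by (rule centered_gaussian_channels[where Ch = "{1..Cs (Suc l)}" and w = "\<lambda>k c. (l, snd k, fst k, c)"])
       (use C l wsd_pos Ms[OF l] finite_weights[OF l] in \<open>auto simp: weights_def wsd_def ch_def\<close>)
  moreover have "(if ch a = ch b then (1 / sqrt (lam l))\<^sup>2 * (\<Sum>k\<in>?Ks. v a k * v b k) else 0)
      = kron_cov (emp_cov Cs w l) a b" for a b
    by (cases a, cases b) (simp add: ch_def v_def kron_cov_def emp_cov_scaled_feat[OF l])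
  moreover have "(\<lambda>y. \<lambda>a\<in>?I. \<Sum>k\<in>?Ks. v a k * y (l, snd k, fst k, ch a))
      = (\<lambda>y. out Cs (merge (all_weights Cs - ?J) ?J (w, y)) (Suc l) C)"
  proof (rule ext, rule restrict_ext)
    fix y a assume "a \<in> ?I"
    then obtain i c p where a: "a = (i, c, p)" "c \<in> {1..Cs (Suc l)}" using C by auto
    show "(\<Sum>k\<in>?Ks. v a k * y (l, snd k, fst k, ch a))
        = (case a of (i, c, p) \<Rightarrow> preact Cs N Ms \<sigma> R x (merge (all_weights Cs - ?J) ?J (w, y)) (Suc l) c i p)"
      unfolding a(1) by (simp only: prod.case ch_def v_def preact_merge[OF l, where Cs = Cs, OF a(2)])
  qed
  ultimately show ?thesis by simp
qed

text \<open>On the good event the inner integral is a Gaussian expectation with covariance near the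
  kernel, hence within \<open>e\<close> of the limit by continuity. Elsewhere boundedness of
  \<open>g\<close> costs at most \<open>2 * M\<close> times the probability.\<close>

lemma integral_out_close:
  assumes l: "l \<le> L"
    and gm: "g \<in> borel_measurable (PiM (out_index (Suc l) C) (\<lambda>_. borel))"
    and gc: "continuous_on (PiE (out_index (Suc l) C) (\<lambda>_. UNIV)) g"
    and gb: "\<And>z. z \<in> PiE (out_index (Suc l) C) (\<lambda>_. UNIV) \<Longrightarrow> \<bar>g z\<bar> \<le> M"
    and cg: "centered_gaussian (out_index (Suc l) C) (kron_cov (K (Suc l))) \<mu>" and e: "e > 0"
  obtains d where "d > 0"
    "\<And>Cs. C \<le> Cs (Suc l) \<Longrightarrow>
      \<bar>(\<integral>W. g (out Cs W (Suc l) C) \<partial>wlaw (all_weights Cs)) - (\<integral>z. g z \<partial>\<mu>)\<bar>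
      \<le> e + 2 * M * measure (wlaw (all_weights Cs)) {W \<in> space (wlaw (all_weights Cs)). \<not> close Cs W l d}"
proof -
  let ?I = "out_index (Suc l) C"
  have fI: "finite ?I" by simp
  define m where "m = (\<integral>z. g z \<partial>\<mu>)"
  obtain d where d: "d > 0" and cont:
    "\<And>S \<nu>. centered_gaussian ?I S \<nu> \<Longrightarrow>
       (\<And>k k'. k \<in> ?I \<Longrightarrow> k' \<in> ?I \<Longrightarrow> \<bar>S k k' - kron_cov (K (Suc l)) k k'\<bar> \<le> d) \<Longrightarrow>
       \<bar>(\<integral>z. g z \<partial>\<nu>) - (\<integral>z. g z \<partial>\<mu>)\<bar> \<le> e"
    using centered_gaussian_integral_continuous[OF fI gm gc sub_gaussian_growth_bounded[OF gb] cg e] by blast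
  have m: "\<bar>m\<bar> \<le> M"
  proof -
    interpret prob_space \<mu> by (rule centered_gaussianD[OF cg])
    have "\<bar>m\<bar> \<le> (\<integral>z. \<bar>g z\<bar> \<partial>\<mu>)" unfolding m_def by (rule integral_abs_bound)
    also have "\<dots> \<le> (\<integral>z. M \<partial>\<mu>)"
      using gb centered_gaussian_integrable_bounded[OF cg gm gb]
      by (intro integral_mono integrable_abs) (auto simp: centered_gaussianD(3)[OF cg])
    finally show ?thesis by (simp add: prob_space)
  qed
  have "\<bar>(\<integral>W. g (out Cs W (Suc l) C) \<partial>wlaw (all_weights Cs)) - m\<bar>
      \<le> e + 2 * M * measure (wlaw (all_weights Cs)) {W \<in> space (wlaw (all_weights Cs)). \<not> close Cs W l d}"
    if C: "C \<le> Cs (Suc l)" for Cs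
  proof -
    let ?Q = "wlaw (all_weights Cs)"
    let ?J = "weights Cs l" and ?I' = "all_weights Cs - weights Cs l"
    let ?close = "{W \<in> space ?Q. close Cs W l d}" and ?far = "{W \<in> space ?Q. \<not> close Cs W l d}"
    interpret Q: prob_space ?Q by (rule prob_space_wlaw)
    have cm: "?close \<in> sets ?Q" using close_measurable[OF l] unfolding sets_wlaw space_wlaw .
    have fm: "?far \<in> sets ?Q" using sets.sets_Collect_neg[OF cm] .
    have om: "(\<lambda>W. out Cs W (Suc l) C) \<in> measurable ?Q (PiM ?I (\<lambda>_. borel))"
      unfolding measurable_PiM_centered_normal using out_measurable[of "Suc l" C Cs] l C by simp
    have gom: "(\<lambda>W. g (out Cs W (Suc l) C)) \<in> borel_measurable ?Q"
      by (rule measurable_compose[OF om gm])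
    have gob: "\<bar>g (out Cs W (Suc l) C)\<bar> \<le> M" for W by (intro gb) auto
    \<comment> \<open>Centring at the limit \<open>m\<close> before splitting means that each part
      is itself an error term.\<close>
    define f where "f T W = (g (out Cs W (Suc l) C) - m) * indicator T W" for T W
    have fb: "\<bar>f T W\<bar> \<le> 2 * M * indicator T W" for T W
      using gob[of W] m by (auto simp: f_def indicator_def)
    have M: "0 \<le> M" using m by simp
    have fi: "integrable ?Q (f T)" if "T \<in> sets ?Q" for T
    proof (rule Q.integrable_const_bound[of _ "2 * M"])
      show "AE W in ?Q. norm (f T W) \<le> 2 * M"
      proof (rule AE_I2)
        fix W show "norm (f T W) \<le> 2 * M"
          using gob[of W] m by (auto simp: f_def indicator_def)
      qed
      show "f T \<in> borel_measurable ?Q" unfolding f_def[abs_def] using gom that by measurable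
    qed
    have "(\<integral>W. g (out Cs W (Suc l) C) \<partial>?Q) - m = (\<integral>W. g (out Cs W (Suc l) C) - m \<partial>?Q)"
      using Q.integrable_const_bound[OF AE_I2 gom, of M] gob by (simp add: Q.prob_space)
    also have "\<dots> = (\<integral>W. f ?close W + f ?far W \<partial>?Q)"
      by (intro Bochner_Integration.integral_cong) (auto simp: f_def indicator_def)
    also have "\<dots> = (\<integral>W. f ?close W \<partial>?Q) + (\<integral>W. f ?far W \<partial>?Q)"
      by (intro Bochner_Integration.integral_add fi cm fm)
    finally have split: "(\<integral>W. g (out Cs W (Suc l) C) \<partial>?Q) - m = (\<integral>W. f ?close W \<partial>?Q) + (\<integral>W. f ?far W \<partial>?Q)" .
    have "\<bar>\<integral>W. f ?far W \<partial>?Q\<bar> \<le> (\<integral>W. \<bar>f ?far W\<bar> \<partial>?Q)" by (rule integral_abs_bound)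
    also have "\<dots> \<le> (\<integral>W. 2 * M * indicator ?far W \<partial>?Q)"
      using fm by (intro integral_mono integrable_abs fi fb integrable_mult_right integrable_real_indicator)
        (auto simp: Q.emeasure_eq_measure)
    also have "\<dots> = 2 * M * measure ?Q ?far" using fm by simp
    finally have far: "\<bar>\<integral>W. f ?far W \<partial>?Q\<bar> \<le> 2 * M * measure ?Q ?far" .
    have inner: "\<bar>\<integral>y. f ?close (merge ?I' ?J (w, y)) \<partial>wlaw ?J\<bar> \<le> e" if w: "w \<in> space (wlaw ?I')" for w
    proof (cases "close Cs w l d")
      case False
      then show ?thesis using e close_merge[OF l, of Cs w _ d] by (simp add: f_def)
    next
      case True
      interpret J: prob_space "wlaw ?J" by (rule prob_space_wlaw)
      let ?h = "\<lambda>y. out Cs (merge ?I' ?J (w, y)) (Suc l) C"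
      let ?\<nu> = "distr (wlaw ?J) (PiM ?I (\<lambda>_. borel)) ?h"
      note law = conditional_law_out[OF l, where Cs = Cs, OF C, of w]
      have mm: "(\<lambda>y. merge ?I' ?J (w, y)) \<in> measurable (wlaw ?J) ?Q"
        using measurable_compose[OF measurable_Pair1'[OF w] measurable_merge[of ?I' ?J "\<lambda>j. centered_normal (wsd j)"]]
        unfolding all_weights_split(1)[OF l] .
      have hm: "?h \<in> measurable (wlaw ?J) (PiM ?I (\<lambda>_. borel))"
        by (rule measurable_compose[OF mm om])
      have "f ?close (merge ?I' ?J (w, y)) = g (?h y) - m" if "y \<in> space (wlaw ?J)" for y
        using measurable_space[OF mm that] True close_merge[OF l, of Cs w y d] by (simp add: f_def)
      then have "(\<integral>y. f ?close (merge ?I' ?J (w, y)) \<partial>wlaw ?J) = (\<integral>y. g (?h y) - m \<partial>wlaw ?J)"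
        by (intro Bochner_Integration.integral_cong) auto
      also have "\<dots> = (\<integral>y. g (?h y) \<partial>wlaw ?J) - m"
        using J.integrable_const_bound[OF AE_I2 measurable_compose[OF hm gm], of M] gob
        by (simp add: J.prob_space)
      also have "(\<integral>y. g (?h y) \<partial>wlaw ?J) = (\<integral>z. g z \<partial>?\<nu>)"
        by (rule integral_distr[OF hm gm, symmetric])
      also have "\<bar>\<dots> - m\<bar> \<le> e"
        unfolding m_def
      proof (rule cont[OF law])
        fix k k' assume "k \<in> ?I" "k' \<in> ?I"
        then obtain i c p j c' q where k: "k = (i, c, p)" "k' = (j, c', q)"
          and mem: "(i, p) \<in> pos (Suc l)" "(j, q) \<in> pos (Suc l)" by auto
        have "\<bar>emp_cov Cs w l (i, p) (j, q) - K (Suc l) (i, p) (j, q)\<bar> \<le> d"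
          using True mem unfolding close_def by blast
        then show "\<bar>kron_cov (emp_cov Cs w l) k k' - kron_cov (K (Suc l)) k k'\<bar> \<le> d"
          unfolding k kron_cov_def using d by simp
      qed
      finally show ?thesis .
    qed
    interpret product_prob_space "\<lambda>j. centered_normal (wsd j)" UNIV
      by (intro product_prob_spaceI prob_space_centered_normal wsd_pos)
    interpret I': prob_space "wlaw ?I'" by (rule prob_space_wlaw)
    have "(\<integral>W. f ?close W \<partial>?Q) = (\<integral>w. \<integral>y. f ?close (merge ?I' ?J (w, y)) \<partial>wlaw ?J \<partial>wlaw ?I')"
      using product_integral_fold[of ?I' ?J "f ?close"] fi[OF cm] all_weights_split[OF l, of Cs]
        finite_weights[OF l, of Cs] finite_all_weights[of Cs] by simp
    also have "\<bar>\<dots>\<bar> \<le> e"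
    \<comment> \<open>A non-integrable inner function has integral 0 by default, for which the bound
      is immediate.\<close>
    proof (cases "integrable (wlaw ?I') (\<lambda>w. \<integral>y. f ?close (merge ?I' ?J (w, y)) \<partial>wlaw ?J)")
      case True
      have "\<bar>\<integral>w. \<integral>y. f ?close (merge ?I' ?J (w, y)) \<partial>wlaw ?J \<partial>wlaw ?I'\<bar>
          \<le> (\<integral>w. \<bar>\<integral>y. f ?close (merge ?I' ?J (w, y)) \<partial>wlaw ?J\<bar> \<partial>wlaw ?I')"
        by (rule integral_abs_bound)
      also have "\<dots> \<le> (\<integral>w. e \<partial>wlaw ?I')"
        using True inner by (intro integral_mono integrable_abs) auto
      finally show ?thesis by (simp add: I'.prob_space)
    next
      case False
      then show ?thesis using e by (simp add: not_integrable_integral_eq)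
    qed
    finally have "\<bar>\<integral>W. f ?close W \<partial>?Q\<bar> \<le> e" .
    with far split show ?thesis by linarith
  qed
  with d show ?thesis unfolding m_def by (rule that)
qed

text \<open>Independence and the marginals determine the joint law, which moves the problem from an
  arbitrary probability space to the product space where Fubini is available.\<close>

lemma distr_weights:
  assumes "prob_space M" and ne: "all_weights Cs \<noteq> {}"
    and indep: "prob_space.indep_vars M (\<lambda>_. borel) (\<lambda>k \<omega>. W \<omega> k) (all_weights Cs)"
    and gauss: "\<And>l m c' c. (l, m, c', c) \<in> all_weights Cs \<Longrightarrow>
      distr M borel (\<lambda>\<omega>. W \<omega> (l, m, c', c)) = centered_normal (1 / sqrt (lam l))"
  shows "(\<lambda>\<omega>. \<lambda>k\<in>all_weights Cs. W \<omega> k) \<in> measurable M (PiM (all_weights Cs) (\<lambda>_. borel))"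
    and "distr M (PiM (all_weights Cs) (\<lambda>_. borel)) (\<lambda>\<omega>. \<lambda>k\<in>all_weights Cs. W \<omega> k) = wlaw (all_weights Cs)"
proof -
  interpret prob_space M by fact
  have rv: "(\<lambda>\<omega>. W \<omega> k) \<in> borel_measurable M" if "k \<in> all_weights Cs" for k
    using indep that by (simp add: indep_vars_def2)
  then show "(\<lambda>\<omega>. \<lambda>k\<in>all_weights Cs. W \<omega> k) \<in> measurable M (PiM (all_weights Cs) (\<lambda>_. borel))"
    by (rule measurable_restrict)
  have "distr M (PiM (all_weights Cs) (\<lambda>_. borel)) (\<lambda>\<omega>. \<lambda>k\<in>all_weights Cs. W \<omega> k)
      = PiM (all_weights Cs) (\<lambda>k. distr M borel (\<lambda>\<omega>. W \<omega> k))"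
    using indep by (subst (asm) indep_vars_iff_distr_eq_PiM'[OF ne rv])
  also have "\<dots> = wlaw (all_weights Cs)"
  proof (intro PiM_cong refl)
    fix k assume k: "k \<in> all_weights Cs"
    obtain l m c' c where k': "k = (l, m, c', c)" by (cases k)
    then have "l \<le> L" using k by (simp add: all_weights_def)
    then show "distr M borel (\<lambda>\<omega>. W \<omega> k) = centered_normal (wsd k)"
      using gauss k by (simp add: k' wsd_def)
  qed
  finally show "distr M (PiM (all_weights Cs) (\<lambda>_. borel)) (\<lambda>\<omega>. \<lambda>k\<in>all_weights Cs. W \<omega> k) = wlaw (all_weights Cs)" .
qed

text \<open>A realisation \<open>W \<omega>\<close> also has values outside the weight index set. By
  locality, restricting it to \<open>all_weights Cs\<close> does not change the observed
  preactivations, and then the joint law applies.\<close>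

lemma integral_out_transfer:
  assumes "prob_space M" and ne: "all_weights Cs \<noteq> {}"
    and indep: "prob_space.indep_vars M (\<lambda>_. borel) (\<lambda>k \<omega>. W \<omega> k) (all_weights Cs)"
    and gauss: "\<And>l m c' c. (l, m, c', c) \<in> all_weights Cs \<Longrightarrow>
      distr M borel (\<lambda>\<omega>. W \<omega> (l, m, c', c)) = centered_normal (1 / sqrt (lam l))"
    and l: "l \<le> Suc L" "C \<le> Cs l"
    and gm: "(g :: _ \<Rightarrow> real) \<in> borel_measurable (PiM (out_index l C) (\<lambda>_. borel))"
  shows "(\<integral>\<omega>. g (out Cs (W \<omega>) l C) \<partial>M) = (\<integral>W. g (out Cs W l C) \<partial>wlaw (all_weights Cs))"
proof -
  have "out Cs (W \<omega>) l C = out Cs (\<lambda>k\<in>all_weights Cs. W \<omega> k) l C" for \<omega>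
  proof (rule restrict_ext)
    fix a assume "a \<in> out_index l C"
    then obtain i c p where a: "a = (i, c, p)" "c \<in> {1..Cs l}" using l by auto
    have "preact Cs N Ms \<sigma> R x (W \<omega>) l c i p = preact Cs N Ms \<sigma> R x (\<lambda>k\<in>all_weights Cs. W \<omega> k) l c i p"
    proof (rule preact_cong)
      show "c \<in> {1..Cs l}" by (rule a(2))
    next
      fix k j assume "k < l" "j \<in> weights Cs k"
      then have "j \<in> all_weights Cs" using weights_subset[of k Cs] l by auto
      then show "W \<omega> j = (\<lambda>k\<in>all_weights Cs. W \<omega> k) j" by simp
    qed
    then show "(case a of (i, c, p) \<Rightarrow> preact Cs N Ms \<sigma> R x (W \<omega>) l c i p)
      = (case a of (i, c, p) \<Rightarrow> preact Cs N Ms \<sigma> R x (\<lambda>k\<in>all_weights Cs. W \<omega> k) l c i p)"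
      by (simp add: a)
  qed
  then have "(\<integral>\<omega>. g (out Cs (W \<omega>) l C) \<partial>M) = (\<integral>\<omega>. g (out Cs (\<lambda>k\<in>all_weights Cs. W \<omega> k) l C) \<partial>M)"
    by simp
  also have "\<dots> = (\<integral>W. g (out Cs W l C) \<partial>distr M (PiM (all_weights Cs) (\<lambda>_. borel)) (\<lambda>\<omega>. \<lambda>k\<in>all_weights Cs. W \<omega> k))"
    by (rule integral_distr[symmetric, OF distr_weights(1)[OF assms(1-4)]
          measurable_compose[OF out_measurable[where Cs = Cs, OF l] gm]])
  finally show ?thesis by (simp only: distr_weights(2)[OF assms(1-4)])
qed

end

theorem mainTheorem3:
  fixes L P C0 CL1 :: nat
    and N :: "nat \<Rightarrow> nat"
    and Cs :: "nat \<Rightarrow> nat \<Rightarrow> nat"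
    and \<alpha> :: "nat \<Rightarrow> real"
    and \<sigma> :: "real \<Rightarrow> real"
    and Ms :: "nat \<Rightarrow> 'm set"
    and R :: "nat \<Rightarrow> nat \<Rightarrow> 'm \<Rightarrow> (nat \<Rightarrow> real) \<Rightarrow> real"
    and lam :: "nat \<Rightarrow> real"
    and x :: "nat \<Rightarrow> nat \<Rightarrow> nat \<Rightarrow> real"
    and \<Omega> :: "nat \<Rightarrow> 'o measure"
    and W :: "nat \<Rightarrow> 'o \<Rightarrow> nat \<times> 'm \<times> nat \<times> nat \<Rightarrow> real"
    and r A B :: real
  assumes L: "L \<ge> 1" and P: "P \<ge> 1"
    and C0: "C0 \<ge> 1" and CL1: "CL1 \<ge> 1"
    and N: "\<forall>l \<le> Suc L. N l \<ge> 1"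
    and Cs_fixed: "\<forall>n \<ge> 1. Cs n 0 = C0 \<and> Cs n (Suc L) = CL1"
    and Cs_pos: "\<forall>n \<ge> 1. \<forall>l \<in> {1..L}. Cs n l \<ge> 1"
    and Cs_lim: "\<forall>l \<in> {1..L}. \<alpha> l > 0 \<and> (\<lambda>n. real (Cs n l) / real n) \<longlonglongrightarrow> \<alpha> l"
    and \<sigma>_meas: "\<sigma> \<in> borel_measurable borel"
    and Ms: "\<forall>l \<le> L. finite (Ms l) \<and> Ms l \<noteq> {}"
    and R_meas: "\<forall>l \<le> L. \<forall>i \<in> {1..N (Suc l)}. \<forall>m \<in> Ms l.
                   R l i m \<in> borel_measurable (PiM {1..N l} (\<lambda>_. borel))"
    and lam: "\<forall>l \<le> L. lam l > 0"
    and prob: "\<forall>n \<ge> 1. prob_space (\<Omega> n)"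
    and indep: "\<forall>n \<ge> 1. prob_space.indep_vars (\<Omega> n) (\<lambda>_. borel) (\<lambda>k \<omega>. W n \<omega> k)
                 {(l, m, c', c). l \<le> L \<and> m \<in> Ms l \<and> c' \<in> {1..Cs n l} \<and> c \<in> {1..Cs n (Suc l)}}"
    and gauss: "\<forall>n \<ge> 1. \<forall>l m c' c. l \<le> L \<and> m \<in> Ms l \<and> c' \<in> {1..Cs n l} \<and> c \<in> {1..Cs n (Suc l)} \<longrightarrow>
                 distr (\<Omega> n) borel (\<lambda>\<omega>. W n \<omega> (l, m, c', c))
                   = density lborel (\<lambda>y. ennreal (normal_density 0 (1 / sqrt (lam l)) y))"
    and \<sigma>_cont: "continuous_on UNIV \<sigma>"
    and R_cont: "\<forall>l \<in> {1..L}. \<forall>i \<in> {1..N (Suc l)}. \<forall>m \<in> Ms l.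
                   continuous_on (PiE {1..N l} (\<lambda>_. UNIV)) (R l i m)"
    and r: "0 \<le> r" "r < 2" and AB: "0 < A" "0 < B"
    and growth: "\<forall>l \<in> {1..L}. \<forall>i \<in> {1..N (Suc l)}. \<forall>m \<in> Ms l. \<forall>z \<in> PiE {1..N l} (\<lambda>_. UNIV).
                   \<bar>\<sigma> (R l i m z)\<bar> \<le> A * exp (B * gpow (sqrt (\<Sum>j\<in>{1..N l}. (z j)\<^sup>2)) r)"
  shows "\<forall>l \<in> {1..Suc L}. \<forall>C \<ge> 1. (l = Suc L \<longrightarrow> C \<le> CL1) \<longrightarrow>
           (\<exists>\<mu>. centered_gaussian ({1..N l} \<times> {1..C} \<times> {1..P})
                   (kron_cov (kernel P C0 N Ms lam \<sigma> R x l)) \<mu> \<and>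
                 conv_law ({1..N l} \<times> {1..C} \<times> {1..P}) \<Omega>
                   (\<lambda>n \<omega>. restrict (\<lambda>(i, c, p). preact (Cs n) N Ms \<sigma> R x (W n \<omega>) l c i p)
                           ({1..N l} \<times> {1..C} \<times> {1..P})) \<mu>)"
proof (intro ballI allI impI)
  fix l C
  assume l: "l \<in> {1..Suc L}" and C: "1 \<le> C" and CL: "l = Suc L \<longrightarrow> C \<le> CL1"
  interpret conv_net L P C0 N \<sigma> Ms R lam x r A B
    by standard (use C0 \<sigma>_meas Ms R_meas lam \<sigma>_cont R_cont r AB growth in auto)
  obtain l' where l': "l = Suc l'" "l' \<le> L" using l by (cases l) auto
  let ?I = "{1..N l} \<times> {1..C} \<times> {1..P}"
  obtain \<mu> where cg: "centered_gaussian ?I (kron_cov (K l)) \<mu>"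
    using centered_gaussian_kron_exists[OF _ _ conjunct1[OF kernel_psd_Zlaw[OF l'(2)]]] unfolding l'(1) by blast
  \<comment> \<open>A positive limit of \<open>Cs n k / n\<close> forces the width itself to
    infinity.\<close>
  have top: "filterlim (\<lambda>n. real (Cs n k)) at_top sequentially" if k: "k \<in> {1..L}" for k
  proof -
    have "filterlim (\<lambda>n. real (Cs n k) / real n * real n) at_top sequentially"
      using Cs_lim k by (intro filterlim_tendsto_pos_mult_at_top[of _ "\<alpha> k"] filterlim_real_sequentially) auto
    moreover have "\<forall>\<^sub>F n in sequentially. real (Cs n k) / real n * real n = real (Cs n k)"
      using eventually_gt_at_top[of 0] by eventually_elim simp
    ultimately show ?thesis by (rule filterlim_cong[THEN iffD1, OF refl refl, rotated])
  qed
  have valid: "valid (Cs n)" if "n \<ge> 1" for n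
    using that Cs_fixed Cs_pos by (simp add: valid_def)
  \<comment> \<open>In a hidden layer the \<open>C\<close> observed channels exist only for large
    \<open>n\<close>; in the last layer they exist by the bound \<open>CL1\<close>.\<close>
  have big: "\<forall>\<^sub>F n in sequentially. C \<le> Cs n l"
  proof (cases "l = Suc L")
    case True
    then show ?thesis
      using CL Cs_fixed by (intro eventually_mono[OF eventually_ge_at_top[of 1]]) auto
  next
    case False
    then have "l \<in> {1..L}" using l by auto
    from top[OF this] have "\<forall>\<^sub>F n in sequentially. real C \<le> real (Cs n l)"
      unfolding filterlim_at_top by blast
    then show ?thesis by simp
  qed
  have "conv_law ?I \<Omega> (\<lambda>n \<omega>. out (Cs n) (W n \<omega>) l C) \<mu>"
    unfolding conv_law_def
  proof (intro allI impI)
    fix g :: "(nat \<times> nat \<times> nat \<Rightarrow> real) \<Rightarrow> real"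
    assume gm: "g \<in> borel_measurable (PiM ?I (\<lambda>_. borel))"
      and gb: "bounded (g ` PiE ?I (\<lambda>_. UNIV))" and gc: "continuous_on (PiE ?I (\<lambda>_. UNIV)) g"
    obtain M where M: "M > 0" "\<And>z. z \<in> PiE ?I (\<lambda>_. UNIV) \<Longrightarrow> \<bar>g z\<bar> \<le> M"
      using gb unfolding bounded_pos by auto
    show "(\<lambda>n. \<integral>\<omega>. g (out (Cs n) (W n \<omega>) l C) \<partial>\<Omega> n) \<longlonglongrightarrow> (\<integral>z. g z \<partial>\<mu>)"
    proof (rule tendstoI)
      fix e :: real assume "e > 0"
      then have e2: "e / 2 > 0" by simp
      obtain d where d: "d > 0" and close: "\<And>Cs. C \<le> Cs l \<Longrightarrow>
          \<bar>(\<integral>W. g (out Cs W l C) \<partial>wlaw (all_weights Cs)) - (\<integral>z. g z \<partial>\<mu>)\<bar>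
          \<le> e / 2 + 2 * M * measure (wlaw (all_weights Cs)) {W \<in> space (wlaw (all_weights Cs)). \<not> close Cs W l' d}"
        using integral_out_close[OF l'(2) gm[unfolded l'(1)] gc[unfolded l'(1)] M(2)[unfolded l'(1)]
            cg[unfolded l'(1)] e2] unfolding l'(1) by blast
      let ?p = "\<lambda>n. measure (wlaw (all_weights (Cs n))) {W \<in> space (wlaw (all_weights (Cs n))). \<not> close (Cs n) W l' d}"
      have "\<forall>\<^sub>F n in sequentially. valid (Cs n)"
        using eventually_ge_at_top[of 1] by eventually_elim (rule valid)
      from emp_cov_tendsto_in_prob[OF this top l'(2) d] have "?p \<longlonglongrightarrow> 0" .
      \<comment> \<open>With this threshold the bad event contributes less than
        \<open>e / 2\<close>, matching the \<open>e / 2\<close> spent on the good event.\<close>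
      moreover have "e / (4 * M) > 0" using \<open>e > 0\<close> M(1) by simp
      ultimately have small: "\<forall>\<^sub>F n in sequentially. ?p n < e / (4 * M)" by (rule order_tendstoD(2))
      show "\<forall>\<^sub>F n in sequentially. dist (\<integral>\<omega>. g (out (Cs n) (W n \<omega>) l C) \<partial>\<Omega> n) (\<integral>z. g z \<partial>\<mu>) < e"
        using big small eventually_ge_at_top[of 1]
      proof eventually_elim
        case (elim n)
        have "all_weights (Cs n) \<noteq> {}"
        proof -
          obtain m where "m \<in> Ms 0" using Ms by blast
          moreover have "Cs n 0 \<ge> 1" "Cs n 1 \<ge> 1" using Cs_fixed Cs_pos C0 L elim(3) by auto
          ultimately have "(0, m, 1, 1) \<in> all_weights (Cs n)" by (simp add: all_weights_def)
          then show ?thesis by blast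
        qed
        then have "(\<integral>\<omega>. g (out (Cs n) (W n \<omega>) l C) \<partial>\<Omega> n) = (\<integral>W. g (out (Cs n) W l C) \<partial>wlaw (all_weights (Cs n)))"
          using prob indep gauss elim l gm
          by (intro integral_out_transfer) (auto simp: all_weights_def)
        moreover have "2 * M * ?p n < e / 2"
          using elim(2) M(1) by (simp add: field_simps)
        ultimately show ?case
          using close[where Cs = "Cs n", OF elim(1)] by (simp add: dist_real_def)
      qed
    qed
  qed
  with cg show "\<exists>\<mu>. centered_gaussian ?I (kron_cov (K l)) \<mu> \<and>
      conv_law ?I \<Omega> (\<lambda>n \<omega>. out (Cs n) (W n \<omega>) l C) \<mu>" by blast
qed

end
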